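(* Let $N\ge 1$, let $\Omega\subset\mathbb{R}^N$ be a bounded domain with smooth boundary containing the origin as an interior point. Suppose that for $x\in\bar\Omega$, $m(x)=a_0+\sum_{i=1}^N a_i x_i^2$ with $a_0\in\mathbb{R}$, $a_i\in\mathbb{R}\setminus\{0\}$ for $i=1,\dots,N$, $\sum_{i=1}^N a_i=0$, and $|a_i|=|a_j|>0$ for all $i\ne j$. Assume $0\le V\in C^\gamma(\bar\Omega)$ for some $0<\gamma<1$. Fix $\varepsilon>0$, and for $\alpha>0$ let $u_\alpha$ be the unique normalized principal eigenfunction (see context) associated with $-\varepsilon\Delta\phi-2\alpha\nabla m\cdot\nabla\phi+V\phi=\lambda_\alpha\phi$ in $\Omega$, $\phi=0$ on $\partial\Omega$. Then for all sufficiently large $\alpha>0$ the global maximum point $d_\alpha\in\Omega$ of $u_\alpha$ is unique.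
   Context: Principal eigenpair: for each $\alpha>0$ the problem $-\varepsilon\Delta\phi-2\alpha\nabla m\cdot\nabla\phi+V\phi=\lambda\phi$ in $\Omega$, $\phi=0$ on $\partial\Omega$, has a unique principal (first) eigenvalue $\lambda_\alpha$, with a positive eigenfunction $\phi_\alpha>0$ unique up to multiplication by constants. The normalized principal eigenfunction $u_\alpha$ is the positive multiple of $e^{\frac{\alpha}{\varepsilon}m}\phi_\alpha$ normalized by $\|u_\alpha\|_{L^2(\Omega)}=1$. Equivalently, $u_\alpha>0$ is the positive minimizer in $$\lambda_\alpha=\inf_{\{u\in H_0^1(\Omega),\ \int_\Omega u^2dx=1\}}\Big\{\int_\Omega\varepsilon|\nabla u|^2dx+\int_\Omega\Big[\frac{\alpha^2}{\varepsilon}|\nabla m|^2+\alpha\Delta m+V(x)\Big]u^2dx\Big\},$$ and satisfies $-\varepsilon\Delta u_\alpha+\big[\frac{\alpha^2}{\varepsilon}|\nabla m|^2+\alpha\Delta m+V\big]u_\alpha=\lambda_\alpha u_\alpha$, $u_\alpha\in H_0^1(\Omega)$. *)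

theory Defs
  imports "HOL-Analysis.Analysis"
begin

text \<open>Derivatives are taken at interior points only: every use below is on an open set, so the
  values do not depend on how a function is extended outside its domain.\<close>

definition partial_deriv :: "'n::finite \<Rightarrow> (real^'n \<Rightarrow> real) \<Rightarrow> real^'n \<Rightarrow> real" where
  "partial_deriv i f x = frechet_derivative f (at x) (axis i 1)"

definition grad :: "(real^'n::finite \<Rightarrow> real) \<Rightarrow> real^'n \<Rightarrow> real^'n" where
  "grad f x = (\<chi> i. partial_deriv i f x)"

definition laplacian :: "(real^'n::finite \<Rightarrow> real) \<Rightarrow> real^'n \<Rightarrow> real" where
  "laplacian f x = (\<Sum>i\<in>UNIV. partial_deriv i (partial_deriv i f) x)"

text \<open>\<open>Ck_on k S f\<close>: \<open>f\<close> is of class \<open>C^k\<close> on the open set \<open>S\<close>.\<close>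

primrec Ck_on :: "nat \<Rightarrow> (real^'n::finite) set \<Rightarrow> (real^'n \<Rightarrow> real) \<Rightarrow> bool" where
  "Ck_on 0 S f \<longleftrightarrow> continuous_on S f"
| "Ck_on (Suc k) S f \<longleftrightarrow> f differentiable_on S \<and> (\<forall>i. Ck_on k S (partial_deriv i f))"

definition Cinfty_on :: "(real^'n::finite) set \<Rightarrow> (real^'n \<Rightarrow> real) \<Rightarrow> bool" where
  "Cinfty_on S f \<longleftrightarrow> (\<forall>k. Ck_on k S f)"

text \<open>Near each boundary point the set is, after relabelling and possibly reflecting the
  coordinates, the open epigraph \<open>x\<^sub>i > g\<close> of a smooth function of the remaining
  coordinates.  Such a function is represented by a function on the whole space that does not
  depend on the \<open>i\<close>-th coordinate.\<close>

definition smooth_boundary :: "(real^'n::finite) set \<Rightarrow> bool" where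
  "smooth_boundary \<Omega> \<longleftrightarrow>
    (\<forall>p\<in>frontier \<Omega>. \<exists>r>0. \<exists>i s g.
       s \<in> {-1, 1::real} \<and> Cinfty_on UNIV g \<and>
       (\<forall>x y. (\<forall>j. j \<noteq> i \<longrightarrow> x $ j = y $ j) \<longrightarrow> g x = g y) \<and>
       \<Omega> \<inter> ball p r = {x \<in> ball p r. s * x $ i > g x})"

definition bounded_smooth_domain :: "(real^'n::finite) set \<Rightarrow> bool" where
  "bounded_smooth_domain \<Omega> \<longleftrightarrow>
     \<Omega> \<noteq> {} \<and> open \<Omega> \<and> connected \<Omega> \<and> bounded \<Omega> \<and> smooth_boundary \<Omega>"

definition holder_on :: "real \<Rightarrow> (real^'n::finite) set \<Rightarrow> (real^'n \<Rightarrow> real) \<Rightarrow> bool" where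
  "holder_on \<gamma> S f \<longleftrightarrow> (\<exists>C. \<forall>x\<in>S. \<forall>y\<in>S. \<bar>f x - f y\<bar> \<le> C * dist x y powr \<gamma>)"

text \<open>Classical solutions of
  \<open>- \<epsilon> \<Delta>\<phi> - 2 \<alpha> \<nabla>m \<bullet> \<nabla>\<phi> + V \<phi> = \<mu> \<phi>\<close> in \<open>\<Omega>\<close>,
  \<open>\<phi> = 0\<close> on the boundary, with \<open>\<phi>\<close> not identically zero.\<close>

definition dirichlet_eigenpair ::
  "(real^'n::finite) set \<Rightarrow> real \<Rightarrow> real \<Rightarrow> (real^'n \<Rightarrow> real) \<Rightarrow> (real^'n \<Rightarrow> real)
     \<Rightarrow> real \<Rightarrow> (real^'n \<Rightarrow> real) \<Rightarrow> bool" where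
  "dirichlet_eigenpair \<Omega> \<epsilon> \<alpha> m V \<mu> \<phi> \<longleftrightarrow>
     Ck_on 2 \<Omega> \<phi> \<and> continuous_on (closure \<Omega>) \<phi> \<and> (\<exists>x\<in>\<Omega>. \<phi> x \<noteq> 0) \<and>
     (\<forall>x\<in>\<Omega>. - \<epsilon> * laplacian \<phi> x - 2 * \<alpha> * (grad m x \<bullet> grad \<phi> x) + V x * \<phi> x = \<mu> * \<phi> x) \<and>
     (\<forall>x\<in>frontier \<Omega>. \<phi> x = 0)"

text \<open>The principal eigenvalue is the one that has a positive eigenfunction.\<close>

definition principal_eigenpair ::
  "(real^'n::finite) set \<Rightarrow> real \<Rightarrow> real \<Rightarrow> (real^'n \<Rightarrow> real) \<Rightarrow> (real^'n \<Rightarrow> real)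
     \<Rightarrow> real \<Rightarrow> (real^'n \<Rightarrow> real) \<Rightarrow> bool" where
  "principal_eigenpair \<Omega> \<epsilon> \<alpha> m V \<mu> \<phi> \<longleftrightarrow>
     dirichlet_eigenpair \<Omega> \<epsilon> \<alpha> m V \<mu> \<phi> \<and> (\<forall>x\<in>\<Omega>. \<phi> x > 0)"

definition L2_norm_on :: "(real^'n::finite) set \<Rightarrow> (real^'n \<Rightarrow> real) \<Rightarrow> real" where
  "L2_norm_on \<Omega> u = sqrt (LINT x:\<Omega>|lborel. (u x)\<^sup>2)"

text \<open>\<open>u\<close> is prescribed on the closure of \<open>\<Omega>\<close> only; its values elsewhere are junk.\<close>

definition normalized_principal_eigenfunction ::
  "(real^'n::finite) set \<Rightarrow> real \<Rightarrow> real \<Rightarrow> (real^'n \<Rightarrow> real) \<Rightarrow> (real^'n \<Rightarrow> real)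
     \<Rightarrow> (real^'n \<Rightarrow> real) \<Rightarrow> bool" where
  "normalized_principal_eigenfunction \<Omega> \<epsilon> \<alpha> m V u \<longleftrightarrow>
     (\<exists>\<mu> \<phi> c. principal_eigenpair \<Omega> \<epsilon> \<alpha> m V \<mu> \<phi> \<and> c > 0 \<and>
        (\<forall>x\<in>closure \<Omega>. u x = c * (exp (\<alpha> / \<epsilon> * m x) * \<phi> x)) \<and>
        L2_norm_on \<Omega> u = 1)"

end

theory Submission
  imports Defs
begin

text \<open>Writing \<open>u = exp (\<alpha> m / \<epsilon>) \<phi>\<close> turns the problem into a Schroedinger equation.  The hypotheses on
  the coefficients make \<open>m\<close> harmonic and \<open>|\<nabla>m|\<^sup>2\<close> a multiple of \<open>|x|\<^sup>2\<close>, so after rescaling by the square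
  root of \<open>k = 2 |a\<^sub>i| \<alpha> / \<epsilon>\<close> the function \<open>W\<close> obtained from \<open>u\<close> solves \<open>\<Delta>W = (|y|\<^sup>2 - N + q) W\<close>, a harmonic
  oscillator with a perturbation \<open>q\<close>.  Comparing \<open>W\<close> with quadratic polynomials times the Gaussian \<open>G\<close>
  locates the eigenvalue and gives \<open>q = O(1/k)\<close>, also in Hoelder norm.  Comparison with
  \<open>(1 + \<eta> |y|\<^sup>2) G\<close> bounds \<open>W\<close> by a multiple \<open>K G\<close> that is almost attained near the origin, so Harnack's
  inequality makes \<open>K G - W\<close> uniformly small on a large ball.  A Schauder estimate for second
  differences then transfers the strict concavity of \<open>G\<close> near the origin to \<open>W\<close>, while every
  maximum point lies there; two maximum points would contradict concavity at their midpoint.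

  Both interior estimates come from one identity: for the kernel \<open>\<rho>(z) = (1 - |z|\<^sup>2)\<^sub>+\<^sup>2\<close> the
  \<open>t\<close>-derivative of \<open>\<integral> \<rho>(z) f(x + t z) dz\<close> is \<open>t\<close> times a weighted
  integral of \<open>\<Delta>f\<close> with nonnegative weight.\<close>

section \<open>Calculus of functions of class \<open>C\<^sup>k\<close>\<close>

text \<open>Nothing is obtained by letting \<alpha> tend to infinity. One threshold \<eta>,
  depending only on the dimension and \<gamma>, serves every ground state on every bounded domain
  that contains a fixed ball; \<alpha> enters only by making q smaller than \<eta>. Multiples of
  \<open>W\<close> are not distinguished either: every estimate is relative to \<open>K\<close>. The
  plain Gaussian cannot locate a point of contact. At a maximum of \<open>W / G\<close> the equation
  gives q \<le> 0 but says nothing about where that point lies, while the rescaled domains exhaust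
  the space. The factor \<open>1 + \<eta> |y|^2\<close> costs a relative error of order \<eta> on a
  fixed ball, and in return confines the contact point to \<open>|p|^2 \<le> N\<close>, from where
  Harnack's inequality can start. The eigenvalue is never computed. With q = V/(\<epsilon> k) -
  \<sigma> for an unknown number \<sigma>, the sign of q at one contact point and a lower bound for
  q at another enclose \<sigma> between 0 and a multiple of 1/k. Second differences replace the
  Hessian because the midpoint argument uses nothing else, and because differences of a mean can be
  moved from the function onto the kernel.\<close>

lemma partial_deriv_eq:
  "(f has_derivative f') (at x) \<Longrightarrow> partial_deriv i f x = f' (axis i 1)"
  unfolding partial_deriv_def by (metis frechet_derivative_at)

lemma partial_deriv_cong:
  assumes "open S" "x \<in> S" "\<And>y. y \<in> S \<Longrightarrow> f y = g y"
  shows "partial_deriv i f x = partial_deriv i g x"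
proof -
  have "(f has_derivative f') (at x) \<longleftrightarrow> (g has_derivative f') (at x)" for f'
    using assms has_derivative_transform_within_open[of f f' x UNIV S g]
      has_derivative_transform_within_open[of g f' x UNIV S f] by auto
  then show ?thesis
    unfolding partial_deriv_def frechet_derivative_def by simp
qed

lemma Ck_on_cong:
  assumes "open S" "\<And>x. x \<in> S \<Longrightarrow> f x = g x"
  shows "Ck_on k S f \<longleftrightarrow> Ck_on k S g"
  using assms(2)
proof (induction k arbitrary: f g)
  case 0
  then show ?case by (simp cong: continuous_on_cong)
next
  case (Suc k)
  have "Ck_on k S (partial_deriv i f) \<longleftrightarrow> Ck_on k S (partial_deriv i g)" for i
    by (rule Suc.IH) (rule partial_deriv_cong[OF assms(1)], auto intro: Suc.prems)
  moreover have "f differentiable_on S \<longleftrightarrow> g differentiable_on S"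
    using Suc.prems
    by (metis (no_types, lifting) differentiable_on_def differentiable_transform_within zero_less_one)
  ultimately show ?case by simp
qed

lemma Ck_on_SucD: "Ck_on (Suc k) S f \<Longrightarrow> Ck_on k S f"
proof (induction k arbitrary: f)
  case 0
  then show ?case by (simp add: differentiable_imp_continuous_on)
next
  case (Suc k)
  then show ?case by (metis Ck_on.simps(2))
qed

lemma Ck_on_subset: "Ck_on k S f \<Longrightarrow> T \<subseteq> S \<Longrightarrow> Ck_on k T f"
  by (induction k arbitrary: f) (auto intro: continuous_on_subset differentiable_on_subset)

lemma Ck_on_const [simp]: "Ck_on k S (\<lambda>x. c)"
proof (induction k arbitrary: c)
  case (Suc k)
  have "partial_deriv i (\<lambda>x. c) = (\<lambda>x. 0)" for i :: 'a
    by (rule ext, subst partial_deriv_eq[OF has_derivative_const]) simp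
  then show ?case using Suc by simp
qed simp

lemma partial_deriv_const [simp]: "partial_deriv i (\<lambda>x. c) x = 0"
  by (subst partial_deriv_eq[OF has_derivative_const]) simp

lemma laplacian_const [simp]: "laplacian (\<lambda>x :: real^'n::finite. c) x = 0"
proof -
  have "partial_deriv i (\<lambda>x. c) = (\<lambda>x. 0)" for i :: 'n and c
    by (rule ext, subst partial_deriv_eq[OF has_derivative_const]) simp
  then show ?thesis by (simp add: laplacian_def)
qed

lemma partial_deriv_coord: "partial_deriv j (\<lambda>x. x $ i) x = (if i = j then 1 else 0)"
  by (subst partial_deriv_eq[OF bounded_linear_imp_has_derivative[OF bounded_linear_vec_nth]])
     (simp add: axis_def)

context
  fixes S :: "(real^'n::finite) set"
  assumes S: "open S"
begin

text \<open>Each stage of \<open>Ck_on\<close> demands total differentiability, so the derivative is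
  linear and its values on the coordinate axes determine it. All later differentiation rules come
  from this explicit form.\<close>

lemma Ck_on_has_derivative:
  assumes "Ck_on (Suc k) S f" "x \<in> S"
  shows "(f has_derivative (\<lambda>h. \<Sum>i\<in>UNIV. partial_deriv i f x * h $ i)) (at x)"
proof -
  obtain f' where f': "(f has_derivative f') (at x)"
    using assms S by (auto simp: differentiable_on_eq_differentiable_at differentiable_def)
  interpret bounded_linear f' using f' by (rule has_derivative_bounded_linear)
  have "f' h = (\<Sum>i\<in>UNIV. partial_deriv i f x * h $ i)" for h
  proof -
    have "f' h = f' (\<Sum>i\<in>UNIV. h $ i *\<^sub>R axis i 1)"
      by (simp add: basis_expansion flip: scalar_mult_eq_scaleR)
    also have "\<dots> = (\<Sum>i\<in>UNIV. partial_deriv i f x * h $ i)"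
      by (simp add: sum scaleR partial_deriv_eq[OF f'] mult.commute)
    finally show ?thesis .
  qed
  with f' show ?thesis by (metis (no_types, lifting) ext)
qed

lemma Ck_on_SucI:
  assumes "\<And>x. x \<in> S \<Longrightarrow> (f has_derivative (\<lambda>h. \<Sum>i\<in>UNIV. D i x * h $ i)) (at x)"
    and "\<And>i. Ck_on k S (D i)"
  shows "Ck_on (Suc k) S f" and "\<And>i x. x \<in> S \<Longrightarrow> partial_deriv i f x = D i x"
proof -
  show *: "partial_deriv i f x = D i x" if "x \<in> S" for i x
    by (subst partial_deriv_eq[OF assms(1)[OF that]])
       (simp add: axis_def if_distrib[of "\<lambda>y. _ * y"] cong: if_cong)
  have "Ck_on k S (partial_deriv i f)" for i
    using assms(2)[of i] Ck_on_cong[OF S, of "partial_deriv i f" "D i"] * by blast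
  moreover have "f differentiable_on S"
    using assms(1) S by (auto simp: differentiable_on_eq_differentiable_at differentiable_def)
  ultimately show "Ck_on (Suc k) S f" by simp
qed

lemma partial_deriv_add:
  assumes "Ck_on (Suc k) S f" "Ck_on (Suc k) S g" "x \<in> S"
  shows "partial_deriv i (\<lambda>x. f x + g x) x = partial_deriv i f x + partial_deriv i g x"
  by (subst partial_deriv_eq[OF has_derivative_add[OF Ck_on_has_derivative[OF assms(1,3)] Ck_on_has_derivative[OF assms(2,3)]]])
     (simp add: axis_def if_distrib[of "\<lambda>y. _ * y"] cong: if_cong)

lemma partial_deriv_mult:
  assumes "Ck_on (Suc k) S f" "Ck_on (Suc k) S g" "x \<in> S"
  shows "partial_deriv i (\<lambda>x. f x * g x) x = f x * partial_deriv i g x + partial_deriv i f x * g x"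
  by (subst partial_deriv_eq[OF has_derivative_mult[OF Ck_on_has_derivative[OF assms(1,3)] Ck_on_has_derivative[OF assms(2,3)]]])
     (simp add: axis_def if_distrib[of "\<lambda>y. _ * y"] cong: if_cong)

lemma partial_deriv_exp:
  assumes "Ck_on (Suc k) S f" "x \<in> S"
  shows "partial_deriv i (\<lambda>x. exp (f x)) x = exp (f x) * partial_deriv i f x"
  by (subst partial_deriv_eq[OF has_derivative_exp[OF Ck_on_has_derivative[OF assms]]])
     (simp add: axis_def if_distrib[of "\<lambda>y. _ * y"] cong: if_cong)

lemma Ck_on_add: "Ck_on k S f \<Longrightarrow> Ck_on k S g \<Longrightarrow> Ck_on k S (\<lambda>x. f x + g x)"
proof (induction k arbitrary: f g)
  case 0
  then show ?case by (simp add: continuous_on_add)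
next
  case (Suc k)
  have "Ck_on k S (partial_deriv i (\<lambda>x. f x + g x))" for i
    using Suc Ck_on_cong[OF S partial_deriv_add[OF Suc.prems]] by simp
  with Suc.prems show ?case by simp
qed

lemma Ck_on_mult: "Ck_on k S f \<Longrightarrow> Ck_on k S g \<Longrightarrow> Ck_on k S (\<lambda>x. f x * g x)"
proof (induction k arbitrary: f g)
  case 0
  then show ?case by (simp add: continuous_on_mult)
next
  case (Suc k)
  have "Ck_on k S (partial_deriv i (\<lambda>x. f x * g x))" for i
    using Ck_on_cong[OF S partial_deriv_mult[OF Suc.prems]] Suc.prems
    by (simp add: Suc.IH Ck_on_add Ck_on_SucD)
  with Suc.prems show ?case by simp
qed

lemma Ck_on_exp: "Ck_on k S f \<Longrightarrow> Ck_on k S (\<lambda>x. exp (f x))"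
proof (induction k arbitrary: f)
  case 0
  then show ?case by (simp add: continuous_on_exp)
next
  case (Suc k)
  have "Ck_on k S (partial_deriv i (\<lambda>x. exp (f x)))" for i
    using Ck_on_cong[OF S partial_deriv_exp[OF Suc.prems]] Suc.prems Suc.IH[of f]
    by (simp add: Ck_on_mult Ck_on_SucD)
  moreover have "(\<lambda>x. exp (f x)) differentiable_on S"
    using has_derivative_exp[OF Ck_on_has_derivative[OF Suc.prems]]
    by (meson S differentiable_on_eq_differentiable_at differentiable_def)
  ultimately show ?case by simp
qed

lemma Ck_on_cmult: "Ck_on k S f \<Longrightarrow> Ck_on k S (\<lambda>x. c * f x)"
  by (simp add: Ck_on_mult)

lemma Ck_on_sum: "(\<And>i. i \<in> I \<Longrightarrow> Ck_on k S (f i)) \<Longrightarrow> Ck_on k S (\<lambda>x. \<Sum>i\<in>I. f i x)"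
  by (induction I rule: infinite_finite_induct) (auto simp: Ck_on_add)

lemma Ck_on_coord: "Ck_on k S (\<lambda>x. x $ i)"
proof (cases k)
  case (Suc k)
  show ?thesis unfolding Suc
  proof (rule Ck_on_SucI)
    show "((\<lambda>x. x $ i) has_derivative (\<lambda>h. \<Sum>j\<in>UNIV. (if j = i then 1 else 0) * h $ j)) (at x)" for x :: "real^'n"
      by (rule has_derivative_eq_rhs[OF bounded_linear_imp_has_derivative[OF bounded_linear_vec_nth]])
         (simp add: if_distrib[of "\<lambda>y. y * _"] cong: if_cong)
  qed simp
qed (simp add: continuous_on_component)

lemma laplacian_add:
  assumes "Ck_on 2 S f" "Ck_on 2 S g" "x \<in> S"
  shows "laplacian (\<lambda>x. f x + g x) x = laplacian f x + laplacian g x"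
proof -
  have fg: "Ck_on (Suc (Suc 0)) S f" "Ck_on (Suc (Suc 0)) S g" using assms by (simp_all add: numeral_2_eq_2)
  have "partial_deriv i (partial_deriv i (\<lambda>x. f x + g x)) x
    = partial_deriv i (partial_deriv i f) x + partial_deriv i (partial_deriv i g) x" for i
    using partial_deriv_cong[OF S assms(3) partial_deriv_add[OF fg, where i = i], where i = i] fg assms(3)
      partial_deriv_add[of 0 "partial_deriv i f" "partial_deriv i g" x i] by (simp del: partial_deriv_const)
  then show ?thesis by (simp add: laplacian_def sum.distrib)
qed

lemma laplacian_mult:
  assumes "Ck_on 2 S f" "Ck_on 2 S g" "x \<in> S"
  shows "laplacian (\<lambda>x. f x * g x) x
    = f x * laplacian g x + 2 * (grad f x \<bullet> grad g x) + laplacian f x * g x"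
proof -
  have fg: "Ck_on (Suc (Suc 0)) S f" "Ck_on (Suc (Suc 0)) S g" using assms by (simp_all add: numeral_2_eq_2)
  note fg' = fg[THEN Ck_on_SucD]
  have C: "Ck_on (Suc 0) S (partial_deriv i f)" "Ck_on (Suc 0) S (partial_deriv i g)" for i
    using fg by simp_all
  have "partial_deriv i (partial_deriv i (\<lambda>x. f x * g x)) x
    = f x * partial_deriv i (partial_deriv i g) x + 2 * (partial_deriv i f x * partial_deriv i g x)
      + partial_deriv i (partial_deriv i f) x * g x" for i
  proof -
    have "partial_deriv i (partial_deriv i (\<lambda>x. f x * g x)) x
      = partial_deriv i (\<lambda>x. f x * partial_deriv i g x + partial_deriv i f x * g x) x"
      by (rule partial_deriv_cong[OF S assms(3)]) (rule partial_deriv_mult[OF fg])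
    also have "\<dots> = f x * partial_deriv i (partial_deriv i g) x + 2 * (partial_deriv i f x * partial_deriv i g x)
      + partial_deriv i (partial_deriv i f) x * g x"
      unfolding partial_deriv_add[OF Ck_on_mult[OF fg'(1) C(2)] Ck_on_mult[OF C(1) fg'(2)] assms(3)]
        partial_deriv_mult[OF fg'(1) C(2) assms(3)] partial_deriv_mult[OF C(1) fg'(2) assms(3)]
      by (simp add: algebra_simps)
    finally show ?thesis .
  qed
  then show ?thesis
    by (simp add: laplacian_def grad_def inner_vec_def sum.distrib sum_distrib_left sum_distrib_right)
qed

lemma laplacian_cmult:
  assumes "Ck_on 2 S f" "x \<in> S"
  shows "laplacian (\<lambda>x. c * f x) x = c * laplacian f x"
proof -
  have "grad (\<lambda>x. c) x = 0" 
    unfolding grad_def by (subst partial_deriv_eq[OF has_derivative_const]) (simp add: vec_eq_iff)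
  then show ?thesis
    using laplacian_mult[OF Ck_on_const assms, of c] by simp
qed

lemma laplacian_exp:
  assumes "Ck_on 2 S f" "x \<in> S"
  shows "laplacian (\<lambda>x. exp (f x)) x = exp (f x) * (laplacian f x + (norm (grad f x))\<^sup>2)"
proof -
  have f: "Ck_on (Suc (Suc 0)) S f" using assms by (simp add: numeral_2_eq_2)
  note f' = f[THEN Ck_on_SucD]
  have C: "Ck_on (Suc 0) S (partial_deriv i f)" for i using f by simp
  have "partial_deriv i (partial_deriv i (\<lambda>x. exp (f x))) x
    = exp (f x) * (partial_deriv i (partial_deriv i f) x + partial_deriv i f x * partial_deriv i f x)" for i
    using partial_deriv_cong[OF S assms(2) partial_deriv_exp[OF f, where i = i], where i = i]
    by (simp add: partial_deriv_mult[OF Ck_on_exp[OF f'] C assms(2)] partial_deriv_exp[OF f' assms(2)] algebra_simps)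
  then show ?thesis
    by (simp add: laplacian_def grad_def power2_norm_eq_inner inner_vec_def sum.distrib sum_distrib_left algebra_simps)
qed

end

lemma laplacian_cong:
  assumes "open S" "x \<in> S" "\<And>y. y \<in> S \<Longrightarrow> f y = g y"
  shows "laplacian f x = laplacian g x"
  unfolding laplacian_def
  by (intro sum.cong refl partial_deriv_cong[OF assms(1,2)] partial_deriv_cong[OF assms(1)] assms(3))

section \<open>Dilations and diagonal quadratic polynomials\<close>

lemma partial_deriv_scale:
  assumes "f differentiable at (c *\<^sub>R x)"
  shows "partial_deriv i (\<lambda>x. f (c *\<^sub>R x)) x = c * partial_deriv i f (c *\<^sub>R x)"
proof -
  obtain f' where f': "(f has_derivative f') (at (c *\<^sub>R x))" using assms by (auto simp: differentiable_def)
  interpret bounded_linear f' using f' by (rule has_derivative_bounded_linear)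
  have "((\<lambda>x. f (c *\<^sub>R x)) has_derivative (\<lambda>h. f' (c *\<^sub>R h))) (at x)"
    by (rule has_derivative_compose[of "\<lambda>x. c *\<^sub>R x", OF _ f']) (auto intro!: derivative_eq_intros)
  from partial_deriv_eq[OF this] partial_deriv_eq[OF f'] show ?thesis by (simp add: scaleR)
qed

lemma Ck_on_scale:
  assumes "open S" "Ck_on k S f"
  shows "Ck_on k {x. c *\<^sub>R x \<in> S} (\<lambda>x. f (c *\<^sub>R x))"
  using assms(2)
proof (induction k arbitrary: f)
  case 0
  then show ?case
    by (auto intro!: continuous_on_compose2[of S f] continuous_intros)
next
  case (Suc k)
  let ?S = "{x. c *\<^sub>R x \<in> S}"
  have S: "open ?S"
    using open_vimage[OF assms(1), of "\<lambda>x. c *\<^sub>R x"] by (simp add: vimage_def continuous_on_scaleR)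
  have d: "f differentiable at (c *\<^sub>R x)" if "x \<in> ?S" for x
    using Suc.prems that assms(1) by (auto simp: differentiable_on_eq_differentiable_at)
  have "Ck_on k ?S (partial_deriv i (\<lambda>x. f (c *\<^sub>R x)))" for i
    using Ck_on_cong[OF S partial_deriv_scale[OF d]] Ck_on_cmult[OF S] Suc by simp
  moreover have "(\<lambda>x. f (c *\<^sub>R x)) differentiable_on ?S"
  proof (clarsimp simp: differentiable_on_eq_differentiable_at[OF S])
    fix x assume "c *\<^sub>R x \<in> S"
    then obtain f' where f': "(f has_derivative f') (at (c *\<^sub>R x))" using d by (auto simp: differentiable_def)
    show "(\<lambda>x. f (c *\<^sub>R x)) differentiable at x"
      by (rule differentiableI, rule has_derivative_compose[of "\<lambda>x. c *\<^sub>R x", OF _ f']) (auto intro!: derivative_eq_intros)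
  qed
  ultimately show ?case by simp
qed

lemma laplacian_scale:
  assumes "open S" "Ck_on 2 S f" "c *\<^sub>R x \<in> S"
  shows "laplacian (\<lambda>x. f (c *\<^sub>R x)) x = c\<^sup>2 * laplacian f (c *\<^sub>R x)"
proof -
  let ?S = "{x. c *\<^sub>R x \<in> S}"
  have S: "open ?S"
    using open_vimage[OF assms(1), of "\<lambda>x. c *\<^sub>R x"] by (simp add: vimage_def continuous_on_scaleR)
  have d: "f differentiable at (c *\<^sub>R x)" "partial_deriv i f differentiable at (c *\<^sub>R x)" if "x \<in> ?S" for x i
    using assms(1,2) that by (auto simp: differentiable_on_eq_differentiable_at numeral_2_eq_2)
  have C: "Ck_on (Suc 0) ?S (\<lambda>x. partial_deriv i f (c *\<^sub>R x))" for i
    using Ck_on_scale[OF assms(1), of "Suc 0" "partial_deriv i f"] assms(2) by (simp add: numeral_2_eq_2)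
  have x: "x \<in> ?S" using assms(3) by simp
  have "partial_deriv i (partial_deriv i (\<lambda>x. f (c *\<^sub>R x))) x
      = c\<^sup>2 * partial_deriv i (partial_deriv i f) (c *\<^sub>R x)" for i
  proof -
    have "partial_deriv i (partial_deriv i (\<lambda>x. f (c *\<^sub>R x))) x
       = partial_deriv i (\<lambda>x. c * partial_deriv i f (c *\<^sub>R x)) x"
      by (rule partial_deriv_cong[OF S x partial_deriv_scale[OF d(1)]])
    also have "\<dots> = c * partial_deriv i (\<lambda>x. partial_deriv i f (c *\<^sub>R x)) x"
      by (subst partial_deriv_mult[OF S Ck_on_const C x]) simp
    also have "\<dots> = c * (c * partial_deriv i (partial_deriv i f) (c *\<^sub>R x))"
      by (simp add: partial_deriv_scale[OF d(2)[OF x]])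
    finally show ?thesis by (simp add: power2_eq_square)
  qed
  then show ?thesis by (simp add: laplacian_def sum_distrib_left)
qed

lemma Ck_on_quadratic: "Ck_on k UNIV (\<lambda>x::real^'n. c + (\<Sum>i\<in>UNIV. b $ i * (x $ i)\<^sup>2))"
  unfolding power2_eq_square
  by (intro Ck_on_add Ck_on_sum Ck_on_mult Ck_on_const Ck_on_coord open_UNIV)

lemma partial_deriv_quadratic:
  "partial_deriv j (\<lambda>x::real^'n. c + (\<Sum>i\<in>UNIV. b $ i * (x $ i)\<^sup>2)) x = 2 * b $ j * x $ j"
proof -
  have "((\<lambda>x::real^'n. c + (\<Sum>i\<in>UNIV. b $ i * (x $ i)\<^sup>2)) has_derivative
      (\<lambda>h. \<Sum>i\<in>UNIV. b $ i * (2 * x $ i * h $ i))) (at x)"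
    by (auto intro!: derivative_eq_intros bounded_linear_imp_has_derivative bounded_linear_vec_nth simp: algebra_simps)
  from partial_deriv_eq[OF this] show ?thesis
    by (simp add: axis_def if_distrib[of "\<lambda>y. _ * y"] cong: if_cong)
qed

lemma grad_quadratic:
  "grad (\<lambda>x::real^'n. c + (\<Sum>i\<in>UNIV. b $ i * (x $ i)\<^sup>2)) x = (\<chi> i. 2 * b $ i * x $ i)"
  by (simp add: grad_def partial_deriv_quadratic)

lemma laplacian_quadratic:
  "laplacian (\<lambda>x::real^'n. c + (\<Sum>i\<in>UNIV. b $ i * (x $ i)\<^sup>2)) x = 2 * (\<Sum>i\<in>UNIV. b $ i)"
proof -
  have "partial_deriv j (\<lambda>x::real^'n. 2 * b $ j * x $ j) x = 2 * b $ j" for j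
    by (subst partial_deriv_mult[OF open_UNIV Ck_on_const Ck_on_coord[OF open_UNIV]])
       (simp_all add: partial_deriv_coord)
  then show ?thesis
    unfolding laplacian_def partial_deriv_quadratic[abs_def] by (simp add: sum_distrib_left)
qed

section \<open>Maximum principle and comparison with Gaussians\<close>

text \<open>Already each pure second derivative is nonpositive: if one were positive, the first
  derivative along that axis, zero at the maximum, would become positive just after it, and the mean
  value theorem would produce a larger value.\<close>

lemma laplacian_nonpos_at_max:
  fixes f :: "real^'n::finite \<Rightarrow> real"
  assumes S: "open S" and f: "Ck_on 2 S f" and p: "p \<in> S" and max: "\<And>x. x \<in> S \<Longrightarrow> f x \<le> f p"
  shows "laplacian f p \<le> 0"
proof -
  have f2: "Ck_on (Suc (Suc 0)) S f" using f by (simp add: numeral_2_eq_2)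
  have "partial_deriv i (partial_deriv i f) p \<le> 0" for i
  proof (rule ccontr)
    assume pos: "\<not> ?thesis"
    obtain r where r: "r > 0" "ball p r \<subseteq> S" using S p openE by blast
    define c where "c t = p + t *\<^sub>R axis i 1" for t :: real
    have c: "c t \<in> S" if "\<bar>t\<bar> < r" for t
      using r(2) that by (auto simp: c_def dist_norm subset_iff)
    have line: "((\<lambda>t. h (c t)) has_real_derivative partial_deriv i h (c t)) (at t)"
      if "\<bar>t\<bar> < r" "Ck_on (Suc k) S h" for t h k
    proof -
      have "((\<lambda>t. h (c t)) has_derivative (\<lambda>s. \<Sum>j\<in>UNIV. partial_deriv j h (c t) * (s *\<^sub>R axis i 1) $ j)) (at t)"
        by (rule has_derivative_compose[of c, OF _ Ck_on_has_derivative[OF S that(2) c[OF that(1)]]])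
          (unfold c_def, auto intro!: derivative_eq_intros)
      then show ?thesis
        by (simp add: has_field_derivative_def axis_def if_distrib[of "\<lambda>y. _ * y"] mult.commute[of _ "partial_deriv i h (c t)"] cong: if_cong)
    qed
    have c0: "c 0 = p" by (simp add: c_def)
    have C1: "Ck_on (Suc 0) S (partial_deriv i f)" using f2 by simp
    have "partial_deriv i f (c 0) = 0"
      by (rule DERIV_local_max[OF line[OF _ f2] r(1)]) (use max c r in \<open>auto simp: c0\<close>)
    moreover obtain d where d: "d > 0" "\<And>h. 0 < h \<Longrightarrow> h < d \<Longrightarrow> partial_deriv i f (c 0) < partial_deriv i f (c h)"
      using DERIV_pos_inc_right[OF line[OF _ C1, of 0]] pos r(1) c0 by auto
    ultimately have dp: "partial_deriv i f (c h) > 0" if "0 < h" "h < d" for h using that by simp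
    define e where "e = min d r / 2"
    have e: "0 < e" "e < d" "e < r" using d(1) r(1) by (auto simp: e_def)
    obtain z where "0 < z" "z < e" "f (c e) - f (c 0) = (e - 0) * partial_deriv i f (c z)"
      using MVT2[of 0 e "\<lambda>t. f (c t)" "\<lambda>t. partial_deriv i f (c t)"] e line[OF _ f2] by auto
    with dp[of z] e have "f (c e) > f (c 0)" by (metis diff_gt_0_iff_gt diff_zero less_trans mult_pos_pos)
    moreover have "f (c e) \<le> f p" using max c e by simp
    ultimately show False by (simp add: c0)
  qed
  then show ?thesis by (simp add: laplacian_def sum_nonpos)
qed

section \<open>The Gaussian and its quadratic perturbations\<close>

definition gauss :: "real^'n::finite \<Rightarrow> real" where
  "gauss x = exp (- (norm x)\<^sup>2 / 2)"

lemma gauss_pos [simp]: "gauss x > 0" and gauss_le_1: "gauss x \<le> 1"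
  by (simp_all add: gauss_def)

lemma continuous_on_gauss: "continuous_on S gauss"
  unfolding gauss_def by (intro continuous_intros) auto

lemma quadratic_norm: "c + b * (norm x)\<^sup>2 = c + (\<Sum>i\<in>UNIV. (\<chi> i::'n::finite. b) $ i * (x $ i)\<^sup>2)"
  by (simp only: power2_norm_eq_inner) (simp add: inner_vec_def sum_distrib_left power2_eq_square)

lemma Ck_on_quadratic_norm: "Ck_on k UNIV (\<lambda>x::real^'n::finite. c + b * (norm x)\<^sup>2)"
  unfolding quadratic_norm by (rule Ck_on_quadratic)

lemma Ck_on_gauss: "Ck_on k UNIV (gauss :: real^'n::finite \<Rightarrow> real)"
  using Ck_on_exp[OF open_UNIV Ck_on_quadratic_norm[of k 0 "-1/2"]] by (simp add: gauss_def[abs_def])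

lemma Ck_on_quadratic_gauss: "Ck_on k UNIV (\<lambda>x::real^'n::finite. (c + b * (norm x)\<^sup>2) * gauss x)"
  by (intro Ck_on_mult open_UNIV Ck_on_quadratic_norm Ck_on_gauss)

text \<open>The first summand is the oscillator potential acting on the function itself, so
  \<open>gauss\<close> is an exact solution (c = 1, b = 0). The second is the defect caused by b;
  its change of sign at \<open>(norm x)^2 = N / 2\<close>, N the dimension, is what confines contact
  points.\<close>

lemma laplacian_quadratic_gauss:
  "laplacian (\<lambda>x::real^'n::finite. (c + b * (norm x)\<^sup>2) * gauss x) x
    = (((norm x)\<^sup>2 - CARD('n)) * (c + b * (norm x)\<^sup>2) + b * (2 * CARD('n) - 4 * (norm x)\<^sup>2)) * gauss x"
proof -
  have g: "grad (\<lambda>x::real^'n. c + b * (norm x)\<^sup>2) x = (2 * b) *\<^sub>R x" for c b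
    unfolding quadratic_norm grad_quadratic by (simp add: vec_eq_iff)
  have l: "laplacian (\<lambda>x::real^'n. c + b * (norm x)\<^sup>2) x = 2 * CARD('n) * b" for c b :: real
    unfolding quadratic_norm laplacian_quadratic by simp
  have ge: "gauss = (\<lambda>x::real^'n. exp (0 + (-1/2) * (norm x)\<^sup>2))" by (simp add: gauss_def[abs_def])
  have lg: "laplacian (gauss :: real^'n \<Rightarrow> real) x = ((norm x)\<^sup>2 - CARD('n)) * gauss x"
    unfolding ge laplacian_exp[OF open_UNIV Ck_on_quadratic_norm UNIV_I] g l
    by (simp add: power_mult_distrib)
  have gg: "grad (gauss :: real^'n \<Rightarrow> real) x = - gauss x *\<^sub>R x"
    unfolding ge grad_def partial_deriv_exp[OF open_UNIV Ck_on_quadratic_norm UNIV_I]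
    using g[of 0 "-1/2"] by (simp add: grad_def vec_eq_iff)
  show ?thesis
    by (subst laplacian_mult[OF open_UNIV Ck_on_quadratic_norm Ck_on_gauss])
      (simp_all only: UNIV_I g l lg gg, simp add: algebra_simps power2_norm_eq_inner)
qed

text \<open>The dimension is split off because it is the ground energy of the unperturbed
  oscillator: q = 0 is the equation of \<open>gauss\<close>. The eigenvalue and the potential
  \<open>V\<close> are both hidden in q.\<close>

locale oscillator_ground_state =
  fixes S :: "(real^'n::finite) set" and W q :: "real^'n \<Rightarrow> real"
  assumes S: "open S" "bounded S" "S \<noteq> {}"
    and W: "Ck_on 2 S W" "continuous_on (closure S) W"
    and W_pos: "\<And>x. x \<in> S \<Longrightarrow> W x > 0"
    and W_frontier: "\<And>x. x \<in> frontier S \<Longrightarrow> W x = 0"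
    and eqn: "\<And>x. x \<in> S \<Longrightarrow> laplacian W x = ((norm x)\<^sup>2 - CARD('n) + q x) * W x"
begin

lemma closure_cases: "x \<in> closure S \<Longrightarrow> x \<in> S \<or> W x = 0"
  using W_frontier S(1) by (auto simp: frontier_def interior_open)

text \<open>At a maximum p of W divided by the trial function, W minus K times that function has
  maximum value 0, so its Laplacian is nonpositive there. The oscillator terms agree at p and
  cancel; only q and the defect remain. Boundary points are excluded because W vanishes on
  them.\<close>

lemma ratio_max:
  assumes b: "b \<ge> 0"
  obtains p K where "p \<in> S" "K > 0" "W p = K * ((1 + b * (norm p)\<^sup>2) * gauss p)"
    "\<And>x. x \<in> closure S \<Longrightarrow> W x \<le> K * ((1 + b * (norm x)\<^sup>2) * gauss x)"
    "q p * (1 + b * (norm p)\<^sup>2) \<le> b * (2 * CARD('n) - 4 * (norm p)\<^sup>2)"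
proof -
  define B where "B x = (1 + b * (norm x)\<^sup>2) * gauss x" for x :: "real^'n"
  have Bpos: "B x > 0" for x using b by (simp add: B_def add_pos_nonneg)
  have "continuous_on (closure S) (\<lambda>x. W x / B x)"
    unfolding B_def
    by (intro continuous_intros W continuous_on_gauss) (metis B_def Bpos less_irrefl)
  then obtain p where p: "p \<in> closure S" "\<And>x. x \<in> closure S \<Longrightarrow> W x / B x \<le> W p / B p"
    using continuous_attains_sup[of "closure S" "\<lambda>x. W x / B x"] S by (metis closure_eq_empty compact_closure)
  define K where "K = W p / B p"
  obtain x0 where x0: "x0 \<in> S" using S by blast
  have "0 < W x0 / B x0" using W_pos[OF x0] Bpos by simp
  also have "\<dots> \<le> K" unfolding K_def using p(2) x0 closure_subset by blast
  finally have K: "K > 0" .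
  have pS: "p \<in> S" using closure_cases[OF p(1)] K by (auto simp: K_def)
  have Wp: "W p = K * B p" using Bpos[of p] by (simp add: K_def)
  have le: "W x \<le> K * B x" if "x \<in> closure S" for x
    using p(2)[OF that] Bpos[of x] unfolding K_def[symmetric] by (simp add: divide_le_eq)
  have BC: "Ck_on 2 S B" unfolding B_def[abs_def] by (rule Ck_on_subset[OF Ck_on_quadratic_gauss]) simp
  have "laplacian (\<lambda>x. W x + (- K) * B x) p \<le> 0"
    by (rule laplacian_nonpos_at_max[OF S(1) Ck_on_add[OF S(1) W(1) Ck_on_cmult[OF S(1) BC]] pS])
       (use le Wp closure_subset in force)
  then have "laplacian W p \<le> K * laplacian B p"
    by (simp only: laplacian_add[OF S(1) W(1) Ck_on_cmult[OF S(1) BC] pS] laplacian_cmult[OF S(1) BC pS])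
  then have "q p * (K * B p) \<le> K * (b * (2 * CARD('n) - 4 * (norm p)\<^sup>2) * gauss p)"
    unfolding eqn[OF pS] Wp B_def laplacian_quadratic_gauss by (simp add: algebra_simps)
  then have "q p * B p \<le> b * (2 * CARD('n) - 4 * (norm p)\<^sup>2) * gauss p" using K by (simp add: mult.left_commute)
  then have "q p * (1 + b * (norm p)\<^sup>2) \<le> b * (2 * CARD('n) - 4 * (norm p)\<^sup>2)"
    unfolding B_def by (metis gauss_pos mult.assoc mult_le_cancel_right_pos)
  with that pS K Wp le show thesis unfolding B_def by blast
qed

text \<open>The case b = 0, where the trial function solves the unperturbed equation. It bounds the
  eigenvalue from below.\<close>

lemma exists_q_nonpos: "\<exists>p\<in>S. q p \<le> 0"
  by (rule ratio_max[of 0]) auto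

text \<open>The roles are exchanged: a trial function vanishing on the sphere of radius r is touched
  from above by a multiple of W. This bounds the eigenvalue from above, with an error that decays as
  the admissible ball grows.\<close>

lemma exists_q_ge:
  fixes r :: real
  assumes r: "r > 0" "cball 0 r \<subseteq> S" and r2: "2 * r\<^sup>2 > CARD('n)"
  shows "\<exists>p\<in>S. q p \<ge> - 2 * CARD('n) / r\<^sup>2"
proof -
  define B where "B x = (r\<^sup>2 + (-1) * (norm x)\<^sup>2) * gauss x" for x :: "real^'n"
  have "continuous_on (cball 0 r) (\<lambda>x. B x / W x)"
    unfolding B_def
  proof (intro continuous_intros continuous_on_gauss ballI)
    show "continuous_on (cball 0 r) W"
      using r(2) closure_subset continuous_on_subset[OF W(2)] by blast
    show "W x \<noteq> 0" if "x \<in> cball 0 r" for x using W_pos[of x] r(2) that by force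
  qed
  then obtain p where p: "p \<in> cball 0 r" "\<And>x. x \<in> cball 0 r \<Longrightarrow> B x / W x \<le> B p / W p"
    using continuous_attains_sup[of "cball (0::real^'n) r" "\<lambda>x. B x / W x"] r(1) by auto
  define K where "K = B p / W p"
  have pS: "p \<in> S" using p r by auto
  have z: "0 \<in> S" using r by auto
  have "0 < B 0 / W 0" using W_pos[OF z] r(1) by (simp add: B_def)
  also have "\<dots> \<le> K" unfolding K_def using p(2) r(1) by simp
  finally have K: "K > 0" .
  have Bp: "B p = K * W p" using W_pos[OF pS] by (simp add: K_def)
  have le: "B x \<le> K * W x" if "x \<in> ball 0 r" for x
  proof -
    have "x \<in> cball 0 r" using that by simp
    then show ?thesis
      using p(2)[of x] W_pos[of x] r(2) unfolding K_def[symmetric] by (auto simp: divide_le_eq)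
  qed
  have s: "r\<^sup>2 - (norm p)\<^sup>2 > 0"
  proof -
    have "B p > 0" using Bp K W_pos[OF pS] by simp
    then show ?thesis by (simp add: B_def zero_less_mult_iff) (meson gauss_pos order.asym)
  qed
  then have pb: "p \<in> ball 0 r" using p r(1) by (auto simp: less_le)
  have sub: "ball 0 r \<subseteq> S" using r(2) by auto
  note WC = Ck_on_subset[OF W(1) sub]
  have BC: "Ck_on 2 (ball 0 r) B" unfolding B_def[abs_def] by (rule Ck_on_subset[OF Ck_on_quadratic_gauss]) simp
  have "laplacian (\<lambda>x. B x + (- K) * W x) p \<le> 0"
    by (rule laplacian_nonpos_at_max[OF open_ball Ck_on_add[OF open_ball BC Ck_on_cmult[OF open_ball WC]] pb])
       (use le Bp in force)
  then have "laplacian B p \<le> K * laplacian W p"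
    by (simp only: laplacian_add[OF open_ball BC Ck_on_cmult[OF open_ball WC] pb] laplacian_cmult[OF open_ball WC pb])
  also have "\<dots> = ((norm p)\<^sup>2 - CARD('n) + q p) * B p" by (simp add: eqn[OF pS] Bp)
  finally have "(- 2 * CARD('n) + 4 * (norm p)\<^sup>2) * gauss p \<le> q p * (r\<^sup>2 - (norm p)\<^sup>2) * gauss p"
    unfolding B_def laplacian_quadratic_gauss by (simp add: algebra_simps)
  then have "- 2 * CARD('n) + 4 * (norm p)\<^sup>2 \<le> q p * (r\<^sup>2 - (norm p)\<^sup>2)" by simp
  \<comment> \<open>Adding \<open>4 * (r^2 - |p|^2)\<close> on both sides removes p from the left.
    As \<open>2 * r^2\<close> exceeds the dimension, the left side is positive, so q p + 4 is
    positive and \<open>r^2 - |p|^2\<close> may be enlarged to \<open>r^2\<close>.\<close>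
  then have *: "4 * r\<^sup>2 - 2 * CARD('n) \<le> (q p + 4) * (r\<^sup>2 - (norm p)\<^sup>2)"
    by (simp add: algebra_simps)
  moreover have "4 * r\<^sup>2 - 2 * CARD('n) > 0" using r2 by simp
  ultimately have "(q p + 4) * (r\<^sup>2 - (norm p)\<^sup>2) > 0" by linarith
  then have "q p + 4 > 0" using s by (simp add: zero_less_mult_iff)
  then have "(q p + 4) * (r\<^sup>2 - (norm p)\<^sup>2) \<le> (q p + 4) * r\<^sup>2" by (intro mult_left_mono) auto
  with * have "- 2 * CARD('n) \<le> q p * r\<^sup>2" by (simp add: algebra_simps)
  then show ?thesis using pS r(1) by (intro bexI[of _ p]) (auto simp: field_simps)
qed

end

section \<open>Means over balls\<close>

text \<open>For this class an integral over \<open>UNIV\<close> is an integral over a box, where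
  continuity yields integrability and permits differentiation under the integral sign.\<close>

definition cont_compact_supp :: "('a::euclidean_space \<Rightarrow> real) \<Rightarrow> bool" where
  "cont_compact_supp f \<longleftrightarrow> continuous_on UNIV f \<and> (\<exists>r. \<forall>z. norm z \<ge> r \<longrightarrow> f z = 0)"

lemma cont_compact_suppI:
  fixes f :: "'a::euclidean_space \<Rightarrow> real"
  shows
  "continuous_on UNIV f \<Longrightarrow> (\<And>z. norm z \<ge> r \<Longrightarrow> f z = 0) \<Longrightarrow> cont_compact_supp f"
  by (auto simp: cont_compact_supp_def)

lemma cont_compact_supp_has_integral:
  fixes f :: "'a::euclidean_space \<Rightarrow> real"
  assumes "continuous_on UNIV f" "\<And>z. z \<notin> cbox a b \<Longrightarrow> f z = 0"
  shows "(f has_integral integral UNIV f) (cbox a b)"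
proof -
  obtain i where i: "(f has_integral i) (cbox a b)"
    using integrable_continuous[of a b f] assms(1) continuous_on_subset by blast
  with has_integral_on_superset[OF i assms(2), of UNIV] have "integral UNIV f = i" by (auto intro: integral_unique)
  with i show ?thesis by simp
qed

lemma cont_compact_supp_cbox:
  fixes f :: "'a::euclidean_space \<Rightarrow> real"
  assumes "cont_compact_supp f"
  obtains a where "\<And>z. z \<notin> cbox (- a) a \<Longrightarrow> f z = 0" "(f has_integral integral UNIV f) (cbox (- a) a)"
proof -
  obtain r where r: "continuous_on UNIV f" "\<And>z. norm z \<ge> r \<Longrightarrow> f z = 0"
    using assms by (auto simp: cont_compact_supp_def)
  obtain a where "cball (0::'a) r \<subseteq> cbox (- a) a" using bounded_subset_cbox_symmetric bounded_cball by metis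
  then have "\<And>z. z \<notin> cbox (- a) a \<Longrightarrow> f z = 0" using r by force
  with that cont_compact_supp_has_integral r show thesis by blast
qed

lemma cont_compact_supp_integrable: "cont_compact_supp f \<Longrightarrow> f integrable_on UNIV"
  using has_integral_on_superset[OF _ _ subset_UNIV] by (auto simp: integrable_on_def elim!: cont_compact_supp_cbox)

lemma cont_compact_supp_affinity:
  fixes f :: "'a::euclidean_space \<Rightarrow> real" and c :: 'a
  assumes f: "cont_compact_supp f" and m: "m \<noteq> 0"
  shows "cont_compact_supp (\<lambda>z. f (m *\<^sub>R z + c))"
    and "integral UNIV (\<lambda>z. f (m *\<^sub>R z + c)) = integral UNIV f / \<bar>m\<bar> ^ DIM('a)"
proof -
  obtain r where r: "continuous_on UNIV f" "\<And>z. norm z \<ge> r \<Longrightarrow> f z = 0"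
    using f by (auto simp: cont_compact_supp_def)
  show "cont_compact_supp (\<lambda>z. f (m *\<^sub>R z + c))"
  proof (rule cont_compact_suppI)
    show "continuous_on UNIV (\<lambda>z. f (m *\<^sub>R z + c))"
      by (intro continuous_on_compose2[OF r(1)] continuous_intros) auto
    fix z :: 'a assume z: "norm z \<ge> (r + norm c) / \<bar>m\<bar>"
    have "norm (m *\<^sub>R z) \<le> norm (m *\<^sub>R z + c) + norm c" by (metis add_diff_cancel_right' norm_triangle_ineq4)
    with z m have "norm (m *\<^sub>R z + c) \<ge> r" by (simp add: field_simps)
    with r show "f (m *\<^sub>R z + c) = 0" by blast
  qed
  obtain a where a: "\<And>z. z \<notin> cbox (- a) a \<Longrightarrow> f z = 0" "(f has_integral integral UNIV f) (cbox (- a) a)"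
    using cont_compact_supp_cbox[OF f] by blast
  let ?g = "\<lambda>x. (1 / m) *\<^sub>R x + - ((1 / m) *\<^sub>R c)"
  have "f (m *\<^sub>R z + c) = 0" if "z \<notin> ?g ` cbox (- a) a" for z
  proof (rule a(1))
    have "z = ?g (m *\<^sub>R z + c)" using m by (simp add: scaleR_add_right)
    with that show "m *\<^sub>R z + c \<notin> cbox (- a) a" by (metis image_eqI)
  qed
  from has_integral_on_superset[OF has_integral_affinity[OF a(2) m, of c] this subset_UNIV]
  show "integral UNIV (\<lambda>z. f (m *\<^sub>R z + c)) = integral UNIV f / \<bar>m\<bar> ^ DIM('a)"
    by (simp add: integral_unique)
qed

lemma cont_compact_supp_translate:
  fixes f :: "'a::euclidean_space \<Rightarrow> real"
  assumes f: "cont_compact_supp f"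
  shows "cont_compact_supp (\<lambda>z. f (z + c))" "integral UNIV (\<lambda>z. f (z + c)) = integral UNIV f"
  using cont_compact_supp_affinity[OF f, of 1 c] by simp_all

text \<open>The integral of the translate g(z + s e) does not depend on s, and its derivative at s =
  0 is the integral of g'. This is the divergence theorem without boundary term.\<close>

lemma integral_deriv_compact_supp:
  fixes g :: "'a::euclidean_space \<Rightarrow> real"
  assumes g: "cont_compact_supp g" and g': "cont_compact_supp g'"
    and d: "\<And>z. ((\<lambda>s. g (z + s *\<^sub>R e)) has_real_derivative g' z) (at 0)"
  shows "integral UNIV g' = 0"
proof -
  obtain r1 r2 where r: "continuous_on UNIV g" "\<And>z. norm z \<ge> r1 \<Longrightarrow> g z = 0"
    "continuous_on UNIV g'" "\<And>z. norm z \<ge> r2 \<Longrightarrow> g' z = 0"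
    using g g' by (auto simp: cont_compact_supp_def)
  \<comment> \<open>Adding the length of e lets one box contain the supports of all translates with
    s in [-1, 1].\<close>
  define R where "R = max r1 r2 + norm e"
  obtain a where a: "cball (0::'a) R \<subseteq> cbox (- a) a" using bounded_subset_cbox_symmetric bounded_cball by metis
  have z1: "g (z + s *\<^sub>R e) = 0" if "z \<notin> cbox (- a) a" "s \<in> {-1..1}" for z s
  proof (rule r(2))
    have "norm (s *\<^sub>R e) \<le> norm e" using that(2) by (simp add: mult_left_le_one_le abs_le_iff)
    moreover have "norm z > R" using that(1) a by force
    ultimately show "norm (z + s *\<^sub>R e) \<ge> r1" using norm_diff_ineq[of z "s *\<^sub>R e"] unfolding R_def by linarith
  qed
  have z2: "g' z = 0" if "z \<notin> cbox (- a) a" for z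
  proof (rule r(4))
    have "norm z > R" using that(1) a by force
    then show "norm z \<ge> r2" unfolding R_def using norm_ge_zero[of e] by linarith
  qed
  have L: "((\<lambda>s. integral (cbox (- a) a) (\<lambda>z. g (z + s *\<^sub>R e))) has_field_derivative
      integral (cbox (- a) a) (\<lambda>z. g' (z + 0 *\<^sub>R e))) (at 0 within {-1..1})"
  proof (rule leibniz_rule_field_derivative)
    fix s :: real and z
    have "((\<lambda>s'. g ((z + s *\<^sub>R e) + (s' - s) *\<^sub>R e)) has_real_derivative g' (z + s *\<^sub>R e) * 1) (at s)"
      by (rule DERIV_chain'[of "\<lambda>s'. s' - s" 1 s UNIV "\<lambda>s'. g ((z + s *\<^sub>R e) + s' *\<^sub>R e)"])
         (use d[of "z + s *\<^sub>R e"] in \<open>auto intro!: derivative_eq_intros\<close>)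
    then have "((\<lambda>s'. g (z + s' *\<^sub>R e)) has_real_derivative g' (z + s *\<^sub>R e)) (at s)"
      by (simp add: algebra_simps)
    then show "((\<lambda>s'. g (z + s' *\<^sub>R e)) has_field_derivative g' (z + s *\<^sub>R e)) (at s within {-1..1})"
      by (rule has_field_derivative_at_within)
  next
    show "(\<lambda>z. g (z + s *\<^sub>R e)) integrable_on cbox (- a) a" for s
      by (intro integrable_continuous continuous_on_compose2[OF r(1)] continuous_intros) auto
    show "continuous_on ({-1..1} \<times> cbox (- a) a) (\<lambda>(s, z). g' (z + s *\<^sub>R e))"
      unfolding split_beta by (intro continuous_on_compose2[OF r(3)] continuous_intros) auto
  qed auto
  have I: "integral (cbox (- a) a) (\<lambda>z. g' (z + 0 *\<^sub>R e)) = integral UNIV g'"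
    using cont_compact_supp_has_integral[OF r(3) z2] by (simp add: integral_unique)
  have "integral UNIV g = integral (cbox (- a) a) (\<lambda>z. g (z + s *\<^sub>R e))" if "s \<in> {-1..1}" for s
  proof -
    have "continuous_on UNIV (\<lambda>z. g (z + s *\<^sub>R e))"
      by (intro continuous_on_compose2[OF r(1)] continuous_intros) auto
    from cont_compact_supp_has_integral[OF this z1[OF _ that], of "- a" a]
    show ?thesis using cont_compact_supp_translate(2)[OF g, of "s *\<^sub>R e"] by (simp add: integral_unique)
  qed
  from has_derivative_transform[OF _ this L[unfolded I has_field_derivative_def]]
  have "((\<lambda>s. integral UNIV g) has_field_derivative integral UNIV g') (at (0::real) within {-1..1})"
    unfolding has_field_derivative_def by simp
  then have "((\<lambda>s. integral UNIV g) has_field_derivative integral UNIV g') (at (0::real))"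
    by (simp add: at_within_Icc_at)
  then show ?thesis by (rule DERIV_unique) simp
qed

section \<open>The kernel and its means\<close>

definition bump :: "'a::euclidean_space \<Rightarrow> real" where
  "bump z = max 0 (1 - (norm z)\<^sup>2)"

lemma bump_nonneg: "0 \<le> bump z" and bump_le_1: "bump z \<le> 1"
  by (auto simp: bump_def)

lemma bump_0 [simp]: "bump 0 = 1"
  by (simp add: bump_def)

lemma bump_outside: "norm z \<ge> 1 \<Longrightarrow> bump z = 0"
  by (simp add: bump_def one_le_power)

lemma continuous_on_bump [continuous_intros]: "continuous_on S g \<Longrightarrow> continuous_on S (\<lambda>x. bump (g x))"
  unfolding bump_def by (intro continuous_intros) auto

lemma has_derivative_bump_cube:
  "((\<lambda>s. bump (z + s *\<^sub>R e) ^ 3) has_real_derivative - 6 * (z \<bullet> e) * (bump z)\<^sup>2) (at 0)"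
proof -
  have c: "((\<lambda>y::real. (max 0 y) ^ 3) has_real_derivative 3 * (max 0 y)\<^sup>2) (at y)" for y
  proof (cases "y = 0")
    case True
    \<comment> \<open>The corner of the positive part is the only critical place; there the
      difference quotient of the cube lies between 0 and \<open>h^2\<close>.\<close>
    have "((\<lambda>h::real. (max 0 h) ^ 3 / h) \<longlongrightarrow> 0) (at 0)"
    proof (rule tendsto_sandwich[of "\<lambda>_. 0" _ _ "\<lambda>h. h\<^sup>2"])
      show "\<forall>\<^sub>F h in at 0. (max 0 h) ^ 3 / h \<le> (h::real)\<^sup>2"
        by (rule always_eventually) (auto simp: max_def power2_eq_square power3_eq_cube field_simps)
      show "\<forall>\<^sub>F h in at 0. 0 \<le> (max 0 h) ^ 3 / (h::real)"
        by (rule always_eventually) (auto simp: max_def)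
      have "((\<lambda>h::real. h\<^sup>2) \<longlongrightarrow> 0\<^sup>2) (at 0)" by (intro tendsto_intros)
      then show "((\<lambda>h::real. h\<^sup>2) \<longlongrightarrow> 0) (at 0)" by simp
    qed simp
    then show ?thesis using True by (simp add: DERIV_def)
  next
    case False
    show ?thesis
    proof (cases "y > 0")
      case True
      have "((\<lambda>y::real. y ^ 3) has_real_derivative 3 * y\<^sup>2) (at y)"
        by (auto intro!: derivative_eq_intros)
      then have "((\<lambda>y::real. (max 0 y) ^ 3) has_real_derivative 3 * y\<^sup>2) (at y)"
        by (rule has_field_derivative_transform_within_open[of _ _ _ "{0<..}"]) (use True in auto)
      then show ?thesis using True by simp
    next
      case y: False
      have "((\<lambda>y::real. (max 0 y) ^ 3) has_real_derivative 0) (at y)"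
        by (rule has_field_derivative_transform_within_open[of "\<lambda>_. 0" _ _ "{..<0}"])
           (use False y in auto)
      then show ?thesis using False y by simp
    qed
  qed
  have "((\<lambda>s. 1 - (norm (z + s *\<^sub>R e))\<^sup>2) has_real_derivative - 2 * (z \<bullet> e)) (at 0)"
    unfolding power2_norm_eq_inner has_field_derivative_def
    by (auto intro!: derivative_eq_intros simp: inner_add_left inner_add_right inner_commute fun_eq_iff)
  from DERIV_chain'[OF this c] show ?thesis by (simp add: bump_def mult_ac)
qed

definition bump_mean :: "nat \<Rightarrow> ('a::euclidean_space \<Rightarrow> real) \<Rightarrow> 'a \<Rightarrow> real \<Rightarrow> real" where
  "bump_mean n g x t = integral UNIV (\<lambda>z. bump z ^ n * g (x + t *\<^sub>R z))"

text \<open>The factor g may be arbitrary outside the closed unit ball: the product is zero there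
  and on the unit sphere, so the two continuous pieces, on closed sets with common values, can be
  glued.\<close>

lemma continuous_on_bump_mult:
  fixes g :: "'a::euclidean_space \<Rightarrow> 'b::metric_space \<Rightarrow> real"
  assumes g: "continuous_on (cball 0 1 \<times> U) (\<lambda>(z, s). g z s)" and U: "closed U" and n: "n > 0"
  shows "continuous_on (UNIV \<times> U) (\<lambda>(z, s). bump z ^ n * g z s)"
proof -
  have "continuous_on (cball 0 1 \<times> U) (\<lambda>(z, s). bump z ^ n * g z s)"
    using g unfolding split_beta by (intro continuous_intros)
  moreover have "continuous_on ((- ball 0 1) \<times> U) (\<lambda>(z, s). bump z ^ n * g z s)"
    by (rule continuous_on_eq[of _ "\<lambda>_. 0"]) (use n in \<open>auto simp: bump_outside zero_power\<close>)
  ultimately have "continuous_on (cball 0 1 \<times> U \<union> (- ball 0 1) \<times> U) (\<lambda>(z, s). bump z ^ n * g z s)"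
    using U by (intro continuous_on_closed_Un closed_Times) auto
  moreover have eq: "UNIV \<times> U = cball 0 1 \<times> U \<union> (- ball 0 1) \<times> U" by force
  ultimately show ?thesis unfolding eq by simp
qed

lemma affine_mem_cball:
  fixes x z :: "'a::real_normed_vector"
  assumes "norm z \<le> r" "0 \<le> t" "t * r \<le> T"
  shows "x + t *\<^sub>R z \<in> cball x T"
  using assms mult_left_mono[of "norm z" r t] by (auto simp: dist_norm)

lemma cont_compact_supp_bump_mult:
  assumes "continuous_on (cball x T) g" "0 \<le> t" "t \<le> T" "n > 0"
  shows "cont_compact_supp (\<lambda>z. bump z ^ n * g (x + t *\<^sub>R z))"
proof (rule cont_compact_suppI)
  show "bump z ^ n * g (x + t *\<^sub>R z) = 0" if "norm z \<ge> 1" for z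
    using that assms(4) by (simp add: bump_outside)
  have "continuous_on (cball 0 1) (\<lambda>z. g (x + t *\<^sub>R z))"
    using assms affine_mem_cball[of _ 1 t T x]
    by (intro continuous_on_compose2[OF assms(1)] continuous_intros) auto
  then have "continuous_on (cball 0 1 \<times> {0::real}) (\<lambda>(z, s). g (x + t *\<^sub>R z))"
    unfolding split_beta by (rule continuous_on_compose2) (auto intro: continuous_intros)
  from continuous_on_compose2[OF continuous_on_bump_mult[OF this _ assms(4)], of UNIV "\<lambda>z. (z, 0)"]
  show "continuous_on UNIV (\<lambda>z. bump z ^ n * g (x + t *\<^sub>R z))"
    by (simp add: continuous_on_Pair image_subset_iff)
qed

text \<open>Both kernels vanish outside the unit ball and the gradient of \<open>bump\<^sup>3 / 6\<close> is
  \<open>- z bump\<^sup>2\<close>, so the \<open>t\<close>-derivative of the mean is the integral of a divergence up to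
  the Laplacian term.\<close>

lemma bump_mean_deriv:
  fixes f :: "real^'n::finite \<Rightarrow> real"
  assumes S: "open S" and f: "Ck_on 2 S f" and xT: "cball x T \<subseteq> S" and t: "t \<in> {0..T}"
  shows "(bump_mean 2 f x has_real_derivative t / 6 * bump_mean 3 (laplacian f) x t) (at t within {0..T})"
proof -
  have f2: "Ck_on (Suc (Suc 0)) S f" using f by (simp add: numeral_2_eq_2)
  have cf: "continuous_on S f" using Ck_on_SucD[OF Ck_on_SucD[OF f2]] by simp
  have C1: "Ck_on (Suc 0) S (partial_deriv i f)" for i using f2 by simp
  have cd: "continuous_on S (partial_deriv i f)" for i using Ck_on_SucD[OF C1] by simp
  have cdd: "continuous_on S (partial_deriv j (partial_deriv i f))" for i j using C1 by simp
  have inS: "x + s *\<^sub>R z \<in> S" if "norm z \<le> 1" "s \<in> {0..T}" for s z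
    using affine_mem_cball[of z 1 s T x] that xT by auto
  define D where "D s z = (\<Sum>i\<in>UNIV. partial_deriv i f (x + s *\<^sub>R z) * z $ i)" for s z
  obtain a where a: "cball (0::real^'n) 1 \<subseteq> cbox (- a) a" using bounded_subset_cbox_symmetric bounded_cball by metis
  have out: "bump z = 0" if "z \<notin> cbox (- a) a" for z :: "real^'n"
    using a that bump_outside[of z] by force
  have cDz: "continuous_on (UNIV \<times> {0..T}) (\<lambda>(z, s). bump z ^ 2 * D s z)"
  proof (rule continuous_on_bump_mult)
    show "continuous_on (cball 0 1 \<times> {0..T}) (\<lambda>(z, s). D s z)"
      unfolding D_def split_beta
      by (intro continuous_intros continuous_on_compose2[OF cd]) (use inS in auto)
  qed auto
  have cD: "continuous_on ({0..T} \<times> cbox (- a) a) (\<lambda>(s, z). bump z ^ 2 * D s z)"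
  proof -
    have "continuous_on ({0..T} \<times> cbox (- a) a) (\<lambda>p. (\<lambda>(z, s). bump z ^ 2 * D s z) (snd p, fst p))"
      by (rule continuous_on_compose2[OF cDz]) (auto intro!: continuous_intros)
    then show ?thesis by (simp add: split_beta)
  qed
  have cDt: "continuous_on UNIV (\<lambda>z. bump z ^ 2 * D t z)"
    using continuous_on_compose2[OF cDz, of UNIV "\<lambda>z. (z, t)"] t by (simp add: continuous_on_Pair image_subset_iff)
  have eqm: "bump_mean 2 f x s = integral (cbox (- a) a) (\<lambda>z. bump z ^ 2 * f (x + s *\<^sub>R z))"
    if "s \<in> {0..T}" for s
  proof -
    have "cont_compact_supp (\<lambda>z. bump z ^ 2 * f (x + s *\<^sub>R z))"
      using that xT by (intro cont_compact_supp_bump_mult[OF continuous_on_subset[OF cf]]) auto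
    from cont_compact_supp_has_integral[OF _ , of "\<lambda>z. bump z ^ 2 * f (x + s *\<^sub>R z)" "- a" a]  this out
    show ?thesis unfolding bump_mean_def cont_compact_supp_def by (metis (no_types, lifting) integral_unique mult_zero_left zero_power2)
  qed
  have L: "((\<lambda>s. integral (cbox (- a) a) (\<lambda>z. bump z ^ 2 * f (x + s *\<^sub>R z))) has_field_derivative
      integral (cbox (- a) a) (\<lambda>z. bump z ^ 2 * D t z)) (at t within {0..T})"
  proof (rule leibniz_rule_field_derivative)
    fix s z assume s: "s \<in> {0..T}"
    show "((\<lambda>s. (bump z)\<^sup>2 * f (x + s *\<^sub>R z)) has_field_derivative (bump z)\<^sup>2 * D s z) (at s within {0..T})"
    proof (cases "norm z \<le> 1")
      case True
      have "((\<lambda>s. f (x + s *\<^sub>R z)) has_derivative (\<lambda>h. \<Sum>i\<in>UNIV. partial_deriv i f (x + s *\<^sub>R z) * (h *\<^sub>R z) $ i)) (at s)"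
        by (rule has_derivative_compose[of "\<lambda>s. x + s *\<^sub>R z", OF _ Ck_on_has_derivative[OF S f2 inS[OF True s]]])
          (auto intro!: derivative_eq_intros)
      then have "((\<lambda>s. f (x + s *\<^sub>R z)) has_field_derivative D s z) (at s)"
        unfolding has_field_derivative_def D_def
        by (rule has_derivative_eq_rhs) (simp add: fun_eq_iff sum_distrib_left algebra_simps)
      then show ?thesis
        by (rule DERIV_cmult[OF has_field_derivative_at_within])
    next
      case False
      then show ?thesis by (simp add: bump_outside)
    qed
    have "cont_compact_supp (\<lambda>z. bump z ^ 2 * f (x + s *\<^sub>R z))"
      using s xT by (intro cont_compact_supp_bump_mult[OF continuous_on_subset[OF cf]]) auto
    then show "(\<lambda>z. (bump z)\<^sup>2 * f (x + s *\<^sub>R z)) integrable_on cbox (- a) a"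
      unfolding cont_compact_supp_def by (blast intro: integrable_continuous continuous_on_subset)
  qed (use cD t in auto)
  have I: "integral (cbox (- a) a) (\<lambda>z. bump z ^ 2 * D t z) = integral UNIV (\<lambda>z. bump z ^ 2 * D t z)"
    using cont_compact_supp_has_integral[OF cDt, of "- a" a] out by (simp add: integral_unique)
  from has_derivative_transform[OF t eqm L[unfolded I has_field_derivative_def]]
  have deriv: "(bump_mean 2 f x has_field_derivative integral UNIV (\<lambda>z. bump z ^ 2 * D t z)) (at t within {0..T})"
    unfolding has_field_derivative_def .
  \<comment> \<open>This is the derivative along axis i of the cubed kernel times
    \<open>partial_deriv i f (x + t z)\<close>, so it integrates to 0. Summing over i gives t times
    the Laplacian term minus 6 times the integrand in \<open>deriv\<close>.\<close>
  define G where "G i z = - 6 * (z $ i * partial_deriv i f (x + t *\<^sub>R z)) * (bump z)\<^sup>2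
      + t * (bump z ^ 3 * partial_deriv i (partial_deriv i f) (x + t *\<^sub>R z))" for i z
  have t': "0 \<le> t" "t \<le> T" using t by auto
  note bm = cont_compact_supp_bump_mult[OF continuous_on_subset[OF _ xT] t']
  have G1: "cont_compact_supp (\<lambda>z. bump z ^ 3 * partial_deriv i (partial_deriv i f) (x + t *\<^sub>R z))" for i
    by (rule bm[OF cdd]) auto
  have G2: "cont_compact_supp (\<lambda>z. bump z ^ 2 * partial_deriv i f (x + t *\<^sub>R z))" for i
    by (rule bm[OF cd]) auto
  have Gc: "cont_compact_supp (G i)" for i
  proof (rule cont_compact_suppI[of _ 1])
    have "G i = (\<lambda>z. - 6 * z $ i * (bump z ^ 2 * partial_deriv i f (x + t *\<^sub>R z))
       + t * (bump z ^ 3 * partial_deriv i (partial_deriv i f) (x + t *\<^sub>R z)))"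
      by (simp add: G_def fun_eq_iff)
    then show "continuous_on UNIV (G i)"
      using G1[of i] G2[of i] unfolding cont_compact_supp_def by (auto intro!: continuous_intros)
  qed (simp add: G_def bump_outside)
  have G0: "integral UNIV (G i) = 0" for i
  proof (rule integral_deriv_compact_supp[OF _ Gc, of "\<lambda>z. bump z ^ 3 * partial_deriv i f (x + t *\<^sub>R z)" "axis i 1"])
    show "cont_compact_supp (\<lambda>z. bump z ^ 3 * partial_deriv i f (x + t *\<^sub>R z))"
      by (rule bm[OF cd]) auto
    fix z :: "real^'n"
    show "((\<lambda>s. bump (z + s *\<^sub>R axis i 1) ^ 3 * partial_deriv i f (x + t *\<^sub>R (z + s *\<^sub>R axis i 1)))
       has_real_derivative G i z) (at 0)"
    proof (cases "norm z \<le> 1")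
      case True
      have "((\<lambda>s. partial_deriv i f (x + t *\<^sub>R (z + s *\<^sub>R axis i 1))) has_derivative
        (\<lambda>h. \<Sum>j\<in>UNIV. partial_deriv j (partial_deriv i f) (x + t *\<^sub>R (z + 0 *\<^sub>R axis i 1)) * (t *\<^sub>R h *\<^sub>R axis i 1) $ j)) (at 0)"
        by (rule has_derivative_compose[of "\<lambda>s. x + t *\<^sub>R (z + s *\<^sub>R axis i 1)", OF _ Ck_on_has_derivative[OF S C1]])
          (use inS[OF True t] in \<open>auto intro!: derivative_eq_intros\<close>)
      then have "((\<lambda>s. partial_deriv i f (x + t *\<^sub>R (z + s *\<^sub>R axis i 1))) has_real_derivative
         t * partial_deriv i (partial_deriv i f) (x + t *\<^sub>R z)) (at 0)"
        unfolding has_field_derivative_def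
        by (rule has_derivative_eq_rhs) (simp add: fun_eq_iff axis_def if_distrib[of "\<lambda>y. _ * y"] if_distrib[of "\<lambda>y. y * _"] mult_ac cong: if_cong)
      from DERIV_mult[OF has_derivative_bump_cube[of z "axis i 1"] this]
      show ?thesis by (simp add: G_def inner_axis algebra_simps)
    next
      case False
      have o: "open ((\<lambda>s. z + s *\<^sub>R axis i 1) -` (- cball 0 1))"
        by (rule open_vimage) (auto intro!: continuous_intros)
      have "((\<lambda>s. bump (z + s *\<^sub>R axis i 1) ^ 3 * partial_deriv i f (x + t *\<^sub>R (z + s *\<^sub>R axis i 1)))
         has_real_derivative 0) (at 0)"
        by (rule has_field_derivative_transform_within_open[OF _ o, of "\<lambda>_. 0"]) (use False in \<open>auto simp: bump_outside\<close>)
      then show ?thesis using False by (simp add: G_def bump_outside)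
    qed
  qed
  have "6 * (bump z ^ 2 * D t z) = t * (bump z ^ 3 * laplacian f (x + t *\<^sub>R z)) - (\<Sum>i\<in>UNIV. G i z)" for z
    by (simp add: D_def G_def laplacian_def sum.distrib sum_distrib_left sum_subtractf sum_negf algebra_simps)
  then have eq: "(\<lambda>z. bump z ^ 2 * D t z) = (\<lambda>z. (t * (bump z ^ 3 * laplacian f (x + t *\<^sub>R z)) - (\<Sum>i\<in>UNIV. G i z)) / 6)"
    by (intro ext) (metis nonzero_mult_div_cancel_left zero_neq_numeral)
  have cl: "continuous_on S (laplacian f)"
    unfolding laplacian_def by (intro continuous_intros cdd)
  have "((\<lambda>z. (t * (bump z ^ 3 * laplacian f (x + t *\<^sub>R z)) - (\<Sum>i\<in>UNIV. G i z)) / 6) has_integral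
     (t * bump_mean 3 (laplacian f) x t - (\<Sum>i\<in>(UNIV::'n set). 0)) / 6) UNIV"
    unfolding bump_mean_def
  proof (intro has_integral_divide has_integral_diff has_integral_mult_right has_integral_sum)
    show "((\<lambda>z. bump z ^ 3 * laplacian f (x + t *\<^sub>R z)) has_integral integral UNIV (\<lambda>z. bump z ^ 3 * laplacian f (x + t *\<^sub>R z))) UNIV"
      by (intro integrable_integral cont_compact_supp_integrable bm[OF cl]) auto
    show "(G i has_integral 0) UNIV" for i
      using integrable_integral[OF cont_compact_supp_integrable[OF Gc[of i]]] G0[of i] by simp
  qed auto
  then have "integral UNIV (\<lambda>z. bump z ^ 2 * D t z) = t / 6 * bump_mean 3 (laplacian f) x t"
    unfolding eq by (auto dest: integral_unique)
  with deriv show ?thesis by simp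
qed

section \<open>Harnack inequality\<close>

text \<open>The means are not normalized; this is the factor by which the mean at t = 0 differs from
  the point value.\<close>

definition bump_mass :: "'a::euclidean_space itself \<Rightarrow> real" where
  "bump_mass _ = integral UNIV (\<lambda>z::'a. bump z ^ 2)"

lemma cont_compact_supp_bump:
  assumes "n > 0" shows "cont_compact_supp (\<lambda>z. bump z ^ n)"
  by (rule cont_compact_suppI[of _ 1]) (use assms in \<open>auto simp: bump_outside intro!: continuous_intros\<close>)

lemma bump_mass_pos: "bump_mass TYPE('a::euclidean_space) > 0"
proof (rule ccontr)
  let ?f = "\<lambda>z::'a. bump z ^ 2"
  assume "\<not> ?thesis"
  moreover have "bump_mass TYPE('a) \<ge> 0"
    unfolding bump_mass_def by (intro integral_nonneg cont_compact_supp_integrable cont_compact_supp_bump) auto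
  ultimately have 0: "integral UNIV ?f = 0" by (simp add: bump_mass_def)
  have c: "continuous_on UNIV ?f" by (intro continuous_intros)
  obtain a where a: "cball (0::'a) 1 \<subseteq> box (- a) a" using bounded_subset_box_symmetric bounded_cball by metis
  then have a0: "0 \<in> box (- a) a" by (auto simp: subset_iff)
  have "(?f has_integral integral UNIV ?f) (cbox (- a) a)"
    by (rule cont_compact_supp_has_integral[OF c]) (metis a bump_outside box_subset_cbox linorder_linear mem_cball_0 power_zero_numeral subsetD)
  then have "?f 0 = 0" 
    using a0 box_subset_cbox[of "- a" a] unfolding 0
    by (intro has_integral_0_cbox_imp_0[of "- a" a ?f] continuous_on_subset[OF c]) auto
  then show False by simp
qed

lemma bump_mean_0: "bump_mean 2 f (x::'a::euclidean_space) 0 = f x * bump_mass TYPE('a)"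
  by (simp add: bump_mean_def bump_mass_def mult.commute)

lemma bump_mean_has_field_derivative:
  fixes f :: "real^'n::finite \<Rightarrow> real"
  assumes "open S" "Ck_on 2 S f" "cball x T \<subseteq> S" "0 < t" "t < T"
  shows "(bump_mean 2 f x has_real_derivative t / 6 * bump_mean 3 (laplacian f) x t) (at t)"
  using bump_mean_deriv[OF assms(1-3), of t] assms(4,5) by (simp add: at_within_Icc_at)

lemma continuous_on_bump_mean:
  fixes f :: "real^'n::finite \<Rightarrow> real"
  assumes "open S" "Ck_on 2 S f" "cball x T \<subseteq> S"
  shows "continuous_on {0..T} (bump_mean 2 f x)"
  using bump_mean_deriv[OF assms] by (rule DERIV_continuous_on)

lemma Ck_on_continuous: "Ck_on k S f \<Longrightarrow> continuous_on S f"
proof (induction k)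
  case (Suc k)
  then show ?case using Ck_on_SucD by blast
qed simp

lemma Ck_on_continuous_laplacian: "Ck_on 2 S f \<Longrightarrow> continuous_on S (laplacian f)"
  unfolding laplacian_def[abs_def] by (intro continuous_on_sum) (simp add: numeral_2_eq_2)

text \<open>With \<open>bump^3 \<le> bump^2\<close> the hypothesis on the Laplacian bounds the
  derivative of the mean F by \<open>c t / 6 * (F + m)\<close>. The shift m makes this inequality
  homogeneous, so \<open>exp (c t^2 / 12) * (F + m)\<close> increases and
  \<open>exp (- c t^2 / 12) * (F + m)\<close> decreases. Point values and means thus control each
  other in both directions.\<close>

lemma bump_mean_gronwall:
  fixes f :: "real^'n::finite \<Rightarrow> real"
  assumes S: "open S" "Ck_on 2 S f" "cball x T \<subseteq> S" and T: "T \<ge> 0" and c: "c > 0"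
    and nonneg: "\<And>y. y \<in> cball x T \<Longrightarrow> 0 \<le> f y"
    and lap: "\<And>y. y \<in> cball x T \<Longrightarrow> \<bar>laplacian f y\<bar> \<le> c * f y + \<delta>"
  defines "E \<equiv> exp (c * T\<^sup>2 / 12)" and "m \<equiv> \<delta> / c * bump_mass TYPE(real^'n)"
  shows "bump_mean 2 f x T + m \<le> E * (f x * bump_mass TYPE(real^'n) + m)"
    and "f x * bump_mass TYPE(real^'n) + m \<le> E * (bump_mean 2 f x T + m)"
proof -
  let ?F = "bump_mean 2 f x"
  define F' where "F' t = t / 6 * bump_mean 3 (laplacian f) x t" for t
  have cf: "continuous_on (cball x T) f" using Ck_on_continuous[OF S(2)] S(3) continuous_on_subset by blast
  have cl: "continuous_on (cball x T) (laplacian f)"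
    using Ck_on_continuous_laplacian[OF S(2)] S(3) continuous_on_subset by blast
  have bound: "\<bar>F' t\<bar> \<le> c * t / 6 * (?F t + m)" if t: "0 < t" "t < T" for t
  proof -
    have i3: "cont_compact_supp (\<lambda>z. bump z ^ 3 * laplacian f (x + t *\<^sub>R z))"
      using t by (intro cont_compact_supp_bump_mult[OF cl]) auto
    have i2: "(\<lambda>z. bump z ^ 2 * f (x + t *\<^sub>R z)) integrable_on UNIV"
      using t by (intro cont_compact_supp_integrable cont_compact_supp_bump_mult[OF cf]) auto
    have ib: "(\<lambda>z::real^'n. bump z ^ 2) integrable_on UNIV"
      by (intro cont_compact_supp_integrable cont_compact_supp_bump) auto
    have hi: "((\<lambda>z. c * (bump z ^ 2 * f (x + t *\<^sub>R z)) + \<delta> * bump z ^ 2) has_integral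
        c * ?F t + \<delta> * bump_mass TYPE(real^'n)) UNIV"
      unfolding bump_mean_def bump_mass_def
      using i2 ib by (intro has_integral_add has_integral_mult_right integrable_integral)
    have "norm (integral UNIV (\<lambda>z. bump z ^ 3 * laplacian f (x + t *\<^sub>R z)))
        \<le> integral UNIV (\<lambda>z. c * (bump z ^ 2 * f (x + t *\<^sub>R z)) + \<delta> * bump z ^ 2)"
    proof (rule integral_norm_bound_integral[OF cont_compact_supp_integrable[OF i3] has_integral_integrable[OF hi]])
      fix z
      show "norm (bump z ^ 3 * laplacian f (x + t *\<^sub>R z)) \<le> c * (bump z ^ 2 * f (x + t *\<^sub>R z)) + \<delta> * bump z ^ 2"
      proof (cases "norm z \<le> 1")
        case True
        have y: "x + t *\<^sub>R z \<in> cball x T" using affine_mem_cball[OF True, of t T x] t by simp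
        have "\<bar>laplacian f (x + t *\<^sub>R z)\<bar> * bump z ^ 3 \<le> (c * f (x + t *\<^sub>R z) + \<delta>) * bump z ^ 2"
        proof (rule mult_mono[OF lap[OF y]])
          show "bump z ^ 3 \<le> bump z ^ 2"
            using bump_nonneg[of z] bump_le_1[of z] by (intro power_decreasing) auto
          show "0 \<le> c * f (x + t *\<^sub>R z) + \<delta>" using lap[OF y] abs_ge_zero order_trans by blast
        qed (simp add: bump_nonneg)
        then show ?thesis by (simp add: abs_mult bump_nonneg algebra_simps)
      next
        case False then show ?thesis by (simp add: bump_outside)
      qed
    qed
    then have "\<bar>bump_mean 3 (laplacian f) x t\<bar> \<le> c * (?F t + m)"
      using c unfolding integral_unique[OF hi] by (simp add: bump_mean_def m_def algebra_simps)
    then show ?thesis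
      using mult_left_mono[of "\<bar>bump_mean 3 (laplacian f) x t\<bar>" "c * (?F t + m)" "t / 6"] t
      by (simp add: F'_def abs_mult mult_ac)
  qed
  note d = bump_mean_has_field_derivative[OF S, folded F'_def]
  have cF: "continuous_on {0..T} ?F" by (rule continuous_on_bump_mean[OF S])
  have "exp (c * 0\<^sup>2 / 12) * (?F 0 + m) \<le> exp (c * T\<^sup>2 / 12) * (?F T + m)"
  proof (rule DERIV_nonneg_imp_increasing_open[OF T])
    fix t assume t: "0 < t" "t < T"
    have "((\<lambda>t. exp (c * t\<^sup>2 / 12) * (?F t + m)) has_real_derivative
        exp (c * t\<^sup>2 / 12) * (c * t / 6 * (?F t + m) + F' t)) (at t)"
      by (auto intro!: derivative_eq_intros d t simp: algebra_simps)
    moreover have "0 \<le> exp (c * t\<^sup>2 / 12) * (c * t / 6 * (?F t + m) + F' t)"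
      using bound[OF t] by (intro mult_nonneg_nonneg) auto
    ultimately show "\<exists>y. ((\<lambda>t. exp (c * t\<^sup>2 / 12) * (?F t + m)) has_real_derivative y) (at t) \<and> 0 \<le> y"
      by blast
  qed (intro continuous_intros cF, auto)
  then show "f x * bump_mass TYPE(real^'n) + m \<le> E * (?F T + m)"
    by (simp add: E_def bump_mean_0)
  have "exp (- (c * 0\<^sup>2 / 12)) * (?F 0 + m) \<ge> exp (- (c * T\<^sup>2 / 12)) * (?F T + m)"
  proof (rule DERIV_nonpos_imp_decreasing_open[OF T])
    fix t assume t: "0 < t" "t < T"
    have "((\<lambda>t. exp (- (c * t\<^sup>2 / 12)) * (?F t + m)) has_real_derivative
        exp (- (c * t\<^sup>2 / 12)) * (F' t - c * t / 6 * (?F t + m))) (at t)"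
      by (auto intro!: derivative_eq_intros d t simp: algebra_simps)
    moreover have "exp (- (c * t\<^sup>2 / 12)) * (F' t - c * t / 6 * (?F t + m)) \<le> 0"
      using bound[OF t] by (intro mult_nonneg_nonpos) auto
    ultimately show "\<exists>y. ((\<lambda>t. exp (- (c * t\<^sup>2 / 12)) * (?F t + m)) has_real_derivative y) (at t) \<and> y \<le> 0"
      by blast
  qed (intro continuous_intros cF, auto)
  then have "(?F T + m) / E \<le> f x * bump_mass TYPE(real^'n) + m"
    by (simp add: E_def bump_mean_0 exp_minus field_simps)
  then show "?F T + m \<le> E * (f x * bump_mass TYPE(real^'n) + m)"
    by (simp add: E_def field_simps)
qed

text \<open>The ball of radius R about x lies deep inside the ball of radius 4 R about p, where the
  larger kernel is bounded away from 0. The power of 4 is the Jacobian of the change of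
  scale.\<close>

lemma bump_mean_le_bump_mean:
  fixes f :: "'a::euclidean_space \<Rightarrow> real"
  assumes f: "continuous_on (cball 0 (5 * R)) f" "\<And>y. y \<in> cball 0 (5 * R) \<Longrightarrow> 0 \<le> f y"
    and R: "R > 0" and x: "norm x \<le> R" and p: "norm p \<le> R"
  shows "bump_mean 2 f x R \<le> 256 / 49 * 4 ^ DIM('a) * bump_mean 2 f p (4 * R)"
proof -
  \<comment> \<open>The point \<open>x + R z\<close> written in the coordinates of the larger ball,
    that is, as \<open>p + 4 R w(z)\<close>.\<close>
  define w where "w z = (1 / 4) *\<^sub>R z + (1 / (4 * R)) *\<^sub>R (x - p)" for z
  have sub: "cball x R \<subseteq> cball 0 (5 * R)" "cball p (4 * R) \<subseteq> cball 0 (5 * R)"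
    using x p R by (simp_all add: cball_subset_cball_iff)
  define g where "g z = bump z ^ 2 * f (p + (4 * R) *\<^sub>R z)" for z
  have g: "cont_compact_supp g"
    unfolding g_def[abs_def] using R
    by (intro cont_compact_supp_bump_mult[OF continuous_on_subset[OF f(1) sub(2)]]) auto
  have fx: "cont_compact_supp (\<lambda>z. bump z ^ 2 * f (x + R *\<^sub>R z))"
    using R by (intro cont_compact_supp_bump_mult[OF continuous_on_subset[OF f(1) sub(1)]]) auto
  have gw1: "cont_compact_supp (\<lambda>z. g (w z))"
    unfolding w_def by (rule cont_compact_supp_affinity(1)[OF g]) simp
  have "integral UNIV (\<lambda>z. g (w z)) = integral UNIV g / \<bar>1 / 4\<bar> ^ DIM('a)"
    unfolding w_def by (rule cont_compact_supp_affinity(2)[OF g]) simp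
  also have "\<dots> = 4 ^ DIM('a) * bump_mean 2 f p (4 * R)"
    unfolding bump_mean_def g_def by (simp add: power_one_over)
  finally have gw2: "integral UNIV (\<lambda>z. g (w z)) = 4 ^ DIM('a) * bump_mean 2 f p (4 * R)" .
  have pt: "bump z ^ 2 * f (x + R *\<^sub>R z) \<le> 256 / 49 * g (w z)" for z
  proof -
    have g_nonneg: "g y \<ge> 0" for y
    proof (cases "norm y \<le> 1")
      case True
      then have "p + (4 * R) *\<^sub>R y \<in> cball p (4 * R)" using R by (intro affine_mem_cball) auto
      then show ?thesis using f(2) sub(2) by (auto simp: g_def)
    qed (simp add: g_def bump_outside)
    show ?thesis
    proof (cases "norm z \<le> 1")
      case True
      have eq: "x + R *\<^sub>R z = p + (4 * R) *\<^sub>R w z"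
        using R by (simp add: w_def scaleR_add_right)
      have "norm (w z) \<le> 1 / 4 * norm z + 1 / (4 * R) * norm (x - p)"
        unfolding w_def by (rule order_trans[OF norm_triangle_ineq]) (use R in simp)
      also have "\<dots> \<le> 1 / 4 * 1 + 1 / (4 * R) * (2 * R)"
        using True x p R norm_triangle_ineq4[of x p] by (intro add_mono mult_left_mono) auto
      also have "\<dots> = 3 / 4" using R by simp
      finally have "(norm (w z))\<^sup>2 \<le> (3 / 4)\<^sup>2" by (intro power_mono) auto
      \<comment> \<open>Since \<open>1 - (3/4)^2 = 7/16\<close>, the squared kernel is at least
        49/256; this is the source of the constant 256/49.\<close>
      then have "bump (w z) \<ge> 7 / 16" by (simp add: bump_def power2_eq_square)
      then have "(bump (w z))\<^sup>2 \<ge> (7 / 16)\<^sup>2" by (intro power_mono) auto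
      moreover have "bump z ^ 2 \<le> 1" using bump_nonneg[of z] bump_le_1[of z] by (simp add: power_le_one)
      ultimately have "bump z ^ 2 \<le> 256 / 49 * bump (w z) ^ 2" by (simp add: power2_eq_square)
      moreover have "x + R *\<^sub>R z \<in> cball x R" using True R by (intro affine_mem_cball) auto
      ultimately show ?thesis
        using mult_right_mono[of "bump z ^ 2" "256 / 49 * bump (w z) ^ 2" "f (x + R *\<^sub>R z)"] f(2) sub(1)
        by (auto simp: g_def eq)
    next
      case False then show ?thesis using g_nonneg by (simp add: bump_outside)
    qed
  qed
  have "integral UNIV (\<lambda>z. bump z ^ 2 * f (x + R *\<^sub>R z)) \<le> integral UNIV (\<lambda>z. 256 / 49 * g (w z))"
    using pt has_integral_mult_right[OF integrable_integral[OF cont_compact_supp_integrable[OF gw1]], of "256 / 49"]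
    by (intro integral_le cont_compact_supp_integrable[OF fx]) (auto simp: integrable_on_def)
  then show ?thesis using gw2 by (simp add: bump_mean_def)
qed

text \<open>The chain runs from the value at x to the mean about x, to the mean about p on the
  fourfold scale, to the value at p. The radius 5 R accommodates a ball of radius 4 R about any p
  with norm at most R. The constant is obtained before the function and its domain, hence is uniform
  in both.\<close>

theorem harnack_inequality:
  assumes R: "R > 0" and c: "c > 0"
  obtains C where "C > 0"
    "\<And>S (f :: real^'n::finite \<Rightarrow> real) \<delta> x p. open S \<Longrightarrow> Ck_on 2 S f \<Longrightarrow> cball 0 (5 * R) \<subseteq> S
      \<Longrightarrow> (\<And>y. y \<in> cball 0 (5 * R) \<Longrightarrow> 0 \<le> f y)
      \<Longrightarrow> (\<And>y. y \<in> cball 0 (5 * R) \<Longrightarrow> \<bar>laplacian f y\<bar> \<le> c * f y + \<delta>) \<Longrightarrow> \<delta> \<ge> 0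
      \<Longrightarrow> norm x \<le> R \<Longrightarrow> norm p \<le> R \<Longrightarrow> f x \<le> C * (f p + \<delta>)"
proof -
  define \<kappa> where "\<kappa> = bump_mass TYPE(real^'n)"
  define A :: real where "A = 256 / 49 * 4 ^ DIM(real^'n)"
  define C where "C = exp (c * R\<^sup>2 / 12) * A * exp (c * (4 * R)\<^sup>2 / 12) * max 1 (1 / c)"
  have \<kappa>: "\<kappa> > 0" unfolding \<kappa>_def by (rule bump_mass_pos)
  have "(1::real) \<le> 4 ^ DIM(real^'n)" by (rule one_le_power) simp
  then have A: "A \<ge> 1" unfolding A_def by linarith
  show thesis
  proof (rule that[of C])
    show "C > 0" using A by (simp add: C_def)
    fix S and f :: "real^'n \<Rightarrow> real" and \<delta> and x p :: "real^'n"
    assume S: "open S" "Ck_on 2 S f" "cball 0 (5 * R) \<subseteq> S"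
      and nn: "\<And>y. y \<in> cball 0 (5 * R) \<Longrightarrow> 0 \<le> f y"
      and lap: "\<And>y. y \<in> cball 0 (5 * R) \<Longrightarrow> \<bar>laplacian f y\<bar> \<le> c * f y + \<delta>"
      and \<delta>: "\<delta> \<ge> 0" and x: "norm x \<le> R" and p: "norm p \<le> R"
    have sub: "cball x R \<subseteq> cball 0 (5 * R)" "cball p (4 * R) \<subseteq> cball 0 (5 * R)"
      using x p R by (simp_all add: cball_subset_cball_iff)
    define m where "m = \<delta> / c * \<kappa>"
    have m: "m \<ge> 0" using \<delta> c \<kappa> by (simp add: m_def)
    have "f x * \<kappa> \<le> f x * \<kappa> + m" using m by simp
    also have "\<dots> \<le> exp (c * R\<^sup>2 / 12) * (bump_mean 2 f x R + m)"
      unfolding \<kappa>_def m_def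
      by (rule bump_mean_gronwall(2)[OF S(1,2) _ _ c]) (use sub S(3) R nn lap in auto)
    also have "\<dots> \<le> exp (c * R\<^sup>2 / 12) * (A * (bump_mean 2 f p (4 * R) + m))"
    proof (intro mult_left_mono)
      have "bump_mean 2 f x R \<le> A * bump_mean 2 f p (4 * R)"
        unfolding A_def
        by (rule bump_mean_le_bump_mean[OF continuous_on_subset[OF Ck_on_continuous[OF S(2)] S(3)] nn R x p])
      moreover have "m \<le> A * m" using A m mult_right_mono[of 1 A m] by simp
      ultimately show "bump_mean 2 f x R + m \<le> A * (bump_mean 2 f p (4 * R) + m)"
        by (simp add: distrib_left)
    qed simp
    also have "\<dots> \<le> exp (c * R\<^sup>2 / 12) * (A * (exp (c * (4 * R)\<^sup>2 / 12) * (f p * \<kappa> + m)))"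
    proof (intro mult_left_mono)
      show "bump_mean 2 f p (4 * R) + m \<le> exp (c * (4 * R)\<^sup>2 / 12) * (f p * \<kappa> + m)"
        unfolding \<kappa>_def m_def
        by (rule bump_mean_gronwall(1)[OF S(1,2) _ _ c]) (use sub S(3) R nn lap in auto)
    qed (use A in auto)
    also have "\<dots> = (exp (c * R\<^sup>2 / 12) * A * exp (c * (4 * R)\<^sup>2 / 12)) * (f p + 1 / c * \<delta>) * \<kappa>"
      by (simp add: m_def algebra_simps)
    finally have "f x \<le> (exp (c * R\<^sup>2 / 12) * A * exp (c * (4 * R)\<^sup>2 / 12)) * (f p + 1 / c * \<delta>)"
      using \<kappa> by simp
    also have "\<dots> \<le> (exp (c * R\<^sup>2 / 12) * A * exp (c * (4 * R)\<^sup>2 / 12)) * (max 1 (1 / c) * f p + max 1 (1 / c) * \<delta>)"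
    proof (intro mult_left_mono add_mono mult_right_mono)
      have "f p \<ge> 0" using nn p R by simp
      then show "f p \<le> max 1 (1 / c) * f p" using mult_right_mono[of 1 "max 1 (1 / c)" "f p"] by simp
    qed (use A \<delta> in auto)
    also have "\<dots> = C * (f p + \<delta>)" by (simp add: C_def algebra_simps)
    finally show "f x \<le> C * (f p + \<delta>)" .
  qed
qed

section \<open>Interior estimates\<close>

lemma pos_part_square_taylor:
  fixes y d :: real
  shows "\<bar>(max 0 (y + d))\<^sup>2 - (max 0 y)\<^sup>2 - 2 * max 0 y * d\<bar> \<le> d\<^sup>2"
proof -
  consider "y \<ge> 0" "y + d \<ge> 0" | "y \<ge> 0" "y + d < 0" | "y < 0" "y + d \<ge> 0" | "y < 0" "y + d < 0" by linarith
  then show ?thesis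
  proof cases
    case 1 then show ?thesis by (simp add: power2_eq_square algebra_simps)
  next
    case 2
    have "y * y \<le> y * (- d)" using 2 by (intro mult_left_mono) auto
    moreover have "(y + d) * (y + d) \<ge> 0" "y * y \<ge> 0" "d * d \<ge> 0" by simp_all
    moreover have "y * (- d) = - (y * d)" "(y + d) * (y + d) = y * y + 2 * (y * d) + d * d"
      by (simp_all add: algebra_simps)
    ultimately have "- (y * y) - 2 * (y * d) \<le> d * d" "y * y + 2 * (y * d) \<le> d * d"
      by linarith+
    then show ?thesis using 2 unfolding abs_le_iff by (simp add: power2_eq_square)
  next
    case 3
    then have "(y + d)\<^sup>2 \<le> d\<^sup>2" by (intro power_mono) auto
    then show ?thesis using 3 by simp
  next
    case 4 then show ?thesis by simp
  qed
qed

text \<open>The second derivative \<open>6 * max 0 y\<close> of the cube is at most 6 for y \<le> 1,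
  which yields the remainder \<open>3 * d^2\<close>. The case distinction takes care of the corner
  at 0.\<close>

lemma pos_part_cube_taylor:
  fixes y d :: real
  assumes "y \<le> 1" "y + d \<le> 1"
  shows "\<bar>(max 0 (y + d)) ^ 3 - (max 0 y) ^ 3 - 3 * (max 0 y)\<^sup>2 * d\<bar> \<le> 3 * d\<^sup>2"
proof -
  consider "y \<ge> 0" "y + d \<ge> 0" | "y \<ge> 0" "y + d < 0" | "y < 0" "y + d \<ge> 0" | "y < 0" "y + d < 0" by linarith
  then show ?thesis
  proof cases
    case 1
    have "(y + d) ^ 3 - y ^ 3 - 3 * y\<^sup>2 * d = d\<^sup>2 * (2 * y + (y + d))"
      by (simp add: power2_eq_square power3_eq_cube algebra_simps)
    moreover have "d\<^sup>2 * (2 * y + (y + d)) \<le> d\<^sup>2 * 3" "0 \<le> d\<^sup>2 * (2 * y + (y + d))"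
      using 1 assms by (intro mult_left_mono mult_nonneg_nonneg; simp)+
    ultimately show ?thesis using 1 by simp
  next
    case 2
    have *: "(max 0 (y + d)) ^ 3 - (max 0 y) ^ 3 - 3 * (max 0 y)\<^sup>2 * d = y\<^sup>2 * (- 3 * d - y)"
      using 2 by (simp add: power2_eq_square power3_eq_cube algebra_simps)
    have "y\<^sup>2 = y * y" by (simp add: power2_eq_square)
    also have "y * y \<le> (- d) * 1" using 2 assms by (intro mult_mono) auto
    finally have "y\<^sup>2 * (- 3 * d - y) \<le> (- d) * (- 3 * d)" using 2 by (intro mult_mono) auto
    moreover have "0 \<le> y\<^sup>2 * (- 3 * d - y)" using 2 by (intro mult_nonneg_nonneg) auto
    ultimately show ?thesis unfolding * by (simp add: power2_eq_square)
  next
    case 3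
    have "(y + d) ^ 3 = (y + d)\<^sup>2 * (y + d)" by (simp add: power2_eq_square power3_eq_cube)
    also have "\<dots> \<le> d\<^sup>2 * 1" using 3 assms by (intro mult_mono power_mono) auto
    finally have "(y + d) ^ 3 \<le> 3 * d\<^sup>2" using zero_le_power2[of d] by linarith
    then show ?thesis using 3 by simp
  next
    case 4 then show ?thesis by simp
  qed
qed

lemma bump_diff:
  fixes z b :: "'a::euclidean_space"
  assumes "norm b \<le> 1"
  shows "\<bar>bump (z + b) - bump z\<bar> \<le> 5 * norm b"
proof (cases "norm z \<le> 2")
  case True
  have "\<bar>bump (z + b) - bump z\<bar> \<le> \<bar>2 * (z \<bullet> b) + (norm b)\<^sup>2\<bar>"
    by (simp add: bump_def power2_norm_eq_inner inner_add inner_commute)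
  also have "\<dots> \<le> 2 * (norm z * norm b) + norm b * norm b"
    using Cauchy_Schwarz_ineq2[of z b] zero_le_square[of "norm b"] unfolding power2_eq_square by linarith
  also have "\<dots> \<le> 2 * (2 * norm b) + 1 * norm b"
    using True assms by (intro add_mono mult_left_mono mult_right_mono) auto
  finally show ?thesis by simp
next
  case False
  then have "norm (z + b) \<ge> 1" using assms norm_diff_ineq[of z b] by linarith
  with False show ?thesis by (simp add: bump_outside)
qed

lemma bump_power_diff:
  fixes z b :: "'a::euclidean_space"
  assumes "norm b \<le> 1" and n: "n \<in> {2, 3}"
  shows "\<bar>bump (z + b) ^ n - bump z ^ n\<bar> \<le> 15 * norm b"
proof -
  define u v where "u = bump (z + b)" and "v = bump z"
  have uv: "0 \<le> u" "u \<le> 1" "0 \<le> v" "v \<le> 1" by (auto simp: u_def v_def bump_nonneg bump_le_1)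
  have p: "u * u \<le> 1" "u * v \<le> 1" "v * v \<le> 1" "0 \<le> u * u" "0 \<le> u * v" "0 \<le> v * v"
    using uv by (auto intro: mult_le_one)
  have "u ^ 2 - v ^ 2 = (u - v) * (u + v)" "u ^ 3 - v ^ 3 = (u - v) * (u * u + u * v + v * v)"
    by (simp_all add: power2_eq_square power3_eq_cube algebra_simps)
  moreover have "\<bar>(u - v) * (u + v)\<bar> \<le> \<bar>u - v\<bar> * 3" "\<bar>(u - v) * (u * u + u * v + v * v)\<bar> \<le> \<bar>u - v\<bar> * 3"
    unfolding abs_mult using uv p by (intro mult_left_mono; simp add: abs_le_iff)+
  ultimately have "\<bar>u ^ n - v ^ n\<bar> \<le> \<bar>u - v\<bar> * 3" using n by auto
  with bump_diff[OF assms(1), of z] show ?thesis by (simp add: u_def v_def)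
qed

text \<open>The increments d1 and d2 of \<open>1 - |z|^2\<close> are each at most
  \<open>5 |b|\<close>, but their sum is only \<open>- 2 |b|^2\<close>, so the linear Taylor terms
  cancel to second order. For the cube the total is 75 + 75 + 6 = 156, rounded up to 160; the square
  needs less.\<close>

lemma bump_power_second_diff:
  fixes z b :: "'a::euclidean_space"
  assumes b: "norm b \<le> 1" and n: "n \<in> {2, 3}"
  shows "\<bar>bump (z + b) ^ n + bump (z - b) ^ n - 2 * bump z ^ n\<bar> \<le> 160 * (norm b)\<^sup>2"
proof (cases "norm z \<le> 2")
  case True
  define y where "y = 1 - (norm z)\<^sup>2"
  define d1 d2 where "d1 = - 2 * (z \<bullet> b) - (norm b)\<^sup>2" and "d2 = 2 * (z \<bullet> b) - (norm b)\<^sup>2"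
  have z: "bump z = max 0 y" by (simp add: bump_def y_def)
  have y1: "1 - (norm (z + b))\<^sup>2 = y + d1" and y2: "1 - (norm (z - b))\<^sup>2 = y + d2"
    unfolding y_def d1_def d2_def by (simp_all add: power2_norm_eq_inner inner_add inner_diff inner_commute)
  have b1: "bump (z + b) = max 0 (y + d1)" and b2: "bump (z - b) = max 0 (y + d2)"
    by (simp_all add: bump_def y1 y2)
  have le1: "y \<le> 1" "y + d1 \<le> 1" "y + d2 \<le> 1" unfolding y1[symmetric] y2[symmetric] by (simp_all add: y_def)
  have *: "\<bar>2 * (z \<bullet> b)\<bar> + (norm b)\<^sup>2 \<le> 5 * norm b"
  proof -
    have "\<bar>z \<bullet> b\<bar> \<le> norm z * norm b" by (rule Cauchy_Schwarz_ineq2)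
    also have "\<dots> \<le> 2 * norm b" using True by (intro mult_right_mono) auto
    finally have "\<bar>2 * (z \<bullet> b)\<bar> \<le> 4 * norm b" by simp
    moreover have "(norm b)\<^sup>2 \<le> 1 * norm b" unfolding power2_eq_square using b by (intro mult_right_mono) auto
    ultimately show ?thesis by simp
  qed
  have "\<bar>d1\<bar> \<le> 5 * norm b" "\<bar>d2\<bar> \<le> 5 * norm b"
    using * zero_le_power2[of "norm b"] unfolding d1_def d2_def by linarith+
  then have "\<bar>d1\<bar>\<^sup>2 \<le> (5 * norm b)\<^sup>2" "\<bar>d2\<bar>\<^sup>2 \<le> (5 * norm b)\<^sup>2" by (intro power_mono; simp)+
  then have dd: "d1\<^sup>2 \<le> 25 * (norm b)\<^sup>2" "d2\<^sup>2 \<le> 25 * (norm b)\<^sup>2" by (simp_all add: power_mult_distrib)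
  have s: "d1 + d2 = - 2 * (norm b)\<^sup>2" by (simp add: d1_def d2_def)
  have m: "max 0 y * (norm b)\<^sup>2 \<le> 1 * (norm b)\<^sup>2" "(max 0 y)\<^sup>2 * (norm b)\<^sup>2 \<le> 1 * (norm b)\<^sup>2"
    "0 \<le> max 0 y * (norm b)\<^sup>2" "0 \<le> (max 0 y)\<^sup>2 * (norm b)\<^sup>2"
    using le1(1) by (intro mult_right_mono power_le_one mult_nonneg_nonneg; simp)+
  from n show ?thesis
  proof safe
    have "2 * max 0 y * d1 + 2 * max 0 y * d2 = - 4 * (max 0 y * (norm b)\<^sup>2)"
      unfolding distrib_left[symmetric] s by simp
    then show "\<bar>bump (z + b) ^ 2 + bump (z - b) ^ 2 - 2 * bump z ^ 2\<bar> \<le> 160 * (norm b)\<^sup>2"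
      using pos_part_square_taylor[of y d1] pos_part_square_taylor[of y d2] dd(1,2) m(1,3)
      unfolding z[symmetric] b1[symmetric] b2[symmetric] by linarith
    have "3 * (max 0 y)\<^sup>2 * d1 + 3 * (max 0 y)\<^sup>2 * d2 = - 6 * ((max 0 y)\<^sup>2 * (norm b)\<^sup>2)"
      unfolding distrib_left[symmetric] s by simp
    then show "\<bar>bump (z + b) ^ 3 + bump (z - b) ^ 3 - 2 * bump z ^ 3\<bar> \<le> 160 * (norm b)\<^sup>2"
      using pos_part_cube_taylor[of y d1] pos_part_cube_taylor[of y d2] dd(1,2) m(2,4) le1
      unfolding z[symmetric] b1[symmetric] b2[symmetric] by linarith
  qed
next
  case False
  then have "norm (z + b) \<ge> 1" "norm (z - b) \<ge> 1" using b norm_diff_ineq[of z b] norm_triangle_ineq2[of z b] by linarith+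
  with False n show ?thesis by (auto simp: bump_outside)
qed

text \<open>The volume of a box containing the ball of radius 2, and with it the supports of all
  kernels shifted by at most 1.\<close>

definition bump_volume :: "'a::euclidean_space itself \<Rightarrow> real" where
  "bump_volume _ = measure lborel (cbox (- 2 *\<^sub>R One) (2 *\<^sub>R One :: 'a))"

lemma bump_volume_nonneg: "bump_volume TYPE('a::euclidean_space) \<ge> 0"
  unfolding bump_volume_def by (rule measure_nonneg)

lemma integral_bound_ball2:
  fixes \<psi> :: "'a::euclidean_space \<Rightarrow> real"
  assumes "cont_compact_supp \<psi>" "\<And>z. norm z \<ge> 2 \<Longrightarrow> \<psi> z = 0" "\<And>z. norm z \<le> 2 \<Longrightarrow> \<bar>\<psi> z\<bar> \<le> B" "0 \<le> B"
  shows "\<bar>integral UNIV \<psi>\<bar> \<le> B * bump_volume TYPE('a)"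
proof -
  have "\<psi> z = 0" if "z \<notin> cbox (- 2 *\<^sub>R One) (2 *\<^sub>R One)" for z
  proof (rule assms(2), rule ccontr)
    assume "\<not> norm z \<ge> 2"
    then have "- 2 \<le> z \<bullet> i \<and> z \<bullet> i \<le> 2" if "i \<in> Basis" for i using Basis_le_norm[OF that, of z] by (simp add: abs_le_iff)
    with that show False by (auto simp: mem_box)
  qed
  then have h: "(\<psi> has_integral integral UNIV \<psi>) (cbox (- 2 *\<^sub>R One) (2 *\<^sub>R One))"
    using assms(1) by (intro cont_compact_supp_has_integral) (auto simp: cont_compact_supp_def)
  have "norm (integral UNIV \<psi>) \<le> B * measure lborel (cbox (- 2 *\<^sub>R One) (2 *\<^sub>R One :: 'a))"
    by (rule has_integral_bound[OF assms(4) h]) (use assms(2,3,4) in \<open>metis abs_zero linear real_norm_def\<close>)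
  then show ?thesis by (simp add: bump_volume_def)
qed

text \<open>Substituting z - a/t for z moves the displacement of the centre onto the kernel.
  Differences of means in the centre become integrals of g against differences of a fixed smooth
  enough kernel, so g itself need not be differentiable. The condition on a keeps the kernel shift
  at most 1.\<close>

lemma bump_mean_shift:
  fixes g :: "'a::euclidean_space \<Rightarrow> real"
  assumes g: "continuous_on (cball x 2) g" and t: "0 < t" "t \<le> 1" and a: "norm a \<le> t" and n: "n > 0"
  shows "cont_compact_supp (\<lambda>z. bump (z - (1 / t) *\<^sub>R a) ^ n * g (x + t *\<^sub>R z))"
    and "bump_mean n g (x + a) t = integral UNIV (\<lambda>z. bump (z - (1 / t) *\<^sub>R a) ^ n * g (x + t *\<^sub>R z))"
proof -
  have sub: "cball (x + a) 1 \<subseteq> cball x 2"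
    using a t by (simp add: cball_subset_cball_iff dist_norm)
  have c: "cont_compact_supp (\<lambda>z. bump z ^ n * g (x + a + t *\<^sub>R z))"
    using t n by (intro cont_compact_supp_bump_mult[OF continuous_on_subset[OF g sub]]) auto
  have eq: "x + a + t *\<^sub>R (z + - ((1 / t) *\<^sub>R a)) = x + t *\<^sub>R z" for z
    using t by (simp add: scaleR_diff_right)
  note tr = cont_compact_supp_translate[OF c, of "- ((1 / t) *\<^sub>R a)", unfolded eq]
  show "cont_compact_supp (\<lambda>z. bump (z - (1 / t) *\<^sub>R a) ^ n * g (x + t *\<^sub>R z))"
    using tr(1) by simp
  show "bump_mean n g (x + a) t = integral UNIV (\<lambda>z. bump (z - (1 / t) *\<^sub>R a) ^ n * g (x + t *\<^sub>R z))"
    using tr(2) by (simp add: bump_mean_def)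
qed

lemma bump_shift_outside:
  fixes z b :: "'a::euclidean_space"
  assumes "norm z \<ge> 2" "norm b \<le> 1"
  shows "bump (z - b) = 0" "bump (z + b) = 0" "bump z = 0"
  using assms norm_triangle_ineq2[of z b] norm_diff_ineq[of z b] by (auto intro!: bump_outside)

lemma bump_mean_diff_bound:
  fixes g :: "'a::euclidean_space \<Rightarrow> real"
  assumes g: "continuous_on (cball x 2) g" "\<And>y. y \<in> cball x 2 \<Longrightarrow> \<bar>g y\<bar> \<le> G"
    and t: "0 < t" "t \<le> 1" and a: "norm a \<le> t" and n: "n \<in> {2, 3}"
  shows "\<bar>bump_mean n g (x + a) t - bump_mean n g x t\<bar> \<le> 15 * (norm a / t) * G * bump_volume TYPE('a)"
proof -
  let ?b = "(1 / t) *\<^sub>R a"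
  have n0: "n > 0" using n by auto
  have b: "norm ?b \<le> 1" using a t by simp
  have nb: "norm ?b = norm a / t" using t by simp
  have G: "G \<ge> 0" using g(2)[of x] by force
  note s1 = bump_mean_shift[OF g(1) t a n0]
  have a0: "norm (0::'a) \<le> t" using t by simp
  note s2 = bump_mean_shift[OF g(1) t a0 n0, simplified]
  note i1 = cont_compact_supp_integrable[OF s1(1)] and i2 = cont_compact_supp_integrable[OF s2(1)]
  let ?\<psi> = "\<lambda>z. bump (z - ?b) ^ n * g (x + t *\<^sub>R z) - bump z ^ n * g (x + t *\<^sub>R z)"
  have out: "?\<psi> z = 0" if "norm z \<ge> 2" for z
    using bump_shift_outside[OF that b] n0 by simp
  have "\<bar>integral UNIV ?\<psi>\<bar> \<le> (15 * (norm a / t) * G) * bump_volume TYPE('a)"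
  proof (rule integral_bound_ball2[OF _ out])
    show "cont_compact_supp ?\<psi>"
      using s1(1) s2(1) out by (intro cont_compact_suppI[of _ 2]) (auto simp: cont_compact_supp_def intro!: continuous_on_diff)
    fix z :: 'a assume z: "norm z \<le> 2"
    have "\<bar>bump (z + - ?b) ^ n - bump z ^ n\<bar> \<le> 15 * norm (- ?b)"
      by (rule bump_power_diff) (use b n in auto)
    moreover have "\<bar>g (x + t *\<^sub>R z)\<bar> \<le> G" using z t affine_mem_cball[OF z, of t 2 x] by (intro g(2)) auto
    ultimately have "\<bar>bump (z + - ?b) ^ n - bump z ^ n\<bar> * \<bar>g (x + t *\<^sub>R z)\<bar> \<le> 15 * norm (- ?b) * G"
      by (intro mult_mono) auto
    then show "\<bar>?\<psi> z\<bar> \<le> 15 * (norm a / t) * G"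
      unfolding norm_minus_cancel nb by (simp add: abs_mult[symmetric] left_diff_distrib)
  qed (use G t in auto)
  then show ?thesis
    using integral_diff[OF i1 i2] s1(2) s2(2) by simp
qed

text \<open>The second difference of the kernel has integral 0 by translation invariance, so any
  constant \<beta> may be subtracted from g. Only the oscillation of g counts, which is what turns
  Hoelder continuity into a gain.\<close>

lemma bump_mean_second_diff_bound:
  fixes g :: "'a::euclidean_space \<Rightarrow> real"
  assumes g: "continuous_on (cball x 2) g"
    and G: "\<And>z. norm z \<le> 2 \<Longrightarrow> \<bar>g (x + t *\<^sub>R z) - \<beta>\<bar> \<le> G"
    and t: "0 < t" "t \<le> 1" and a: "norm a \<le> t" and n: "n \<in> {2, 3}"
  shows "\<bar>bump_mean n g (x + a) t + bump_mean n g (x - a) t - 2 * bump_mean n g x t\<bar>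
    \<le> 160 * (norm a / t)\<^sup>2 * G * bump_volume TYPE('a)"
proof -
  let ?b = "(1 / t) *\<^sub>R a"
  have n0: "n > 0" using n by auto
  have b: "norm ?b \<le> 1" using a t by simp
  have nb: "norm ?b = norm a / t" using t by simp
  have G0: "G \<ge> 0" using G[of 0] by simp
  have a': "norm (- a) \<le> t" "norm (0::'a) \<le> t" using a t by auto
  note s1 = bump_mean_shift[OF g(1) t a n0]
  note s2 = bump_mean_shift[OF g(1) t a'(1) n0, simplified]
  note s3 = bump_mean_shift[OF g(1) t a'(2) n0, simplified]
  note i = s1(1)[THEN cont_compact_supp_integrable] s2(1)[THEN cont_compact_supp_integrable] s3(1)[THEN cont_compact_supp_integrable]
  let ?k = "\<lambda>z. bump (z - ?b) ^ n + bump (z + ?b) ^ n - 2 * bump z ^ n"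
  have kout: "?k z = 0" if "norm z \<ge> 2" for z
    using bump_shift_outside[OF that b] n0 by simp
  note cb = cont_compact_supp_bump[OF n0]
  note tr = cont_compact_supp_translate[OF cb]
  have "(?k has_integral integral UNIV (\<lambda>z::'a. bump z ^ n) + integral UNIV (\<lambda>z::'a. bump z ^ n)
      - 2 * integral UNIV (\<lambda>z::'a. bump z ^ n)) UNIV"
    using tr(1)[of "- ?b", THEN cont_compact_supp_integrable, THEN integrable_integral]
      tr(1)[of "?b", THEN cont_compact_supp_integrable, THEN integrable_integral]
      cb[THEN cont_compact_supp_integrable, THEN integrable_integral]
    by (intro has_integral_diff has_integral_add has_integral_mult_right) (simp_all add: tr(2)[of "- ?b", simplified] tr(2))
  then have k0: "(?k has_integral 0) UNIV" by simp
  let ?\<psi> = "\<lambda>z. ?k z * (g (x + t *\<^sub>R z) - \<beta>)"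
  have hi: "((\<lambda>z. bump (z - ?b) ^ n * g (x + t *\<^sub>R z) + bump (z + ?b) ^ n * g (x + t *\<^sub>R z)
     - 2 * (bump z ^ n * g (x + t *\<^sub>R z)) - \<beta> * ?k z) has_integral
     bump_mean n g (x + a) t + bump_mean n g (x - a) t - 2 * bump_mean n g x t - \<beta> * 0) UNIV"
    unfolding s1(2) s2(2) s3(2) using i
    by (intro has_integral_diff has_integral_add has_integral_mult_right k0 integrable_integral)
  have \<psi>: "?\<psi> = (\<lambda>z. bump (z - ?b) ^ n * g (x + t *\<^sub>R z) + bump (z + ?b) ^ n * g (x + t *\<^sub>R z)
     - 2 * (bump z ^ n * g (x + t *\<^sub>R z)) - \<beta> * ?k z)"
    by (simp add: fun_eq_iff algebra_simps)
  have out: "?\<psi> z = 0" if "norm z \<ge> 2" for z using kout[OF that] by simp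
  have "\<bar>integral UNIV ?\<psi>\<bar> \<le> (160 * (norm a / t)\<^sup>2 * G) * bump_volume TYPE('a)"
  proof (rule integral_bound_ball2[OF _ out])
    show "cont_compact_supp ?\<psi>"
    proof (rule cont_compact_suppI[of _ 2, OF _ out])
      have ck: "continuous_on UNIV ?k" by (intro continuous_intros)
      show "continuous_on UNIV ?\<psi>"
        unfolding \<psi> using s1(1) s2(1) s3(1) unfolding cont_compact_supp_def
        by (intro continuous_on_diff[OF continuous_on_diff[OF continuous_on_add continuous_on_mult_left]] continuous_on_mult_left[OF ck]) auto
    qed
    fix z :: 'a assume z: "norm z \<le> 2"
    have "\<bar>?k z\<bar> \<le> 160 * (norm ?b)\<^sup>2"
      using bump_power_second_diff[OF b n, of z] by (simp add: add.commute)
    then have "\<bar>?k z\<bar> * \<bar>g (x + t *\<^sub>R z) - \<beta>\<bar> \<le> 160 * (norm ?b)\<^sup>2 * G"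
      using G[OF z] by (intro mult_mono) auto
    then show "\<bar>?\<psi> z\<bar> \<le> 160 * (norm a / t)\<^sup>2 * G" unfolding nb by (simp add: abs_mult)
  qed (use G0 t in auto)
  then show ?thesis using integral_unique[OF hi] unfolding \<psi> by simp
qed

lemma bump_mean_bound:
  fixes g :: "'a::euclidean_space \<Rightarrow> real"
  assumes "cont_compact_supp (\<lambda>z. bump z ^ n * h z)" "n > 0" "\<And>z. norm z \<le> 1 \<Longrightarrow> \<bar>h z\<bar> \<le> B" "0 \<le> B"
  shows "\<bar>integral UNIV (\<lambda>z::'a. bump z ^ n * h z)\<bar> \<le> B * bump_volume TYPE('a)"
proof (rule integral_bound_ball2[OF assms(1)])
  show "bump z ^ n * h z = 0" if "norm z \<ge> 2" for z :: 'a using that assms(2) by (simp add: bump_outside)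
  show "\<bar>bump z ^ n * h z\<bar> \<le> B" for z :: 'a
  proof (cases "norm z \<le> 1")
    case True
    have "\<bar>bump z ^ n\<bar> * \<bar>h z\<bar> \<le> 1 * B"
      using assms(3)[OF True] by (intro mult_mono) (auto simp: bump_nonneg bump_le_1 power_le_one)
    then show ?thesis by (simp add: abs_mult)
  next
    case False then show ?thesis using assms(2,4) by (simp add: bump_outside zero_power)
  qed
qed fact

text \<open>The difference \<Phi> of the means at x + a and x is followed from t = 1, where the
  kernel carries the difference and M suffices, down to t = 0, where it is the difference of f up to
  the mass. Shifting the kernel costs \<open>|a| / t\<close>, and the factor t in the derivative
  identity compensates exactly.\<close>

theorem lipschitz_estimate:
  fixes f :: "real^'n::finite \<Rightarrow> real"
  assumes S: "open S" "Ck_on 2 S f" "cball x 2 \<subseteq> S"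
    and M: "\<And>y. y \<in> cball x 2 \<Longrightarrow> \<bar>f y\<bar> \<le> M" and G: "\<And>y. y \<in> cball x 2 \<Longrightarrow> \<bar>laplacian f y\<bar> \<le> G"
    and a: "norm a \<le> 1"
  shows "\<bar>f (x + a) - f x\<bar> \<le> 15 * bump_volume TYPE(real^'n) / bump_mass TYPE(real^'n) * (M + G) * norm a"
proof -
  define V where "V = bump_volume TYPE(real^'n)"
  define g where "g = laplacian f"
  have V: "V \<ge> 0" unfolding V_def by (rule bump_volume_nonneg)
  have \<kappa>: "bump_mass TYPE(real^'n) > 0" by (rule bump_mass_pos)
  have M0: "M \<ge> 0" and G0: "G \<ge> 0" using M[of x] G[of x] by force+
  have cf: "continuous_on (cball x 2) f" using Ck_on_continuous[OF S(2)] S(3) continuous_on_subset by blast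
  have cg: "continuous_on (cball x 2) g"
    using Ck_on_continuous_laplacian[OF S(2)] S(3) continuous_on_subset unfolding g_def by blast
  have sub: "cball (x + a) 1 \<subseteq> cball x 2" "cball x 1 \<subseteq> cball x 2"
    using a by (simp_all add: cball_subset_cball_iff dist_norm)
  define \<Phi> where "\<Phi> t = bump_mean 2 f (x + a) t - bump_mean 2 f x t" for t
  have "norm (\<Phi> 1 - \<Phi> 0) \<le> 3 * norm a * G * V * 1 - 3 * norm a * G * V * 0"
  proof (rule differentiable_bound_general[where \<phi> = "\<lambda>t. 3 * norm a * G * V * t" and \<phi>' = "\<lambda>_. 3 * norm a * G * V"])
    show "continuous_on {0..1} \<Phi>"
      unfolding \<Phi>_def using S(3) sub by (intro continuous_on_diff continuous_on_bump_mean[OF S(1,2)]) auto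
    fix t :: real assume t: "0 < t" "t < 1"
    show "(\<Phi> has_vector_derivative t / 6 * bump_mean 3 g (x + a) t - t / 6 * bump_mean 3 g x t) (at t)"
      unfolding \<Phi>_def has_real_derivative_iff_has_vector_derivative[symmetric] g_def
      using S(3) sub t by (intro DERIV_diff bump_mean_has_field_derivative[OF S(1,2), where T = 1]) auto
    show "((\<lambda>t. 3 * norm a * G * V * t) has_vector_derivative 3 * norm a * G * V) (at t)"
      unfolding has_real_derivative_iff_has_vector_derivative[symmetric] by (auto intro!: derivative_eq_intros)
    have "\<bar>bump_mean 3 g (x + a) t - bump_mean 3 g x t\<bar> \<le> 15 * (norm a / t) * G * V"
    proof (cases "norm a \<le> t")
      case True
      then show ?thesis
        unfolding V_def using t G by (intro bump_mean_diff_bound cg) (auto simp: g_def)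
    next
      case False
      have B: "\<bar>bump_mean 3 g y t\<bar> \<le> G * V" if "cball y 1 \<subseteq> cball x 2" for y
        unfolding bump_mean_def V_def
      proof (rule bump_mean_bound)
        show "cont_compact_supp (\<lambda>z. bump z ^ 3 * g (y + t *\<^sub>R z))"
          using t by (intro cont_compact_supp_bump_mult[OF continuous_on_subset[OF cg that]]) auto
        show "\<bar>g (y + t *\<^sub>R z)\<bar> \<le> G" if "norm z \<le> 1" for z
          using affine_mem_cball[OF that, of t 1 y] t \<open>cball y 1 \<subseteq> cball x 2\<close> G by (auto simp: g_def)
      qed (use G0 in auto)
      \<comment> \<open>On scales below \<open>|a|\<close> the shifted kernel is out of reach; the
        two means are estimated separately, and \<open>|a| / t \<ge> 1\<close> brings the crude
        bound into the same form.\<close>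
      have "1 \<le> norm a / t" using False t by simp
      then have "1 * (G * V) \<le> (norm a / t) * (G * V)" using G0 V by (intro mult_right_mono) auto
      moreover have "0 \<le> (norm a / t) * (G * V)" using G0 V t by auto
      ultimately show ?thesis using B[OF sub(1)] B[OF sub(2)] by (simp add: mult.assoc)
    qed
    then have "t / 6 * \<bar>bump_mean 3 g (x + a) t - bump_mean 3 g x t\<bar> \<le> t / 6 * (15 * (norm a / t) * G * V)"
      using t by (intro mult_left_mono) auto
    also have "\<dots> = 15 / 6 * (norm a * G * V)" using t by simp
    also have "\<dots> \<le> 3 * (norm a * G * V)" using G0 V by (intro mult_right_mono) auto
    finally show "norm (t / 6 * bump_mean 3 g (x + a) t - t / 6 * bump_mean 3 g x t) \<le> 3 * norm a * G * V"
      using t by (simp add: right_diff_distrib[symmetric] abs_mult mult.assoc del: times_divide_eq_left)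
  qed (auto intro!: continuous_intros)
  moreover have "\<bar>\<Phi> 1\<bar> \<le> 15 * norm a * M * V"
    using bump_mean_diff_bound[OF cf M, of 1 a 2] a unfolding \<Phi>_def V_def by simp
  ultimately have "\<bar>\<Phi> 0\<bar> \<le> 15 * norm a * M * V + 3 * norm a * G * V" by simp
  also have "\<dots> \<le> 15 * norm a * M * V + 15 * norm a * G * V"
    using G0 V by (intro add_left_mono mult_right_mono) auto
  finally have "\<bar>f (x + a) - f x\<bar> * bump_mass TYPE(real^'n) \<le> 15 * V * (M + G) * norm a"
  proof -
    assume *: "\<bar>\<Phi> 0\<bar> \<le> 15 * norm a * M * V + 15 * norm a * G * V"
    have "\<bar>\<Phi> 0\<bar> = \<bar>f (x + a) - f x\<bar> * bump_mass TYPE(real^'n)"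
      unfolding \<Phi>_def bump_mean_0 left_diff_distrib[symmetric] abs_mult using \<kappa> by simp
    with * show ?thesis by (simp add: algebra_simps)
  qed
  then show ?thesis using \<kappa> by (simp add: V_def field_simps)
qed

text \<open>A Schauder estimate in terms of second differences; the integrand \<open>t powr (\<gamma> - 1)\<close>
  below is integrable at \<open>0\<close> precisely because \<open>\<gamma> > 0\<close>.\<close>

theorem second_difference_estimate:
  fixes f :: "real^'n::finite \<Rightarrow> real"
  assumes S: "open S" "Ck_on 2 S f" "cball x 2 \<subseteq> S" and \<gamma>: "0 < \<gamma>" "\<gamma> \<le> 1"
    and M: "\<And>y. y \<in> cball x 2 \<Longrightarrow> \<bar>f y\<bar> \<le> M"
    and H: "\<And>y y'. y \<in> cball x 2 \<Longrightarrow> y' \<in> cball x 2 \<Longrightarrow> \<bar>laplacian f y - laplacian f y'\<bar> \<le> H * dist y y' powr \<gamma>"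
    and H0: "H \<ge> 0" and a: "norm a \<le> 1"
  shows "\<bar>f (x + a) + f (x - a) - 2 * f x\<bar>
    \<le> 160 * bump_volume TYPE(real^'n) / (\<gamma> * bump_mass TYPE(real^'n)) * (M + H) * (norm a)\<^sup>2"
proof (cases "a = 0")
  case True then show ?thesis by simp
next
  case a0: False
  define V where "V = bump_volume TYPE(real^'n)"
  define g where "g = laplacian f"
  have V: "V \<ge> 0" unfolding V_def by (rule bump_volume_nonneg)
  have \<kappa>: "bump_mass TYPE(real^'n) > 0" by (rule bump_mass_pos)
  have M0: "M \<ge> 0" using M[of x] by force
  have cf: "continuous_on (cball x 2) f" using Ck_on_continuous[OF S(2)] S(3) continuous_on_subset by blast
  have cg: "continuous_on (cball x 2) g"
    using Ck_on_continuous_laplacian[OF S(2)] S(3) continuous_on_subset unfolding g_def by blast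
  have sub: "cball (x + a) 1 \<subseteq> cball x 2" "cball (x - a) 1 \<subseteq> cball x 2" "cball x 1 \<subseteq> cball x 2"
    using a by (simp_all add: cball_subset_cball_iff dist_norm)
  define \<Phi> where "\<Phi> t = bump_mean 2 f (x + a) t + bump_mean 2 f (x - a) t - 2 * bump_mean 2 f x t" for t
  define \<Phi>' where "\<Phi>' t = t / 6 * (bump_mean 3 g (x + a) t + bump_mean 3 g (x - a) t - 2 * bump_mean 3 g x t)" for t
  define A where "A = 60 * (norm a)\<^sup>2 * H * V"
  have A: "A \<ge> 0" using H0 V by (simp add: A_def)
  have "norm (\<Phi> 1 - \<Phi> 0) \<le> A / \<gamma> * (1 powr \<gamma>) - A / \<gamma> * (0 powr \<gamma>)"
  \<comment> \<open>For \<gamma> < 1 the derivative of the comparison function is unbounded at 0, so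
    the mean value inequality is used with continuity on [0, 1] and derivatives only in the
    interior.\<close>
  proof (rule differentiable_bound_general[where \<phi> = "\<lambda>t. A / \<gamma> * (t powr \<gamma>)" and \<phi>' = "\<lambda>t. A * t powr (\<gamma> - 1)"])
    show "continuous_on {0..1} \<Phi>"
      unfolding \<Phi>_def using S(3) sub by (intro continuous_on_diff continuous_on_add continuous_on_mult_left continuous_on_bump_mean[OF S(1,2)]) auto
    show "continuous_on {0..1} (\<lambda>t. A / \<gamma> * t powr \<gamma>)"
      using \<gamma> by (intro continuous_on_mult continuous_on_const continuous_on_powr') (auto intro!: continuous_intros)
    fix t :: real assume t: "0 < t" "t < 1"
    show "(\<Phi> has_vector_derivative \<Phi>' t) (at t)"
      unfolding \<Phi>_def \<Phi>'_def has_real_derivative_iff_has_vector_derivative[symmetric] g_def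
    proof -
      have d: "(bump_mean 2 f y has_real_derivative t / 6 * bump_mean 3 (laplacian f) y t) (at t)"
        if "cball y 1 \<subseteq> cball x 2" for y
        using that S(3) t by (intro bump_mean_has_field_derivative[OF S(1,2), where T = 1]) auto
      show "((\<lambda>t. bump_mean 2 f (x + a) t + bump_mean 2 f (x - a) t - 2 * bump_mean 2 f x t) has_real_derivative
        t / 6 * (bump_mean 3 (laplacian f) (x + a) t + bump_mean 3 (laplacian f) (x - a) t
          - 2 * bump_mean 3 (laplacian f) x t)) (at t)"
        by (rule DERIV_cong[OF DERIV_diff[OF DERIV_add[OF d[OF sub(1)] d[OF sub(2)]] DERIV_cmult[OF d[OF sub(3)], of 2]]])
          (simp add: algebra_simps)
    qed
    show "((\<lambda>t. A / \<gamma> * t powr \<gamma>) has_vector_derivative A * t powr (\<gamma> - 1)) (at t)"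
      unfolding has_real_derivative_iff_has_vector_derivative[symmetric]
      using t \<gamma> by (auto intro!: derivative_eq_intros)
    \<comment> \<open>Both ranges of t lead to a multiple of \<open>|a|^2 t^(\<gamma> - 2)\<close>.
      For t \<ge> \<open>|a|\<close> the second difference of the kernel gives
      \<open>(|a| / t)^2\<close> and the oscillation of g gives \<open>2 t^\<gamma>\<close>, hence
      320, which fits into 6 * 60.\<close>
    have "\<bar>bump_mean 3 g (x + a) t + bump_mean 3 g (x - a) t - 2 * bump_mean 3 g x t\<bar>
      \<le> 6 * A * (t powr (\<gamma> - 1) / t)"
    proof (cases "norm a \<le> t")
      case True
      have "\<bar>bump_mean 3 g (x + a) t + bump_mean 3 g (x - a) t - 2 * bump_mean 3 g x t\<bar>
         \<le> 160 * (norm a / t)\<^sup>2 * (H * (2 * t powr \<gamma>)) * V"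
        unfolding V_def
      proof (rule bump_mean_second_diff_bound[OF cg _ _ _ True, where \<beta> = "g x"])
        fix z :: "real^'n" assume z: "norm z \<le> 2"
        have "x + t *\<^sub>R z \<in> cball x 2" using z t by (intro affine_mem_cball) auto
        then have "\<bar>g (x + t *\<^sub>R z) - g x\<bar> \<le> H * dist (x + t *\<^sub>R z) x powr \<gamma>"
          unfolding g_def by (intro H) auto
        also have "\<dots> \<le> H * (2 * t) powr \<gamma>"
          using z t \<gamma> H0 mult_left_mono[OF z, of t] by (intro mult_left_mono powr_mono2) (auto simp: dist_norm mult.commute)
        also have "\<dots> = H * (2 powr \<gamma> * t powr \<gamma>)" using t by (simp add: powr_mult)
        also have "\<dots> \<le> H * (2 powr 1 * t powr \<gamma>)"
          using H0 \<gamma> by (intro mult_left_mono mult_right_mono powr_mono) auto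
        finally show "\<bar>g (x + t *\<^sub>R z) - g x\<bar> \<le> H * (2 * t powr \<gamma>)" by simp
      qed (use t in auto)
      also have "\<dots> = 320 * ((norm a)\<^sup>2 * H * V) * (t powr \<gamma> / t\<^sup>2)" by (simp add: power_divide)
      also have "t powr \<gamma> / t\<^sup>2 = t powr (\<gamma> - 1) / t" using t by (simp add: powr_diff power2_eq_square)
      also have "320 * ((norm a)\<^sup>2 * H * V) * (t powr (\<gamma> - 1) / t) \<le> 360 * ((norm a)\<^sup>2 * H * V) * (t powr (\<gamma> - 1) / t)"
        using t H0 V by (intro mult_right_mono) auto
      finally show ?thesis by (simp add: A_def mult.assoc)
    next
      case False
      let ?h = "\<lambda>z. g (x + a + t *\<^sub>R z) + g (x - a + t *\<^sub>R z) - 2 * g (x + t *\<^sub>R z)"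
      have cc: "cont_compact_supp (\<lambda>z. bump z ^ 3 * g (y + t *\<^sub>R z))" if "cball y 1 \<subseteq> cball x 2" for y
        using t by (intro cont_compact_supp_bump_mult[OF continuous_on_subset[OF cg that]]) auto
      have eq: "bump z ^ 3 * ?h z = bump z ^ 3 * g (x + a + t *\<^sub>R z) + bump z ^ 3 * g (x - a + t *\<^sub>R z)
          - 2 * (bump z ^ 3 * g (x + t *\<^sub>R z))" for z
        by (simp add: algebra_simps)
      have ch: "cont_compact_supp (\<lambda>z. bump z ^ 3 * ?h z)"
      proof (rule cont_compact_suppI[of _ 1])
        show "continuous_on UNIV (\<lambda>z. bump z ^ 3 * ?h z)"
          unfolding eq using cc[OF sub(1)] cc[OF sub(2)] cc[OF sub(3)] unfolding cont_compact_supp_def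
          by (intro continuous_on_diff[OF continuous_on_add continuous_on_mult_left]) auto
      qed (simp add: bump_outside)
      have "((\<lambda>z. bump z ^ 3 * ?h z) has_integral
         bump_mean 3 g (x + a) t + bump_mean 3 g (x - a) t - 2 * bump_mean 3 g x t) UNIV"
        unfolding eq bump_mean_def
        by (intro has_integral_diff has_integral_add has_integral_mult_right integrable_integral cont_compact_supp_integrable cc sub)
      then have "\<bar>bump_mean 3 g (x + a) t + bump_mean 3 g (x - a) t - 2 * bump_mean 3 g x t\<bar>
         = \<bar>integral UNIV (\<lambda>z. bump z ^ 3 * ?h z)\<bar>" by (simp add: integral_unique)
      also have "\<dots> \<le> (2 * (H * norm a powr \<gamma>)) * V"
        unfolding V_def
      proof (rule bump_mean_bound[OF ch])
        fix z :: "real^'n" assume z: "norm z \<le> 1"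
        have mem: "y + t *\<^sub>R z \<in> cball y 1" for y using z t by (intro affine_mem_cball) auto
        have "\<bar>g (x + a + t *\<^sub>R z) - g (x + t *\<^sub>R z)\<bar> \<le> H * dist (x + a + t *\<^sub>R z) (x + t *\<^sub>R z) powr \<gamma>"
          unfolding g_def by (intro H; meson mem sub subsetD)
        moreover have "\<bar>g (x - a + t *\<^sub>R z) - g (x + t *\<^sub>R z)\<bar> \<le> H * dist (x - a + t *\<^sub>R z) (x + t *\<^sub>R z) powr \<gamma>"
          unfolding g_def by (intro H; meson mem sub subsetD)
        ultimately show "\<bar>?h z\<bar> \<le> 2 * (H * norm a powr \<gamma>)" by (simp add: dist_norm)
      qed (use H0 in auto)
      \<comment> \<open>For t below \<open>|a|\<close> each outer value of g is paired with the
        central one, giving \<open>2 H |a|^\<gamma>\<close>. Since \<gamma> - 2 is negative,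
        replacing \<open>|a|\<close> by the smaller t in the power \<gamma> - 2 enlarges the
        bound.\<close>
      also have "norm a powr \<gamma> = (norm a)\<^sup>2 * norm a powr (\<gamma> - 2)"
        using a0 by (simp add: powr_diff)
      also have "2 * (H * ((norm a)\<^sup>2 * norm a powr (\<gamma> - 2))) * V \<le> 2 * (H * ((norm a)\<^sup>2 * t powr (\<gamma> - 2))) * V"
        using False t \<gamma> H0 V by (intro mult_left_mono mult_right_mono powr_mono2') auto
      also have "t powr (\<gamma> - 2) = t powr (\<gamma> - 1) / t" using t by (simp add: powr_diff power2_eq_square)
      also have "2 * (H * ((norm a)\<^sup>2 * (t powr (\<gamma> - 1) / t))) * V = 2 * ((norm a)\<^sup>2 * H * V) * (t powr (\<gamma> - 1) / t)" by simp
      also have "\<dots> \<le> 360 * ((norm a)\<^sup>2 * H * V) * (t powr (\<gamma> - 1) / t)"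
        using t H0 V by (intro mult_right_mono) auto
      finally show ?thesis by (simp add: A_def mult.assoc)
    qed
    then have "t / 6 * \<bar>bump_mean 3 g (x + a) t + bump_mean 3 g (x - a) t - 2 * bump_mean 3 g x t\<bar>
        \<le> t / 6 * (6 * A * (t powr (\<gamma> - 1) / t))"
      using t by (intro mult_left_mono) auto
    also have "\<dots> = A * t powr (\<gamma> - 1)" using t by simp
    finally show "norm (\<Phi>' t) \<le> A * t powr (\<gamma> - 1)"
      using t by (simp add: \<Phi>'_def abs_mult)
  qed auto
  moreover have "\<bar>\<Phi> 1\<bar> \<le> 160 * (norm a)\<^sup>2 * M * V"
  proof -
    have "\<bar>f (x + 1 *\<^sub>R z) - 0\<bar> \<le> M" if "norm z \<le> 2" for z
      using that M[of "x + z"] by (simp add: dist_norm)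
    from bump_mean_second_diff_bound[OF cf this, of a 2] a show ?thesis unfolding \<Phi>_def V_def by simp
  qed
  ultimately have "\<bar>\<Phi> 0\<bar> \<le> 160 * (norm a)\<^sup>2 * M * V + A / \<gamma>" using \<gamma> by simp
  also have "\<dots> \<le> 160 * (norm a)\<^sup>2 * M * V / \<gamma> + 160 * (norm a)\<^sup>2 * H * V / \<gamma>"
  proof (intro add_mono divide_right_mono)
    have "0 \<le> 160 * (norm a)\<^sup>2 * M * V" using M0 V by simp
    then show "160 * (norm a)\<^sup>2 * M * V \<le> 160 * (norm a)\<^sup>2 * M * V / \<gamma>"
      using \<gamma> mult_left_mono[of \<gamma> 1 "160 * (norm a)\<^sup>2 * M * V"] by (simp add: le_divide_eq)
    show "A \<le> 160 * (norm a)\<^sup>2 * H * V" unfolding A_def using H0 V by (intro mult_right_mono) auto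
  qed (use \<gamma> in auto)
  finally have "\<bar>f (x + a) + f (x - a) - 2 * f x\<bar> * bump_mass TYPE(real^'n) \<le> 160 * V / \<gamma> * (M + H) * (norm a)\<^sup>2"
  proof -
    assume *: "\<bar>\<Phi> 0\<bar> \<le> 160 * (norm a)\<^sup>2 * M * V / \<gamma> + 160 * (norm a)\<^sup>2 * H * V / \<gamma>"
    have "\<Phi> 0 = (f (x + a) + f (x - a) - 2 * f x) * bump_mass TYPE(real^'n)"
      unfolding \<Phi>_def bump_mean_0 by (simp add: algebra_simps)
    then have "\<bar>\<Phi> 0\<bar> = \<bar>f (x + a) + f (x - a) - 2 * f x\<bar> * bump_mass TYPE(real^'n)"
      using \<kappa> by (simp add: abs_mult)
    with * show ?thesis by (simp add: add_divide_distrib algebra_simps)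
  qed
  then show ?thesis using \<kappa> \<gamma> by (simp add: V_def field_simps)
qed

section \<open>Perturbed harmonic oscillators\<close>

lemma exp_quadratic_bound:
  fixes w :: real
  assumes "\<bar>w\<bar> \<le> 1"
  shows "exp w \<le> 1 + w + w\<^sup>2"
proof (cases "w \<ge> 0")
  case True then show ?thesis using exp_bound assms by simp
next
  case False
  define x where "x = - w"
  have x: "x > 0" using False by (simp add: x_def)
  \<comment> \<open>For negative w the claim is multiplied by \<open>exp x\<close>, x = - w; the
    product with the quadratic Taylor lower bound of \<open>exp x\<close> has no linear term and
    only positive coefficients beyond 1.\<close>
  have "1 \<le> 1 + (x\<^sup>2 / 2 + x ^ 3 / 2 + x ^ 4 / 2)" using x by simp
  also have "\<dots> = (1 - x + x\<^sup>2) * (1 + x + x\<^sup>2 / 2)"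
    by (simp add: power2_eq_square power3_eq_cube power4_eq_xxxx field_simps)
  also have "\<dots> \<le> (1 - x + x\<^sup>2) * exp x"
  proof (rule mult_left_mono)
    show "1 + x + x\<^sup>2 / 2 \<le> exp x" using exp_lower_Taylor_quadratic[of x] x by simp
    show "0 \<le> 1 - x + x\<^sup>2" using assms False by (simp add: x_def)
  qed
  finally show ?thesis by (simp add: x_def exp_minus field_simps)
qed

text \<open>The Gaussian is strictly concave in the open unit ball; radius 1/2 leaves room for a
  uniform constant. Factoring out \<open>gauss x\<close> reduces the claim to
  \<open>exp (- v - s) + exp (- v + s)\<close>, where \<open>s^2 \<le> v / 2\<close> because x is
  short. The result 7/8 * 3/4 exceeds the 1/2 required.\<close>

lemma gauss_second_difference:
  fixes x a :: "real^'n::finite"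
  assumes x: "norm x \<le> 1/2" and a: "norm a \<le> 1/2"
  shows "gauss (x + a) + gauss (x - a) - 2 * gauss x \<le> - (1/4) * (norm a)\<^sup>2"
proof -
  define v s where "v = (norm a)\<^sup>2 / 2" and "s = x \<bullet> a"
  have v: "0 \<le> v" "v \<le> 1/8"
    using power_mono[OF a, of 2] by (simp_all add: v_def power2_eq_square)
  have "\<bar>s\<bar> \<le> norm x * norm a" unfolding s_def by (rule Cauchy_Schwarz_ineq2)
  also have "\<dots> \<le> 1/2 * norm a" using x by (intro mult_right_mono) auto
  finally have s: "\<bar>s\<bar> \<le> 1/2 * norm a" .
  then have s1: "\<bar>s\<bar> \<le> 1/4" using a by simp
  have s2: "s\<^sup>2 \<le> v / 2" using power_mono[OF s, of 2] by (simp add: v_def power2_eq_square)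
  have v2: "v\<^sup>2 \<le> v / 8" using mult_left_mono[OF v(2) v(1)] by (simp add: power2_eq_square)
  have e: "gauss (x + a) = gauss x * exp (- v - s)" "gauss (x - a) = gauss x * exp (- v + s)"
    unfolding gauss_def exp_add[symmetric] v_def s_def
    by (simp_all add: power2_norm_eq_inner inner_add inner_diff inner_commute field_simps)
  have "exp (- v - s) + exp (- v + s) \<le> (1 + (- v - s) + (- v - s)\<^sup>2) + (1 + (- v + s) + (- v + s)\<^sup>2)"
    using v s1 by (intro add_mono exp_quadratic_bound) auto
  also have "\<dots> = 2 - 2 * v + 2 * v\<^sup>2 + 2 * s\<^sup>2" by (simp add: power2_eq_square algebra_simps)
  also have "\<dots> \<le> 2 - 3/4 * v" using s2 v2 by simp
  finally have "gauss x * (exp (- v - s) + exp (- v + s) - 2) \<le> gauss x * (- (3/4) * v)"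
    by (intro mult_left_mono) (auto intro: less_imp_le)
  moreover have "7/8 \<le> gauss x"
  proof -
    have "(norm x)\<^sup>2 / 2 \<le> 1/8" using power_mono[OF x, of 2] by (simp add: power2_eq_square)
    then show ?thesis using exp_ge_add_one_self[of "- (norm x)\<^sup>2 / 2"] unfolding gauss_def by linarith
  qed
  then have "7/8 * (3/4 * v) \<le> gauss x * (3/4 * v)" using v by (intro mult_right_mono) auto
  moreover have "gauss x * (- (3/4) * v) = - (gauss x * (3/4 * v))" "- (1/4) * (norm a)\<^sup>2 = - (1/2) * v"
    by (simp_all add: v_def)
  moreover have "gauss (x + a) + gauss (x - a) - 2 * gauss x = gauss x * (exp (- v - s) + exp (- v + s) - 2)"
    unfolding e by (simp add: algebra_simps)
  ultimately show ?thesis using v by linarith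
qed

context oscillator_ground_state
begin

text \<open>At the contact point with \<open>(1 + \<eta> |x|^2) gauss x\<close>, the bound q \<ge> -
  \<eta> can be divided by \<eta> and gives \<open>3 |p|^2 \<le> 2 N + 1 \<le> 3 N\<close>, with N
  the dimension. Contact thus occurs in a region independent of \<eta> and of the domain.\<close>

lemma gauss_comparison:
  assumes \<eta>: "0 < \<eta>" "\<eta> \<le> 1" and q: "\<And>x. x \<in> S \<Longrightarrow> \<bar>q x\<bar> \<le> \<eta>" and \<rho>: "cball 0 \<rho> \<subseteq> S" "\<rho> > 0"
  obtains p K where "p \<in> S" "K > 0" "(norm p)\<^sup>2 \<le> CARD('n)"
    "\<And>x. x \<in> cball 0 \<rho> \<Longrightarrow> W x \<le> K * gauss x" "K * gauss p - W p \<le> K * (\<eta> * \<rho>\<^sup>2)"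
proof -
  obtain p K where p: "p \<in> S" and K: "K > 0" and Wp: "W p = K * ((1 + \<eta> * (norm p)\<^sup>2) * gauss p)"
    and le: "\<And>x. x \<in> closure S \<Longrightarrow> W x \<le> K * ((1 + \<eta> * (norm x)\<^sup>2) * gauss x)"
    and qp: "q p * (1 + \<eta> * (norm p)\<^sup>2) \<le> \<eta> * (2 * CARD('n) - 4 * (norm p)\<^sup>2)"
    by (rule ratio_max[of \<eta>]) (use \<eta> in auto)
  have pos: "0 \<le> \<eta> * (norm p)\<^sup>2" using \<eta> by simp
  have "- \<eta> * (1 + \<eta> * (norm p)\<^sup>2) \<le> q p * (1 + \<eta> * (norm p)\<^sup>2)"
    using q[OF p] pos by (intro mult_right_mono) auto
  moreover have "- \<eta> * (1 + \<eta> * (norm p)\<^sup>2) = \<eta> * (- (1 + \<eta> * (norm p)\<^sup>2))" by (simp add: algebra_simps)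
  ultimately have "\<eta> * (- (1 + \<eta> * (norm p)\<^sup>2)) \<le> \<eta> * (2 * CARD('n) - 4 * (norm p)\<^sup>2)" using qp by linarith
  then have "- (1 + \<eta> * (norm p)\<^sup>2) \<le> 2 * CARD('n) - 4 * (norm p)\<^sup>2" using \<eta> by simp
  moreover have "\<eta> * (norm p)\<^sup>2 \<le> 1 * (norm p)\<^sup>2" using \<eta> by (intro mult_right_mono) auto
  moreover have "real CARD('n) \<ge> 1" by (simp add: Suc_leI)
  ultimately have np: "(norm p)\<^sup>2 \<le> CARD('n)" by linarith
  \<comment> \<open>Freezing the quadratic factor at its largest value on the ball turns the bound
    into a pure Gaussian one; the price is a gap of relative size \<open>\<eta> \<rho>^2\<close> at
    p.\<close>
  define K' where "K' = K * (1 + \<eta> * \<rho>\<^sup>2)"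
  have f: "1 \<le> 1 + \<eta> * \<rho>\<^sup>2" using \<eta> by simp
  show thesis
  proof (rule that[OF p _ np])
    show "K' > 0" using K f by (simp add: K'_def)
    show "W x \<le> K' * gauss x" if x: "x \<in> cball 0 \<rho>" for x
    proof -
      have "W x \<le> K * ((1 + \<eta> * (norm x)\<^sup>2) * gauss x)" using le x \<rho> closure_subset by blast
      also have "\<dots> \<le> K * ((1 + \<eta> * \<rho>\<^sup>2) * gauss x)"
        using x \<eta> K by (intro mult_left_mono mult_right_mono add_left_mono power_mono) (auto intro: less_imp_le)
      finally show ?thesis by (simp add: K'_def)
    qed
    have "K' * gauss p - W p = K * (\<eta> * \<rho>\<^sup>2) * gauss p - K * (\<eta> * (norm p)\<^sup>2) * gauss p"
      by (simp add: K'_def Wp algebra_simps)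
    also have "\<dots> \<le> K * (\<eta> * \<rho>\<^sup>2) * gauss p" using K \<eta> by (simp add: less_imp_le)
    also have "\<dots> \<le> K * (\<eta> * \<rho>\<^sup>2) * 1" using K \<eta> gauss_le_1[of p] by (intro mult_left_mono) auto
    also have "\<dots> \<le> K * (1 + \<eta> * \<rho>\<^sup>2) * (\<eta> * \<rho>\<^sup>2)"
      using K f \<eta> mult_left_mono[of 1 "1 + \<eta> * \<rho>\<^sup>2" "K * (\<eta> * \<rho>\<^sup>2)"] by (simp add: mult_ac)
    finally show "K' * gauss p - W p \<le> K' * (\<eta> * \<rho>\<^sup>2)" by (simp add: K'_def)
  qed
qed

lemma exists_max: "\<exists>d\<in>S. \<forall>x\<in>closure S. W x \<le> W d"
proof -
  obtain d where d: "d \<in> closure S" "\<And>x. x \<in> closure S \<Longrightarrow> W x \<le> W d"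
    using continuous_attains_sup[of "closure S" W] S W by (metis closure_eq_empty compact_closure)
  obtain x0 where "x0 \<in> S" using S by blast
  then have "W d > 0" using d(2)[of x0] W_pos[of x0] closure_subset[of S] by force
  with closure_cases[OF d(1)] d show ?thesis by auto
qed

lemma max_location:
  assumes "d \<in> S" "\<And>x. x \<in> closure S \<Longrightarrow> W x \<le> W d"
  shows "(norm d)\<^sup>2 \<le> CARD('n) - q d"
proof -
  have "laplacian W d \<le> 0"
    using assms closure_subset by (intro laplacian_nonpos_at_max[OF S(1) W(1)]) auto
  then show ?thesis using eqn[OF assms(1)] W_pos[OF assms(1)] by (simp add: mult_le_0_iff)
qed

text \<open>The gap between the Gaussian bound and W solves the unperturbed equation up to the small
  source \<open>q * W\<close>, so Harnack's inequality applies to it.\<close>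

lemma laplacian_gauss_diff:
  assumes x: "x \<in> S"
  shows "laplacian (\<lambda>x. K * gauss x + (- 1) * W x) x
    = ((norm x)\<^sup>2 - CARD('n)) * (K * gauss x + (- 1) * W x) - q x * W x"
proof -
  have lg: "laplacian gauss x = ((norm x)\<^sup>2 - CARD('n)) * gauss x"
    using laplacian_quadratic_gauss[of 1 0 x] by simp
  have Cg: "Ck_on 2 S gauss" by (rule Ck_on_subset[OF Ck_on_gauss]) simp
  show ?thesis
    unfolding laplacian_add[OF S(1) Ck_on_cmult[OF S(1) Cg] Ck_on_cmult[OF S(1) W(1)] x]
      laplacian_cmult[OF S(1) Cg x] laplacian_cmult[OF S(1) W(1) x] lg eqn[OF x]
    by (simp add: algebra_simps)
qed

end

text \<open>The threshold precedes the domain, W and q, since all constants depend only on the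
  dimension and \<gamma>. With \<open>Z = K gauss - W\<close>, a gap of size \<eta> K at one point
  spreads to a sup bound, then to Lipschitz, Hoelder and second-difference bounds of the same order,
  until the Gaussian's concavity dominates.\<close>

theorem oscillator_unique_max:
  assumes \<gamma>: "0 < \<gamma>" "\<gamma> \<le> 1"
  shows "\<exists>\<eta>>0. \<forall>S (W :: real^'n::finite \<Rightarrow> real) q. oscillator_ground_state S W q
    \<longrightarrow> cball 0 (5 * (real CARD('n) + 5)) \<subseteq> S \<longrightarrow> (\<forall>x\<in>S. \<bar>q x\<bar> \<le> \<eta>)
    \<longrightarrow> (\<forall>x\<in>cball 0 3. \<forall>y\<in>cball 0 3. \<bar>q x - q y\<bar> \<le> \<eta> * dist x y powr \<gamma>)
    \<longrightarrow> (\<exists>!d. d \<in> S \<and> (\<forall>x\<in>closure S. W x \<le> W d))"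
proof -
  \<comment> \<open>R contains the contact point (\<open>|p|^2 \<le> N\<close>), every maximum point
    (\<open>|d|^2 \<le> N + 1\<close>) and all balls of radius 2 about points of norm at most 3.
    Harnack's inequality needs 5 R, and c bounds the potential there.\<close>
  define N R \<rho> c where "N = real CARD('n)" and "R = N + 5" and "\<rho> = 5 * R" and "c = \<rho>\<^sup>2 + N"
  have N: "N \<ge> 1" unfolding N_def by (simp add: Suc_leI)
  have R: "R > 0" "R \<ge> 6" "\<rho> > 0" and NR: "N + 1 \<le> R\<^sup>2" and R\<rho>: "R \<le> \<rho>"
  proof -
    show "R > 0" "R \<ge> 6" "\<rho> > 0" "R \<le> \<rho>" using N by (simp_all add: R_def \<rho>_def)
    have "R * 1 \<le> R * R" using N by (intro mult_left_mono) (auto simp: R_def)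
    then show "N + 1 \<le> R\<^sup>2" by (simp add: R_def power2_eq_square)
  qed
  have c: "c > 0" using N by (simp add: c_def add_nonneg_pos)
  obtain C1 where C1: "C1 > 0" and harnack:
    "\<And>S (f :: real^'n \<Rightarrow> real) \<delta> x p. open S \<Longrightarrow> Ck_on 2 S f \<Longrightarrow> cball 0 \<rho> \<subseteq> S
      \<Longrightarrow> (\<And>y. y \<in> cball 0 \<rho> \<Longrightarrow> 0 \<le> f y)
      \<Longrightarrow> (\<And>y. y \<in> cball 0 \<rho> \<Longrightarrow> \<bar>laplacian f y\<bar> \<le> c * f y + \<delta>) \<Longrightarrow> \<delta> \<ge> 0
      \<Longrightarrow> norm x \<le> R \<Longrightarrow> norm p \<le> R \<Longrightarrow> f x \<le> C1 * (f p + \<delta>)"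
    using harnack_inequality[OF R(1) c] unfolding \<rho>_def by metis
  define CL where "CL = 15 * bump_volume TYPE(real^'n) / bump_mass TYPE(real^'n)"
  define CS where "CS = 160 * bump_volume TYPE(real^'n) / (\<gamma> * bump_mass TYPE(real^'n))"
  have CL: "CL \<ge> 0" and CS: "CS \<ge> 0"
    using bump_volume_nonneg[where 'a = "real^'n"] bump_mass_pos[where 'a = "real^'n"] \<gamma> by (simp_all add: CL_def CS_def)
  \<comment> \<open>In units of \<eta> K: C2 bounds Z, C3 its Laplacian, C4 its Lipschitz constant
    and C6 the Hoelder constant of its Laplacian. C5, in units of K alone, is a Lipschitz constant
    for W.\<close>
  define C2 where "C2 = C1 * (\<rho>\<^sup>2 + 1)"
  define C3 where "C3 = c * C2 + 1"
  define C4 where "C4 = CL * (C2 + C3)"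
  define C5 where "C5 = CL * (c + 2)"
  define C6 where "C6 = 6 * C2 + (9 + N) * C4 + 1 + C5 + 2 * C3"
  have C2: "C2 > 0" using C1 by (simp add: C2_def add_nonneg_pos)
  have C3: "C3 \<ge> 1" using c C2 by (simp add: C3_def)
  have C45: "C4 \<ge> 0" "C5 \<ge> 0" using CL C2 C3 c by (simp_all add: C4_def C5_def)
  have C6: "C6 \<ge> 0" using C2 C3 C45 N by (simp add: C6_def)
  \<comment> \<open>The second entry makes the gap at the origin at most K/10, smaller than the drop
    K/9 of the Gaussian bound outside radius 1/2. The third keeps second differences of Z below half
    of the 1/4 provided by the Gaussian.\<close>
  define \<eta> where "\<eta> = min 1 (min (1 / (10 * C2)) (1 / (8 * (CS * (C2 + C6) + 1))))"
  have D: "CS * (C2 + C6) + 1 > 0" using CS C2 C6 by (intro add_nonneg_pos mult_nonneg_nonneg) auto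
  have \<eta>: "0 < \<eta>" "\<eta> \<le> 1" using C2 D by (simp_all add: \<eta>_def)
  have "\<eta> * (10 * C2) \<le> 1 / (10 * C2) * (10 * C2)"
    using C2 by (intro mult_right_mono) (auto simp: \<eta>_def)
  then have \<eta>2: "C2 * \<eta> \<le> 1/10" using C2 by (simp add: mult_ac)
  have "\<eta> * (8 * (CS * (C2 + C6) + 1)) \<le> 1 / (8 * (CS * (C2 + C6) + 1)) * (8 * (CS * (C2 + C6) + 1))"
    using D by (intro mult_right_mono) (auto simp: \<eta>_def)
  then have "8 * (CS * (C2 + C6) * \<eta>) + 8 * \<eta> \<le> 1" using D by (simp add: algebra_simps)
  then have \<eta>S: "CS * (C2 + C6) * \<eta> < 1/8" using \<eta> by linarith
  show ?thesis
  proof (intro exI[of _ \<eta>] conjI allI impI \<eta>(1))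
    fix S and W q :: "real^'n \<Rightarrow> real"
    assume os: "oscillator_ground_state S W q" and ball: "cball 0 (5 * (real CARD('n) + 5)) \<subseteq> S"
      and q': "\<forall>x\<in>S. \<bar>q x\<bar> \<le> \<eta>"
      and qH: "\<forall>x\<in>cball 0 3. \<forall>y\<in>cball 0 3. \<bar>q x - q y\<bar> \<le> \<eta> * dist x y powr \<gamma>"
    note q = bspec[OF q']
    interpret oscillator_ground_state S W q by (rule os)
    have \<rho>S: "cball 0 \<rho> \<subseteq> S" using ball by (simp add: \<rho>_def R_def N_def)
    obtain p K where p: "p \<in> S" and K: "K > 0" and np: "(norm p)\<^sup>2 \<le> CARD('n)"
      and le: "\<And>x. x \<in> cball 0 \<rho> \<Longrightarrow> W x \<le> K * gauss x" and Zp': "K * gauss p - W p \<le> K * (\<eta> * \<rho>\<^sup>2)"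
      using gauss_comparison[OF \<eta> q \<rho>S R(3)] by metis
    have "(norm p)\<^sup>2 \<le> R\<^sup>2" using np NR unfolding N_def by linarith
    then have pR: "norm p \<le> R" by (rule power2_le_imp_le) (use R(1) in simp)
    define Z where "Z x = K * gauss x + (- 1) * W x" for x
    have ZC: "Ck_on 2 S Z"
      unfolding Z_def[abs_def]
      by (intro Ck_on_add Ck_on_cmult S W Ck_on_subset[OF Ck_on_gauss]) simp
    have lapZ: "laplacian Z x = ((norm x)\<^sup>2 - N) * Z x - q x * W x" if "x \<in> S" for x
      using laplacian_gauss_diff[OF that, of K] unfolding Z_def[abs_def] N_def .
    have Z0: "Z x \<ge> 0" if "x \<in> cball 0 \<rho>" for x using le[OF that] by (simp add: Z_def)
    have WK: "0 \<le> W x" "W x \<le> K" if "x \<in> cball 0 \<rho>" for x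
    proof -
      show "0 \<le> W x" using W_pos[of x] \<rho>S that by force
      have "K * gauss x \<le> K * 1" using K gauss_le_1[of x] by (intro mult_left_mono) auto
      with le[OF that] show "W x \<le> K" by linarith
    qed
    have poly: "\<bar>(norm x)\<^sup>2 - N\<bar> \<le> c" if "x \<in> cball 0 \<rho>" for x
    proof -
      have "(norm x)\<^sup>2 \<le> \<rho>\<^sup>2" using that by (intro power_mono) auto
      then show ?thesis using N zero_le_power2[of "norm x"] zero_le_power2[of \<rho>] unfolding c_def abs_le_iff by linarith
    qed
    have qW: "\<bar>q x * W x\<bar> \<le> \<eta> * K" if "x \<in> cball 0 \<rho>" for x
      unfolding abs_mult using q[of x] \<rho>S that WK[OF that] \<eta> by (intro mult_mono) auto
    have lapZ_le: "\<bar>laplacian Z x\<bar> \<le> c * Z x + \<eta> * K" if "x \<in> cball 0 \<rho>" for x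
    proof -
      have "\<bar>((norm x)\<^sup>2 - N) * Z x\<bar> \<le> c * Z x"
        unfolding abs_mult using poly[OF that] Z0[OF that] by (simp add: mult_right_mono)
      then show ?thesis using lapZ[of x] \<rho>S that qW[OF that] by auto
    qed
    have Zsmall: "Z x \<le> C2 * \<eta> * K" if "norm x \<le> R" for x
    proof -
      have "Z x \<le> C1 * (Z p + \<eta> * K)"
        by (rule harnack[OF S(1) ZC \<rho>S Z0 lapZ_le _ that pR]) (use \<eta> K in auto)
      also have "\<dots> \<le> C1 * (K * (\<eta> * \<rho>\<^sup>2) + \<eta> * K)"
        using Zp' C1 by (intro mult_left_mono[OF add_right_mono]) (auto simp: Z_def)
      finally show ?thesis by (simp add: C2_def algebra_simps)
    qed
    have in\<rho>: "x \<in> cball 0 \<rho>" if "norm x \<le> R" for x using that R\<rho> by simp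
    have lapZ_small: "\<bar>laplacian Z x\<bar> \<le> C3 * (\<eta> * K)" if "norm x \<le> R" for x
    proof -
      have "c * Z x \<le> c * (C2 * \<eta> * K)" using Zsmall[OF that] c by (intro mult_left_mono) auto
      then show ?thesis using lapZ_le[OF in\<rho>[OF that]] by (simp add: C3_def algebra_simps)
    qed
    have absZ: "\<bar>Z x\<bar> \<le> C2 * (\<eta> * K)" if "norm x \<le> R" for x
      using Zsmall[OF that] Z0[OF in\<rho>[OF that]] by simp
    have near: "norm y \<le> R" if "norm x \<le> 3" "y \<in> cball x 2" for x y :: "real^'n"
      using that R norm_triangle_ineq2[of y x] by (simp add: dist_norm norm_minus_commute)
    have sub: "cball x 2 \<subseteq> S" if "norm x \<le> 3" for x
      using near[OF that] in\<rho> \<rho>S by blast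
    have ZL: "\<bar>Z (x + a) - Z x\<bar> \<le> C4 * (\<eta> * K) * norm a" if "norm x \<le> 3" "norm a \<le> 1" for x a
    proof -
      have "\<bar>Z (x + a) - Z x\<bar> \<le> CL * (C2 * (\<eta> * K) + C3 * (\<eta> * K)) * norm a"
        unfolding CL_def
        by (rule lipschitz_estimate[OF S(1) ZC sub[OF that(1)] _ _ that(2)])
           (use absZ lapZ_small near[OF that(1)] in auto)
      then show ?thesis by (simp add: C4_def algebra_simps)
    qed
    have WL: "\<bar>W (x + a) - W x\<bar> \<le> C5 * K * norm a" if "norm x \<le> 3" "norm a \<le> 1" for x a
    proof -
      have "\<bar>W (x + a) - W x\<bar> \<le> CL * (K + (c + 1) * K) * norm a"
        unfolding CL_def
      proof (rule lipschitz_estimate[OF S(1) W(1) sub[OF that(1)] _ _ that(2)])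
        fix y assume y: "y \<in> cball x 2"
        then have y\<rho>: "y \<in> cball 0 \<rho>" and yS: "y \<in> S" using near[OF that(1)] in\<rho> \<rho>S by blast+
        show "\<bar>W y\<bar> \<le> K" using WK[OF y\<rho>] by simp
        have "\<bar>(norm y)\<^sup>2 - N + q y\<bar> \<le> c + 1" using poly[OF y\<rho>] q[OF yS] \<eta> by linarith
        then have "\<bar>(norm y)\<^sup>2 - N + q y\<bar> * \<bar>W y\<bar> \<le> (c + 1) * K"
          using WK[OF y\<rho>] c by (intro mult_mono) auto
        then show "\<bar>laplacian W y\<bar> \<le> (c + 1) * K"
          unfolding eqn[OF yS] N_def abs_mult .
      qed
      then show ?thesis by (simp add: C5_def algebra_simps)
    qed
    have lapZ_holder: "\<bar>laplacian Z y - laplacian Z y'\<bar> \<le> C6 * (\<eta> * K) * dist y y' powr \<gamma>"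
      if y: "norm y \<le> 3" "norm y' \<le> 3" for y y'
    \<comment> \<open>For distance at most 1, Lipschitz bounds imply Hoelder bounds; beyond 1 the
      sup bound of the Laplacian, taken twice, suffices.\<close>
    proof (cases "dist y y' \<le> 1")
      case True
      define D where "D = dist y y' powr \<gamma>"
      have yS: "y \<in> S" "y' \<in> S" using y sub[of y] sub[of y'] by auto
      have yR: "norm y \<le> R" "norm y' \<le> R" using y R by auto
      have dD: "dist y y' \<le> D"
      proof (cases "dist y y' = 0")
        case False
        then have "dist y y' powr 1 \<le> D" unfolding D_def using True \<gamma> by (intro powr_mono') auto
        then show ?thesis by simp
      qed (simp add: D_def)
      have nd: "norm (y - y') = dist y y'" by (simp add: dist_norm)
      have D0: "D \<ge> 0" by (simp add: D_def)
      have "\<bar>(norm y)\<^sup>2 - (norm y')\<^sup>2\<bar> = \<bar>norm y - norm y'\<bar> * (norm y + norm y')"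
        by (simp add: power2_eq_square square_diff_square_factored abs_mult mult.commute)
      also have "\<dots> \<le> D * 6"
        using norm_triangle_ineq3[of y y'] dD y D0 unfolding nd by (intro mult_mono) auto
      finally have "\<bar>((norm y)\<^sup>2 - (norm y')\<^sup>2) * Z y\<bar> \<le> D * 6 * (C2 * (\<eta> * K))"
        unfolding abs_mult using absZ[OF yR(1)] D0 by (intro mult_mono) auto
      moreover have "\<bar>((norm y')\<^sup>2 - N) * (Z y - Z y')\<bar> \<le> (9 + N) * (C4 * (\<eta> * K) * D)"
        unfolding abs_mult
      proof (rule mult_mono)
        have "(norm y')\<^sup>2 \<le> 3\<^sup>2" using y by (intro power_mono) auto
        then show "\<bar>(norm y')\<^sup>2 - N\<bar> \<le> 9 + N" using N zero_le_power2[of "norm y'"] unfolding abs_le_iff by (simp, linarith)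
        have "\<bar>Z y - Z y'\<bar> \<le> C4 * (\<eta> * K) * dist y y'"
          using ZL[OF y(2), of "y - y'"] True by (simp add: dist_norm)
        also have "\<dots> \<le> C4 * (\<eta> * K) * D" using dD C45 \<eta> K by (intro mult_left_mono) auto
        finally show "\<bar>Z y - Z y'\<bar> \<le> C4 * (\<eta> * K) * D" .
      qed (use N in auto)
      moreover have "\<bar>(q y - q y') * W y\<bar> \<le> \<eta> * D * K"
        unfolding abs_mult using qH y WK[OF in\<rho>[OF yR(1)]] \<eta> D0
        by (intro mult_mono) (auto simp: D_def)
      moreover have "\<bar>q y' * (W y - W y')\<bar> \<le> \<eta> * (C5 * K * D)"
        unfolding abs_mult
      proof (rule mult_mono)
        have "\<bar>W y - W y'\<bar> \<le> C5 * K * dist y y'"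
          using WL[OF y(2), of "y - y'"] True by (simp add: dist_norm)
        also have "\<dots> \<le> C5 * K * D" using dD C45 K by (intro mult_left_mono) auto
        finally show "\<bar>W y - W y'\<bar> \<le> C5 * K * D" .
      qed (use q[OF yS(2)] \<eta> in auto)
      \<comment> \<open>The two products are telescoped so that each term is small: Z and its
        differences are of order \<eta> K, and so are q and its differences times quantities of
        order K.\<close>
      moreover have "laplacian Z y - laplacian Z y' = ((norm y)\<^sup>2 - (norm y')\<^sup>2) * Z y
          + ((norm y')\<^sup>2 - N) * (Z y - Z y') - (q y - q y') * W y - q y' * (W y - W y')"
        unfolding lapZ[OF yS(1)] lapZ[OF yS(2)] by (simp add: algebra_simps)
      ultimately have "\<bar>laplacian Z y - laplacian Z y'\<bar>
        \<le> D * 6 * (C2 * (\<eta> * K)) + (9 + N) * (C4 * (\<eta> * K) * D) + \<eta> * D * K + \<eta> * (C5 * K * D)"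
        by linarith
      also have "\<dots> = (6 * C2 + (9 + N) * C4 + 1 + C5) * (\<eta> * K) * D" by (simp add: algebra_simps)
      also have "\<dots> \<le> C6 * (\<eta> * K) * D"
        using C3 \<eta> K D0 by (intro mult_right_mono) (auto simp: C6_def)
      finally show ?thesis by (simp add: D_def)
    next
      case False
      have yR: "norm y \<le> R" "norm y' \<le> R" using y R by auto
      have "\<bar>laplacian Z y - laplacian Z y'\<bar> \<le> 2 * C3 * (\<eta> * K) * 1"
        using lapZ_small[OF yR(1)] lapZ_small[OF yR(2)] by simp
      also have "\<dots> \<le> C6 * (\<eta> * K) * dist y y' powr \<gamma>"
        using False \<gamma> C2 C3 C45 N \<eta> K
        by (intro mult_mono mult_right_mono ge_one_powr_ge_zero) (auto simp: C6_def intro!: add_nonneg_nonneg)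
      finally show ?thesis .
    qed
    have W_second: "W (x + a) + W (x - a) - 2 * W x < 0" if x: "norm x \<le> 1/2" and a: "norm a \<le> 1/2" "a \<noteq> 0" for x a
    proof -
      have x3: "norm x \<le> 3" using x by simp
      have near3: "norm y \<le> 3" if "y \<in> cball x 2" for y
        using that x norm_triangle_ineq2[of y x] by (simp add: dist_norm norm_minus_commute)
      have "\<bar>Z (x + a) + Z (x - a) - 2 * Z x\<bar> \<le> CS * (C2 * (\<eta> * K) + C6 * (\<eta> * K)) * (norm a)\<^sup>2"
        unfolding CS_def
        by (rule second_difference_estimate[OF S(1) ZC sub[OF x3] \<gamma>])
           (use absZ near[OF x3] near3 lapZ_holder C6 \<eta> K a in auto)
      also have "\<dots> = CS * (C2 + C6) * \<eta> * (K * (norm a)\<^sup>2)" by (simp add: algebra_simps)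
      also have "\<dots> < 1/8 * (K * (norm a)\<^sup>2)"
        using \<eta>S K a by (intro mult_strict_right_mono) auto
      finally have "\<bar>Z (x + a) + Z (x - a) - 2 * Z x\<bar> < 1/8 * (K * (norm a)\<^sup>2)" .
      moreover have "K * (gauss (x + a) + gauss (x - a) - 2 * gauss x) \<le> K * (- (1/4) * (norm a)\<^sup>2)"
        using gauss_second_difference[OF x a(1)] K by (intro mult_left_mono) auto
      moreover have "0 < K * (norm a)\<^sup>2" using K a by simp
      moreover have "W (x + a) + W (x - a) - 2 * W x = K * (gauss (x + a) + gauss (x - a) - 2 * gauss x)
          - (Z (x + a) + Z (x - a) - 2 * Z x)"
        by (simp add: Z_def algebra_simps)
      ultimately show ?thesis by linarith
    qed
    have loc: "norm d < 1/2" if d: "d \<in> S" "\<forall>x\<in>closure S. W x \<le> W d" for d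
    proof (rule ccontr)
      assume "\<not> ?thesis"
      then have "(1/2)\<^sup>2 \<le> (norm d)\<^sup>2" by (intro power_mono) auto
      then have "gauss d \<le> exp (- (1/8))" by (simp add: gauss_def power2_eq_square)
      \<comment> \<open>Outside radius 1/2 the bound \<open>K gauss\<close> is thus at most 8/9 K,
        whereas the value at the origin is at least 9/10 K.\<close>
      also have "\<dots> \<le> 8/9" using exp_ge_add_one_self[of "1/8::real"] by (simp add: exp_minus field_simps)
      finally have gd: "gauss d \<le> 8/9" .
      have "(norm d)\<^sup>2 \<le> N - q d" unfolding N_def using d by (intro max_location) auto
      then have "(norm d)\<^sup>2 \<le> R\<^sup>2" using q[OF d(1)] \<eta> NR by linarith
      then have "norm d \<le> R" by (rule power2_le_imp_le) (use R(1) in simp)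
      then have "W d \<le> K * gauss d" using le in\<rho> by blast
      also have "\<dots> \<le> K * (8/9)" using gd K by (intro mult_left_mono) auto
      finally have "W d \<le> K * (8/9)" .
      moreover have "0 \<in> S" using \<rho>S R by auto
      then have "W 0 \<le> W d" using d closure_subset by blast
      moreover have "K - W 0 \<le> C2 * \<eta> * K" using Zsmall[of 0] R by (simp add: Z_def gauss_def)
      moreover have "C2 * \<eta> * K \<le> 1/10 * K" using \<eta>2 K by (intro mult_right_mono) auto
      ultimately show False using K by linarith
    qed
    obtain d where d: "d \<in> S" "\<forall>x\<in>closure S. W x \<le> W d" using exists_max by blast
    show "\<exists>!d. d \<in> S \<and> (\<forall>x\<in>closure S. W x \<le> W d)"
    proof (rule ex1I[of _ d])
      show "d \<in> S \<and> (\<forall>x\<in>closure S. W x \<le> W d)" using d by blast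
      fix e assume e: "e \<in> S \<and> (\<forall>x\<in>closure S. W x \<le> W e)"
      show "e = d"
      proof (rule ccontr)
        assume ne: "e \<noteq> d"
        \<comment> \<open>Midpoint and half-difference: the two maximum points are x + a and x - a,
          so a negative second difference would make the midpoint value larger.\<close>
        define x a where "x = (1/2) *\<^sub>R (d + e)" and "a = (1/2) *\<^sub>R (d - e)"
        have de: "norm d < 1/2" "norm e < 1/2" using loc d e by blast+
        have xd: "x + a = d" "x - a = e"
          by (simp_all add: x_def a_def algebra_simps flip: scaleR_add_left)
        have nx: "norm x \<le> 1/2" "norm a \<le> 1/2"
          using de norm_triangle_ineq[of d e] norm_triangle_ineq4[of d e] by (simp_all add: x_def a_def)
        have "x \<in> closure S" using nx(1) sub[of x] closure_subset[of S] centre_in_cball[of x 2] by force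
        then have "W x \<le> W d" "W x \<le> W e" using d e by blast+
        moreover have "W d + W e - 2 * W x < 0"
          using W_second[OF nx] ne unfolding xd by (simp add: a_def)
        ultimately show False by linarith
      qed
    qed
  qed
qed

section \<open>Removing the drift\<close>

text \<open>In the Laplacian of \<open>exp P * \<phi>\<close> with P = \<alpha> m / \<epsilon>, the
  cross term is exactly the drift, which the equation trades for
  \<open>(V - \<mu>) / \<epsilon>\<close>. What is left is the Laplacian of P, zero because the
  coefficients sum to 0, and \<open>|grad P|^2\<close>, radial because they have equal
  modulus.\<close>

lemma drift_transform:
  fixes a :: "real^'n::finite"
  assumes \<Omega>: "open \<Omega>" and \<phi>: "Ck_on 2 \<Omega> \<phi>" and \<epsilon>: "\<epsilon> > 0"
    and m: "\<And>x. x \<in> \<Omega> \<Longrightarrow> m x = a0 + (\<Sum>i\<in>UNIV. a $ i * (x $ i)\<^sup>2)"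
    and sum0: "(\<Sum>i\<in>UNIV. a $ i) = 0" and A: "\<And>i. \<bar>a $ i\<bar> = A"
    and eqn: "\<And>x. x \<in> \<Omega> \<Longrightarrow>
      - \<epsilon> * laplacian \<phi> x - 2 * \<alpha> * (grad m x \<bullet> grad \<phi> x) + V x * \<phi> x = \<mu> * \<phi> x"
    and v: "\<And>x. x \<in> \<Omega> \<Longrightarrow> v x = c * (exp (\<alpha> / \<epsilon> * m x) * \<phi> x)"
  shows "Ck_on 2 \<Omega> v"
    and "\<And>x. x \<in> \<Omega> \<Longrightarrow> laplacian v x = ((2 * A * \<alpha> / \<epsilon>)\<^sup>2 * (norm x)\<^sup>2 + (V x - \<mu>) / \<epsilon>) * v x"
proof -
  define P where "P x = \<alpha> / \<epsilon> * a0 + (\<Sum>i\<in>UNIV. ((\<alpha> / \<epsilon>) *\<^sub>R a) $ i * (x $ i)\<^sup>2)" for x :: "real^'n"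
  have Pm: "\<alpha> / \<epsilon> * m x = P x" if "x \<in> \<Omega>" for x
    unfolding m[OF that] P_def by (simp add: distrib_left sum_distrib_left mult.assoc)
  have P: "Ck_on k \<Omega> P" for k
    unfolding P_def[abs_def] by (rule Ck_on_subset[OF Ck_on_quadratic]) simp
  define U where "U x = c * (exp (P x) * \<phi> x)" for x
  have vU: "v x = U x" if "x \<in> \<Omega>" for x using v[OF that] Pm[OF that] by (simp add: U_def)
  have eP\<phi>: "Ck_on 2 \<Omega> (\<lambda>x. exp (P x) * \<phi> x)"
    by (intro Ck_on_mult Ck_on_exp \<Omega> P \<phi>)
  have "Ck_on 2 \<Omega> U"
    unfolding U_def[abs_def] by (intro Ck_on_cmult \<Omega> eP\<phi>)
  then show "Ck_on 2 \<Omega> v" using Ck_on_cong[OF \<Omega> vU] by simp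
  fix x assume x: "x \<in> \<Omega>"
  have "partial_deriv i m x = partial_deriv i (\<lambda>x. a0 + (\<Sum>i\<in>UNIV. a $ i * (x $ i)\<^sup>2)) x" for i
    by (rule partial_deriv_cong[OF \<Omega> x]) (rule m)
  then have gm: "grad m x = (\<chi> i. 2 * a $ i * x $ i)"
    by (simp add: grad_def partial_deriv_quadratic)
  have gP: "grad P x = (\<alpha> / \<epsilon>) *\<^sub>R grad m x"
    unfolding P_def[abs_def] grad_quadratic gm by (simp add: vec_eq_iff)
  have lP: "laplacian P x = 0"
    unfolding P_def[abs_def] laplacian_quadratic using sum0 by (simp flip: sum_distrib_left sum_divide_distrib)
  have ge: "grad (\<lambda>x. exp (P x)) x = exp (P x) *\<^sub>R grad P x"
    unfolding grad_def by (simp add: vec_eq_iff partial_deriv_exp[OF \<Omega> P x])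
  have a2: "(a $ i)\<^sup>2 = A\<^sup>2" for i using A[of i] by (metis power2_abs)
  have nm: "(norm (grad m x))\<^sup>2 = 4 * A\<^sup>2 * (norm x)\<^sup>2"
  proof -
    have sq: "(2 * a $ i * x $ i) * (2 * a $ i * x $ i) = 4 * A\<^sup>2 * (x $ i * x $ i)" for i
      unfolding a2[of i, symmetric] by (simp add: power2_eq_square)
    have "(norm (grad m x))\<^sup>2 = (\<Sum>i\<in>UNIV. (2 * a $ i * x $ i) * (2 * a $ i * x $ i))"
      unfolding power2_norm_eq_inner gm by (simp add: inner_vec_def)
    also have "\<dots> = (\<Sum>i\<in>UNIV. 4 * A\<^sup>2 * (x $ i * x $ i))" by (simp only: sq)
    also have "\<dots> = 4 * A\<^sup>2 * (norm x)\<^sup>2"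
      unfolding power2_norm_eq_inner by (simp add: inner_vec_def sum_distrib_left)
    finally show ?thesis .
  qed
  have e: "laplacian \<phi> x + 2 * (\<alpha> / \<epsilon>) * (grad m x \<bullet> grad \<phi> x) = (V x - \<mu>) / \<epsilon> * \<phi> x"
    using eqn[OF x] \<epsilon> by (simp add: field_simps)
  have "laplacian v x = laplacian U x" by (rule laplacian_cong[OF \<Omega> x vU])
  also have "\<dots> = c * (exp (P x) * laplacian \<phi> x + 2 * (grad (\<lambda>x. exp (P x)) x \<bullet> grad \<phi> x)
      + laplacian (\<lambda>x. exp (P x)) x * \<phi> x)"
    unfolding U_def[abs_def] laplacian_cmult[OF \<Omega> eP\<phi> x]
      laplacian_mult[OF \<Omega> Ck_on_exp[OF \<Omega> P] \<phi> x] ..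
  also have "\<dots> = c * (exp (P x) * (laplacian \<phi> x + 2 * (\<alpha> / \<epsilon>) * (grad m x \<bullet> grad \<phi> x))
      + exp (P x) * (\<alpha> / \<epsilon>)\<^sup>2 * (norm (grad m x))\<^sup>2 * \<phi> x)"
    unfolding ge laplacian_exp[OF \<Omega> P x] lP gP by (simp add: power_mult_distrib power_divide algebra_simps)
  also have "\<dots> = ((2 * A * \<alpha> / \<epsilon>)\<^sup>2 * (norm x)\<^sup>2 + (V x - \<mu>) / \<epsilon>) * U x"
    unfolding e nm U_def by (simp add: power_mult_distrib power_divide algebra_simps)
  finally show "laplacian v x = ((2 * A * \<alpha> / \<epsilon>)\<^sup>2 * (norm x)\<^sup>2 + (V x - \<mu>) / \<epsilon>) * v x"
    using vU[OF x] by simp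
qed

lemma closure_scaled_preimage:
  fixes \<Omega> :: "'a::real_normed_vector set"
  assumes "t \<noteq> 0"
  shows "closure {y. t *\<^sub>R y \<in> \<Omega>} = {y. t *\<^sub>R y \<in> closure \<Omega>}"
proof -
  have im: "{y. t *\<^sub>R y \<in> T} = (*\<^sub>R) (1 / t) ` T" for T :: "'a set"
  proof safe
    fix y assume "t *\<^sub>R y \<in> T"
    then show "y \<in> (*\<^sub>R) (1 / t) ` T" using assms by (intro image_eqI[of _ _ "t *\<^sub>R y"]) auto
  qed (use assms in auto)
  show ?thesis unfolding im by (rule closure_scaleR[symmetric])
qed

text \<open>The length \<open>1 / sqrt k\<close> balances the Laplacian against the potential
  \<open>k^2 |x|^2\<close> and gives it coefficient 1; the remaining term is divided by k. Adding
  the dimension to q compensates the ground energy subtracted in the locale.\<close>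

lemma rescaled_oscillator_ground_state:
  fixes a :: "real^'n::finite"
  assumes \<Omega>: "open \<Omega>" "bounded \<Omega>" "0 \<in> \<Omega>" and \<epsilon>: "\<epsilon> > 0" and \<alpha>: "\<alpha> > 0"
    and m: "\<And>x. x \<in> closure \<Omega> \<Longrightarrow> m x = a0 + (\<Sum>i\<in>UNIV. a $ i * (x $ i)\<^sup>2)"
    and sum0: "(\<Sum>i\<in>UNIV. a $ i) = 0" and A: "\<And>i. \<bar>a $ i\<bar> = A" "A > 0"
    and pe: "principal_eigenpair \<Omega> \<epsilon> \<alpha> m V \<mu> \<phi>" and c: "c > 0"
    and v: "\<And>x. x \<in> closure \<Omega> \<Longrightarrow> v x = c * (exp (\<alpha> / \<epsilon> * m x) * \<phi> x)"
  defines "k \<equiv> 2 * A * \<alpha> / \<epsilon>"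
  shows "oscillator_ground_state {y. (1 / sqrt k) *\<^sub>R y \<in> \<Omega>} (\<lambda>y. v ((1 / sqrt k) *\<^sub>R y))
    (\<lambda>y. (V ((1 / sqrt k) *\<^sub>R y) - \<mu>) / (\<epsilon> * k) + CARD('n))"
proof -
  have k: "k > 0" using \<epsilon> \<alpha> A by (simp add: k_def)
  define t where "t = 1 / sqrt k"
  have t: "t > 0" and t2: "t\<^sup>2 = 1 / k" using k by (simp_all add: t_def power_divide)
  let ?S = "{y. t *\<^sub>R y \<in> \<Omega>}"
  have S: "open ?S"
    using open_vimage[OF \<Omega>(1), of "\<lambda>x. t *\<^sub>R x"] by (simp add: vimage_def continuous_on_scaleR)
  have clS: "closure ?S = {y. t *\<^sub>R y \<in> closure \<Omega>}" using t by (intro closure_scaled_preimage) simp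
  have \<phi>: "Ck_on 2 \<Omega> \<phi>" "continuous_on (closure \<Omega>) \<phi>" "\<And>x. x \<in> frontier \<Omega> \<Longrightarrow> \<phi> x = 0"
    "\<And>x. x \<in> \<Omega> \<Longrightarrow> \<phi> x > 0" "\<And>x. x \<in> \<Omega> \<Longrightarrow>
      - \<epsilon> * laplacian \<phi> x - 2 * \<alpha> * (grad m x \<bullet> grad \<phi> x) + V x * \<phi> x = \<mu> * \<phi> x"
    using pe by (auto simp: principal_eigenpair_def dirichlet_eigenpair_def)
  have cl: "x \<in> closure \<Omega>" if "x \<in> \<Omega>" for x using that closure_subset by blast
  have m': "m x = a0 + (\<Sum>i\<in>UNIV. a $ i * (x $ i)\<^sup>2)" and v': "v x = c * (exp (\<alpha> / \<epsilon> * m x) * \<phi> x)"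
    if "x \<in> \<Omega>" for x using m v cl that by auto
  have dt: "Ck_on 2 \<Omega> v"
    "\<And>x. x \<in> \<Omega> \<Longrightarrow> laplacian v x = (k\<^sup>2 * (norm x)\<^sup>2 + (V x - \<mu>) / \<epsilon>) * v x"
    unfolding k_def by (rule drift_transform[OF \<Omega>(1) \<phi>(1) \<epsilon> _ sum0 A(1)]; use m' v' \<phi>(5) in blast)+
  have "oscillator_ground_state ?S (\<lambda>y. v (t *\<^sub>R y)) (\<lambda>y. (V (t *\<^sub>R y) - \<mu>) / (\<epsilon> * k) + CARD('n))"
  proof
    show "open ?S" by (rule S)
    obtain B where B: "\<And>x. x \<in> \<Omega> \<Longrightarrow> norm x \<le> B" using \<Omega>(2) by (auto simp: bounded_iff)
    show "bounded ?S"
    proof (rule boundedI)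
      fix y assume "y \<in> ?S"
      then have "t * norm y \<le> B" using B[of "t *\<^sub>R y"] t by simp
      then show "norm y \<le> B / t" using t by (simp add: field_simps)
    qed
    show "?S \<noteq> {}" using \<Omega>(3) by (auto intro!: exI[of _ 0])
    show "Ck_on 2 ?S (\<lambda>y. v (t *\<^sub>R y))" by (rule Ck_on_scale[OF \<Omega>(1) dt(1)])
    have "continuous_on (closure \<Omega>) (\<lambda>x. c * (exp (\<alpha> / \<epsilon> * (a0 + (\<Sum>i\<in>UNIV. a $ i * (x $ i)\<^sup>2))) * \<phi> x))"
      by (intro continuous_intros \<phi>(2))
    then have "continuous_on (closure \<Omega>) v"
      by (rule continuous_on_eq) (simp add: v m)
    then show "continuous_on (closure ?S) (\<lambda>y. v (t *\<^sub>R y))"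
      unfolding clS by (rule continuous_on_compose2) (auto intro!: continuous_intros)
    show "v (t *\<^sub>R y) > 0" if "y \<in> ?S" for y
      using that c \<phi>(4) v[OF cl] by simp
    show "v (t *\<^sub>R y) = 0" if "y \<in> frontier ?S" for y
    proof -
      have "t *\<^sub>R y \<in> frontier \<Omega>"
        using that S \<Omega>(1) unfolding frontier_def clS by (simp add: interior_open)
      then show ?thesis using v[of "t *\<^sub>R y"] \<phi>(3) by (simp add: frontier_def)
    qed
    show "laplacian (\<lambda>y. v (t *\<^sub>R y)) y
        = ((norm y)\<^sup>2 - CARD('n) + ((V (t *\<^sub>R y) - \<mu>) / (\<epsilon> * k) + CARD('n))) * v (t *\<^sub>R y)" if "y \<in> ?S" for y
    proof -
      have y: "t *\<^sub>R y \<in> \<Omega>" using that by simp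
      have "t\<^sup>2 * (k\<^sup>2 * (norm (t *\<^sub>R y))\<^sup>2 + (V (t *\<^sub>R y) - \<mu>) / \<epsilon>) = (norm y)\<^sup>2 + (V (t *\<^sub>R y) - \<mu>) / (\<epsilon> * k)"
      proof -
        have "(norm (t *\<^sub>R y))\<^sup>2 = (norm y)\<^sup>2 / k" by (simp add: power_mult_distrib t2)
        then show ?thesis unfolding t2 using k \<epsilon> by (simp add: field_simps power2_eq_square)
      qed
      then show ?thesis unfolding laplacian_scale[OF \<Omega>(1) dt(1) y] dt(2)[OF y] by (simp flip: mult.assoc)
    qed
  qed
  then show ?thesis by (simp add: t_def)
qed

theorem corollary2p5:
  fixes \<Omega> :: "(real^'n::finite) set"
    and m V :: "real^'n \<Rightarrow> real"
    and a0 \<gamma> \<epsilon> :: real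
    and a :: "real^'n"
    and u :: "real \<Rightarrow> real^'n \<Rightarrow> real"
  assumes "bounded_smooth_domain \<Omega>"
    and "0 \<in> \<Omega>"
    and "\<forall>x\<in>closure \<Omega>. m x = a0 + (\<Sum>i\<in>UNIV. a $ i * (x $ i)\<^sup>2)"
    and "\<forall>i. a $ i \<noteq> 0"
    and "(\<Sum>i\<in>UNIV. a $ i) = 0"
    and "\<forall>i j. i \<noteq> j \<longrightarrow> \<bar>a $ i\<bar> = \<bar>a $ j\<bar> \<and> \<bar>a $ j\<bar> > 0"
    and "\<forall>x\<in>closure \<Omega>. 0 \<le> V x"
    and "0 < \<gamma>" and "\<gamma> < 1"
    and "holder_on \<gamma> (closure \<Omega>) V"
    and "0 < \<epsilon>"
    and "\<forall>\<alpha>>0. normalized_principal_eigenfunction \<Omega> \<epsilon> \<alpha> m V (u \<alpha>)"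
  shows "\<forall>\<^sub>F \<alpha> in at_top. \<exists>!d. d \<in> \<Omega> \<and> (\<forall>x\<in>closure \<Omega>. u \<alpha> x \<le> u \<alpha> d)"
proof -
  have \<Omega>: "open \<Omega>" "bounded \<Omega>" "0 \<in> \<Omega>" using assms(1,2) by (auto simp: bounded_smooth_domain_def)
  note \<epsilon> = \<open>0 < \<epsilon>\<close> and \<gamma> = \<open>0 < \<gamma>\<close> less_imp_le[OF \<open>\<gamma> < 1\<close>]
  define N where "N = real CARD('n)"
  have N: "N \<ge> 1" unfolding N_def by (simp add: Suc_leI)
  obtain i0 :: 'n where True by blast
  define A where "A = \<bar>a $ i0\<bar>"
  have A: "\<bar>a $ i\<bar> = A" "A > 0" for i
    using assms(4,6) unfolding A_def by (cases "i = i0"; simp)+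
  have cl: "x \<in> closure \<Omega>" if "x \<in> \<Omega>" for x using that closure_subset by blast
  obtain r where r: "r > 0" "cball 0 r \<subseteq> \<Omega>" using \<Omega> open_contains_cball by blast
  obtain C where C: "C \<ge> 0" "\<And>x y. x \<in> closure \<Omega> \<Longrightarrow> y \<in> closure \<Omega> \<Longrightarrow> \<bar>V x - V y\<bar> \<le> C * dist x y powr \<gamma>"
  proof -
    obtain C where "\<forall>x\<in>closure \<Omega>. \<forall>y\<in>closure \<Omega>. \<bar>V x - V y\<bar> \<le> C * dist x y powr \<gamma>"
      using assms(10) by (auto simp: holder_on_def)
    then have "\<bar>V x - V y\<bar> \<le> \<bar>C\<bar> * dist x y powr \<gamma>" if "x \<in> closure \<Omega>" "y \<in> closure \<Omega>" for x y
      using that by (meson abs_ge_self mult_right_mono order_trans powr_ge_zero)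
    then show thesis using that[of "\<bar>C\<bar>"] by simp
  qed
  obtain B where B: "\<And>x. x \<in> \<Omega> \<Longrightarrow> norm x \<le> B" using \<Omega>(2) by (auto simp: bounded_iff)
  have B0: "B \<ge> 0" using B[OF \<Omega>(3)] by simp
  \<comment> \<open>A Hoelder function on a bounded set is bounded; M also covers the oscillation of
    \<open>V\<close> across the whole domain.\<close>
  define M where "M = V 0 + C * B powr \<gamma>"
  have M: "V x \<le> M" if "x \<in> \<Omega>" for x
  proof -
    have "\<bar>V x - V 0\<bar> \<le> C * dist x 0 powr \<gamma>" using C(2)[OF cl[OF that] cl[OF \<Omega>(3)]] .
    also have "\<dots> \<le> C * B powr \<gamma>" using B[OF that] C(1) \<gamma> by (intro mult_left_mono powr_mono2) auto
    finally show ?thesis by (simp add: M_def)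
  qed
  have V0: "V x \<ge> 0" if "x \<in> \<Omega>" for x using assms(7) cl[OF that] by blast
  have M0: "M \<ge> 0" using M[OF \<Omega>(3)] V0[OF \<Omega>(3)] by simp
  obtain \<eta> where \<eta>: "\<eta> > 0" and uniq: "\<forall>S (W :: real^'n \<Rightarrow> real) q. oscillator_ground_state S W q
    \<longrightarrow> cball 0 (5 * (real CARD('n) + 5)) \<subseteq> S \<longrightarrow> (\<forall>x\<in>S. \<bar>q x\<bar> \<le> \<eta>)
    \<longrightarrow> (\<forall>x\<in>cball 0 3. \<forall>y\<in>cball 0 3. \<bar>q x - q y\<bar> \<le> \<eta> * dist x y powr \<gamma>)
    \<longrightarrow> (\<exists>!d. d \<in> S \<and> (\<forall>x\<in>closure S. W x \<le> W d))"
    using oscillator_unique_max[OF \<gamma>] by blast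
  define D where "D = M / \<epsilon> + 2 * N / r\<^sup>2"
  \<comment> \<open>One summand per demand on k: scaling must not increase distances, q must be at
    most \<eta>, its Hoelder constant must be at most \<eta>, the rescaled domain must contain the
    fixed ball, and the ball of radius \<open>r sqrt k\<close> must be large enough for the lower
    bound on q.\<close>
  define k0 where "k0 = 1 + D / \<eta> + C / (\<epsilon> * \<eta>) + (5 * (N + 5) / r)\<^sup>2 + N / r\<^sup>2"
  have D0: "D \<ge> 0" using M0 \<epsilon> N by (simp add: D_def)
  have "\<exists>!d. d \<in> \<Omega> \<and> (\<forall>x\<in>closure \<Omega>. u \<alpha> x \<le> u \<alpha> d)"
    if large: "\<alpha> > 0" "\<alpha> \<ge> k0 * \<epsilon> / (2 * A)" for \<alpha>
  proof -
    define k where "k = 2 * A * \<alpha> / \<epsilon>"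
    have kk: "k \<ge> k0" using large(2) A(2) \<epsilon> by (simp add: k_def field_simps)
    have terms: "0 \<le> D / \<eta>" "0 \<le> C / (\<epsilon> * \<eta>)" "0 \<le> (5 * (N + 5) / r)\<^sup>2" "0 \<le> N / r\<^sup>2"
      using D0 C(1) \<eta> \<epsilon> N by simp_all
    have k1: "k \<ge> 1" and kD: "D / \<eta> \<le> k" and kC: "C / (\<epsilon> * \<eta>) \<le> k"
      and kR: "(5 * (N + 5) / r)\<^sup>2 \<le> k" and kN: "N / r\<^sup>2 < k"
      using kk terms unfolding k0_def by linarith+
    have k: "k > 0" using k1 by simp
    define t where "t = 1 / sqrt k"
    have t: "t > 0" "t \<le> 1" and t2: "t\<^sup>2 = 1 / k" using k k1 by (simp_all add: t_def power_divide)
    obtain \<mu> \<phi> c where pe: "principal_eigenpair \<Omega> \<epsilon> \<alpha> m V \<mu> \<phi>" and c: "c > 0"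
      and v: "\<forall>x\<in>closure \<Omega>. u \<alpha> x = c * (exp (\<alpha> / \<epsilon> * m x) * \<phi> x)"
      using assms(12) large(1) unfolding normalized_principal_eigenfunction_def by blast
    define S where "S = {y. t *\<^sub>R y \<in> \<Omega>}"
    define W where "W y = u \<alpha> (t *\<^sub>R y)" for y
    define q where "q y = (V (t *\<^sub>R y) - \<mu>) / (\<epsilon> * k) + N" for y
    have os: "oscillator_ground_state S W q"
      unfolding S_def W_def[abs_def] q_def[abs_def] N_def t_def k_def
      by (rule rescaled_oscillator_ground_state[OF \<Omega> \<epsilon> large(1) _ assms(5) A pe c])
         (use assms(3) v in auto)
    interpret oscillator_ground_state S W q by (rule os)
    have big: "cball 0 s \<subseteq> S" if "t * s \<le> r" for s
    proof
      fix y :: "real^'n" assume "y \<in> cball 0 s"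
      then have "t * norm y \<le> t * s" using t by (intro mult_left_mono) auto
      then have "t * norm y \<le> r" using that by linarith
      then have "t *\<^sub>R y \<in> cball 0 r" using t by simp
      then show "y \<in> S" using r(2) by (auto simp: S_def)
    qed
    have ball: "cball 0 (5 * (real CARD('n) + 5)) \<subseteq> S"
    proof (rule big)
      have "5 * (N + 5) / r \<le> sqrt k" by (rule real_le_rsqrt[OF kR])
      then show "t * (5 * (real CARD('n) + 5)) \<le> r"
        using r(1) k by (simp add: t_def N_def field_simps)
    qed
    \<comment> \<open>The unknown constant part of q. A point with q \<le> 0 and V \<ge> 0 give
      \<sigma> \<ge> 0; the point from \<open>exists_q_ge\<close> on the ball of radius
      \<open>r / t\<close>, together with V \<le> M, gives \<sigma> \<le> D / k.\<close>
    define \<sigma> where "\<sigma> = \<mu> / (\<epsilon> * k) - N"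
    have q\<sigma>: "q y = V (t *\<^sub>R y) / (\<epsilon> * k) - \<sigma>" for y by (simp add: q_def \<sigma>_def diff_divide_distrib)
    have qV: "0 \<le> V (t *\<^sub>R y) / (\<epsilon> * k)" "V (t *\<^sub>R y) / (\<epsilon> * k) \<le> M / (\<epsilon> * k)" if "y \<in> S" for y
      using that M V0 \<epsilon> k by (auto simp: S_def intro!: divide_right_mono)
    obtain p1 where "p1 \<in> S" "q p1 \<le> 0" using exists_q_nonpos by blast
    then have \<sigma>0: "\<sigma> \<ge> 0" using qV[of p1] by (simp add: q\<sigma>)
    obtain p2 where p2: "p2 \<in> S" "q p2 \<ge> - 2 * CARD('n) / (r / t)\<^sup>2"
    proof -
      have "CARD('n) < 2 * (r / t)\<^sup>2"
      proof -
        have "N < k * r\<^sup>2" using kN r(1) by (simp add: field_simps)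
        also have "k * r\<^sup>2 = (r / t)\<^sup>2" using k by (simp add: power_divide t2)
        also have "\<dots> \<le> 2 * (r / t)\<^sup>2" by simp
        finally show ?thesis by (simp add: N_def)
      qed
      moreover have "cball 0 (r / t) \<subseteq> S" using t by (intro big) simp
      ultimately show thesis using exists_q_ge[of "r / t"] r(1) t(1) that by auto
    qed
    have "\<sigma> \<le> D / k"
    proof -
      have "- 2 * CARD('n) / (r / t)\<^sup>2 = - (2 * N / r\<^sup>2 / k)"
        using r(1) k by (simp add: power_divide t2 N_def)
      then have "\<sigma> \<le> M / (\<epsilon> * k) + 2 * N / r\<^sup>2 / k" using p2 qV[of p2] unfolding q\<sigma> by linarith
      also have "\<dots> = D / k" by (simp add: D_def add_divide_distrib)
      finally show ?thesis .
    qed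
    moreover have "M / (\<epsilon> * k) \<le> D / k"
    proof -
      have "M / \<epsilon> \<le> D" using N by (simp add: D_def)
      then have "M / \<epsilon> / k \<le> D / k" using k by (intro divide_right_mono) auto
      then show ?thesis by simp
    qed
    moreover have "D / k \<le> \<eta>" using kD \<eta> k by (simp add: field_simps)
    ultimately have q_small: "\<bar>q y\<bar> \<le> \<eta>" if "y \<in> S" for y
      using qV[OF that] \<sigma>0 unfolding q\<sigma> by linarith
    have q_holder: "\<bar>q x - q y\<bar> \<le> \<eta> * dist x y powr \<gamma>" if "x \<in> cball 0 3" "y \<in> cball 0 3" for x y
    proof -
      have "cball (0::real^'n) 3 \<subseteq> cball 0 (5 * (real CARD('n) + 5))" by (rule subset_cball) simp
      then have "x \<in> S" "y \<in> S" using that ball by blast+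
      then have xy: "t *\<^sub>R x \<in> closure \<Omega>" "t *\<^sub>R y \<in> closure \<Omega>" using cl by (simp_all add: S_def)
      have "\<bar>V (t *\<^sub>R x) - V (t *\<^sub>R y)\<bar> \<le> C * dist (t *\<^sub>R x) (t *\<^sub>R y) powr \<gamma>" by (rule C(2)[OF xy])
      also have "\<dots> \<le> C * dist x y powr \<gamma>"
      proof (intro mult_left_mono powr_mono2)
        show "dist (t *\<^sub>R x) (t *\<^sub>R y) \<le> dist x y"
          using t mult_right_mono[of t 1 "norm (x - y)"] by (simp add: dist_norm flip: scaleR_diff_right)
      qed (use C \<gamma> in auto)
      finally have "\<bar>V (t *\<^sub>R x) - V (t *\<^sub>R y)\<bar> / (\<epsilon> * k) \<le> C * dist x y powr \<gamma> / (\<epsilon> * k)"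
        using \<epsilon> k by (intro divide_right_mono) auto
      moreover have "\<bar>q x - q y\<bar> = \<bar>V (t *\<^sub>R x) - V (t *\<^sub>R y)\<bar> / (\<epsilon> * k)"
        using \<epsilon> k by (simp add: q\<sigma> flip: diff_divide_distrib)
      moreover have "C / (\<epsilon> * k) \<le> \<eta>" using kC \<eta> \<epsilon> k by (simp add: field_simps)
      then have "C / (\<epsilon> * k) * dist x y powr \<gamma> \<le> \<eta> * dist x y powr \<gamma>" by (intro mult_right_mono) auto
      ultimately show ?thesis by simp
    qed
    obtain d where d: "d \<in> S" "\<forall>x\<in>closure S. W x \<le> W d"
      and du: "\<And>e. e \<in> S \<Longrightarrow> \<forall>x\<in>closure S. W x \<le> W e \<Longrightarrow> e = d"
      using uniq[rule_format, OF os ball q_small q_holder] by blast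
    have clS: "closure S = {y. t *\<^sub>R y \<in> closure \<Omega>}" unfolding S_def using t by (intro closure_scaled_preimage) simp
    have resc: "t *\<^sub>R (1 / t) *\<^sub>R x = x" for x :: "real^'n" using t by simp
    show ?thesis
    proof (rule ex1I[of _ "t *\<^sub>R d"])
      have "u \<alpha> x \<le> u \<alpha> (t *\<^sub>R d)" if "x \<in> closure \<Omega>" for x
        using d(2) that resc[of x] unfolding clS W_def by (metis mem_Collect_eq)
      then show "t *\<^sub>R d \<in> \<Omega> \<and> (\<forall>x\<in>closure \<Omega>. u \<alpha> x \<le> u \<alpha> (t *\<^sub>R d))" using d(1) by (simp add: S_def)
      fix e assume e: "e \<in> \<Omega> \<and> (\<forall>x\<in>closure \<Omega>. u \<alpha> x \<le> u \<alpha> e)"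
      have "(1 / t) *\<^sub>R e = d"
      proof (rule du)
        show "(1 / t) *\<^sub>R e \<in> S" unfolding S_def mem_Collect_eq resc using e by blast
        show "\<forall>x\<in>closure S. W x \<le> W ((1 / t) *\<^sub>R e)" unfolding clS W_def resc using e by blast
      qed
      then show "e = t *\<^sub>R d" using resc[of e] by metis
    qed
  qed
  then have "\<exists>!d. d \<in> \<Omega> \<and> (\<forall>x\<in>closure \<Omega>. u \<alpha> x \<le> u \<alpha> d)"
    if "\<alpha> \<ge> max 1 (k0 * \<epsilon> / (2 * A))" for \<alpha>
    using that by simp
  then show ?thesis unfolding eventually_at_top_linorder by blast
qed

end
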